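(* Let $\mathcal{G}$ be a 2-group. For any $\mathcal{V}\in 2\mathrm{Rep}(\mathcal{G})$, the 2-character $\chi_{\mathcal{V}}\in\mathrm{Fun}(\mathcal{G},\mathrm{Vec})^{\mathcal{G}}$ is a $\mathrm{B}\mathbb{Z}$-fixed point.
   Context: $k$ is an algebraically closed field of characteristic $0$ and $\mathrm{Vec}$ is the category of finite-dimensional $k$-vector spaces. A 2-group $\mathcal{G}$ is a monoidal category in which every object is invertible and every morphism is an isomorphism; $e$ is the tensor unit. For each object $g$ a left dual $g^*$ is fixed with isomorphisms $\mathrm{ev}_g\colon g^*\otimes g\to e$, $\mathrm{coev}_g\colon e\to g\otimes g^*$ (whose inverses exhibit $g^*$ also as a right dual); for $a\colon g\to h$, $a^*\colon g^*\to h^*$ is the inverse of the dual morphism $a^L\colon h^*\to g^*$. $2\mathrm{Rep}(\mathcal{G})$ is the 2-category of finite semisimple 2-representations: an object is a finite semisimple $k$-linear category $\mathcal{V}$ with a left $\mathcal{G}$-module structure $\odot$ by $k$-linear functors. The category $\mathrm{Fun}(\mathcal{G},\mathrm{Vec})^{\mathcal{G}}$ of class functors has as objects pairs $(F,\psi)$ with $F\colon\mathcal{G}\to\mathrm{Vec}$ a functor and isomorphisms $\psi_{g,x}\colon F(x)\to F((g\otimes x)\otimes g^* )$ natural in $x$, such that for all $g,h,x$ and $a\colon g\to h$: $\psi_{g,(h\otimes x)\otimes h^*}\circ\psi_{h,x}$ equals $\psi_{g\otimes h,x}$ followed by the canonical isomorphism $F(((g\otimes h)\otimes x)\otimes(g\otimes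 h)^* )\simeq F((g\otimes((h\otimes x)\otimes h^* ))\otimes g^* )$, and $F((a\otimes 1_x)\otimes a^* )\circ\psi_{g,x}=\psi_{h,x}$. Morphisms are natural transformations commuting with the $\psi_{g,x}$. The 2-character is $\chi_{\mathcal{V}}(x)=\mathrm{Nat}(1_{\mathcal{V}},x\odot-)$ (morphisms of $\mathcal{G}$ acting by post-composition), regarded as an object of $\mathrm{Fun}(\mathcal{G},\mathrm{Vec})^{\mathcal{G}}$ via $\psi_{g,x}$ sending $\alpha\colon 1_{\mathcal{V}}\Rightarrow x\odot-$ to the natural transformation with components $v\simeq g\odot(g^*\odot v)\xrightarrow{1\odot\alpha_{g^*\odot v}}g\odot(x\odot(g^*\odot v))\simeq((g\otimes x)\otimes g^* )\odot v$. There is a $\mathrm{B}\mathbb{Z}$-action on $\mathrm{Fun}(\mathcal{G},\mathrm{Vec})^{\mathcal{G}}$, where $\mathrm{B}\mathbb{Z}$ is the 2-group with one object and automorphism group $\mathbb{Z}$. It is given by the natural automorphism $\phi$ of the identity functor with $$(\phi_{(F,\psi)})_g:=\bigl(F(g)\xrightarrow{\psi_{g,g}}F((g\otimes g)\otimes g^* )\simeq F(g)\bigr),\qquad g\in\mathcal{G},$$ the last isomorphism being $F$ applied to $(g\otimes g)\otimes g^*\simeq g\otimes(g\otimes g^* )\simeq g\otimes e\simeq g$. For a class functor, being a $\mathrm{B}\mathbb{Z}$-fixed point is a property and not extra structure: $(F,\psi)$ is a $\mathrm{B}\mathbb{Z}$-fixed point if and only if $\phi_{(F,\psi)}$ is the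 identity. *)

theory Defs
  imports "HOL-Algebra.Algebraic_Closure" "Jordan_Normal_Form.Missing_VectorSpace"
begin

section \<open>Categories, functors and natural transformations\<close>

record ('o, 'm) cat =
  Obj :: "'o set"
  Arr :: "'m set"
  Src :: "'m \<Rightarrow> 'o"
  Tgt :: "'m \<Rightarrow> 'o"
  Idn :: "'o \<Rightarrow> 'm"
  Cmp :: "'m \<Rightarrow> 'm \<Rightarrow> 'm" (infixr \<open>\<bullet>\<index>\<close> 55)

definition Hom :: "('o, 'm, 'z) cat_scheme \<Rightarrow> 'o \<Rightarrow> 'o \<Rightarrow> 'm set" where
  "Hom C a b = {f \<in> Arr C. Src C f = a \<and> Tgt C f = b}"

locale category =
  fixes C :: "('o, 'm, 'z) cat_scheme" (structure)
  assumes Src_closed: "f \<in> Arr C \<Longrightarrow> Src C f \<in> Obj C"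
    and Tgt_closed: "f \<in> Arr C \<Longrightarrow> Tgt C f \<in> Obj C"
    and Idn_in_Hom: "a \<in> Obj C \<Longrightarrow> Idn C a \<in> Hom C a a"
    and Cmp_in_Hom: "\<lbrakk>f \<in> Hom C a b; g \<in> Hom C b c\<rbrakk> \<Longrightarrow> g \<bullet> f \<in> Hom C a c"
    and Cmp_Idn: "f \<in> Hom C a b \<Longrightarrow> f \<bullet> Idn C a = f"
    and Idn_Cmp: "f \<in> Hom C a b \<Longrightarrow> Idn C b \<bullet> f = f"
    and Cmp_assoc: "\<lbrakk>f \<in> Hom C a b; g \<in> Hom C b c; h \<in> Hom C c d\<rbrakk>
      \<Longrightarrow> (h \<bullet> g) \<bullet> f = h \<bullet> (g \<bullet> f)"

definition inverse_arrows :: "('o, 'm, 'z) cat_scheme \<Rightarrow> 'm \<Rightarrow> 'm \<Rightarrow> bool" where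
  "inverse_arrows C f g \<longleftrightarrow>
     f \<in> Arr C \<and> g \<in> Hom C (Tgt C f) (Src C f) \<and>
     g \<bullet>\<^bsub>C\<^esub> f = Idn C (Src C f) \<and> f \<bullet>\<^bsub>C\<^esub> g = Idn C (Tgt C f)"

definition iso_arrow :: "('o, 'm, 'z) cat_scheme \<Rightarrow> 'm \<Rightarrow> bool" where
  "iso_arrow C f \<longleftrightarrow> (\<exists>g. inverse_arrows C f g)"

definition inv_arrow :: "('o, 'm, 'z) cat_scheme \<Rightarrow> 'm \<Rightarrow> 'm" where
  "inv_arrow C f = (THE g. inverse_arrows C f g)"

definition isomorphic :: "('o, 'm, 'z) cat_scheme \<Rightarrow> 'o \<Rightarrow> 'o \<Rightarrow> bool" where
  "isomorphic C a b \<longleftrightarrow> (\<exists>f \<in> Hom C a b. iso_arrow C f)"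

record ('o1, 'm1, 'o2, 'm2) functr =
  FObj :: "'o1 \<Rightarrow> 'o2"
  FArr :: "'m1 \<Rightarrow> 'm2"

locale functor_between = A: category A + B: category B
  for A :: "('o1, 'm1, 'z1) cat_scheme" and B :: "('o2, 'm2, 'z2) cat_scheme" +
  fixes F :: "('o1, 'm1, 'o2, 'm2) functr"
  assumes FObj_closed: "a \<in> Obj A \<Longrightarrow> FObj F a \<in> Obj B"
    and FArr_in_Hom: "f \<in> Hom A a b \<Longrightarrow> FArr F f \<in> Hom B (FObj F a) (FObj F b)"
    and FArr_Idn: "a \<in> Obj A \<Longrightarrow> FArr F (Idn A a) = Idn B (FObj F a)"
    and FArr_Cmp: "\<lbrakk>f \<in> Hom A a b; g \<in> Hom A b c\<rbrakk>
      \<Longrightarrow> FArr F (g \<bullet>\<^bsub>A\<^esub> f) = FArr F g \<bullet>\<^bsub>B\<^esub> FArr F f"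

locale bifunctor = A: category A + B: category B + C: category C
  for A :: "('o1, 'm1, 'z1) cat_scheme" and B :: "('o2, 'm2, 'z2) cat_scheme"
    and C :: "('o3, 'm3, 'z3) cat_scheme" +
  fixes TO :: "'o1 \<Rightarrow> 'o2 \<Rightarrow> 'o3" and TA :: "'m1 \<Rightarrow> 'm2 \<Rightarrow> 'm3"
  assumes TO_closed: "\<lbrakk>a \<in> Obj A; b \<in> Obj B\<rbrakk> \<Longrightarrow> TO a b \<in> Obj C"
    and TA_in_Hom: "\<lbrakk>f \<in> Hom A a a'; g \<in> Hom B b b'\<rbrakk> \<Longrightarrow> TA f g \<in> Hom C (TO a b) (TO a' b')"
    and TA_Idn: "\<lbrakk>a \<in> Obj A; b \<in> Obj B\<rbrakk> \<Longrightarrow> TA (Idn A a) (Idn B b) = Idn C (TO a b)"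
    and TA_Cmp: "\<lbrakk>f \<in> Hom A a a'; f' \<in> Hom A a' a''; g \<in> Hom B b b'; g' \<in> Hom B b' b''\<rbrakk>
      \<Longrightarrow> TA (f' \<bullet>\<^bsub>A\<^esub> f) (g' \<bullet>\<^bsub>B\<^esub> g) = TA f' g' \<bullet>\<^bsub>C\<^esub> TA f g"

text \<open>Families indexed by the objects are taken to be extensional, so that equality of
  natural transformations is equality of all components.\<close>

definition nat_trans ::
  "('o1, 'm1, 'z1) cat_scheme \<Rightarrow> ('o2, 'm2, 'z2) cat_scheme
   \<Rightarrow> ('o1, 'm1, 'o2, 'm2) functr \<Rightarrow> ('o1, 'm1, 'o2, 'm2) functr \<Rightarrow> ('o1 \<Rightarrow> 'm2) set" where
  "nat_trans A B F F' =
     {\<eta> \<in> extensional (Obj A).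
        (\<forall>a \<in> Obj A. \<eta> a \<in> Hom B (FObj F a) (FObj F' a)) \<and>
        (\<forall>f \<in> Arr A. \<eta> (Tgt A f) \<bullet>\<^bsub>B\<^esub> FArr F f = FArr F' f \<bullet>\<^bsub>B\<^esub> \<eta> (Src A f))}"

definition id_functr :: "('o, 'm, 'o, 'm) functr" where
  "id_functr = \<lparr>FObj = (\<lambda>a. a), FArr = (\<lambda>f. f)\<rparr>"


section \<open>Monoidal categories and 2-groups\<close>

record ('o, 'm) moncat = "('o, 'm) cat" +
  TenO :: "'o \<Rightarrow> 'o \<Rightarrow> 'o" (infixr \<open>\<otimes>\<^sub>o\<index>\<close> 70)
  TenA :: "'m \<Rightarrow> 'm \<Rightarrow> 'm" (infixr \<open>\<otimes>\<^sub>a\<index>\<close> 70)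
  UnitO :: "'o"
  Assoc :: "'o \<Rightarrow> 'o \<Rightarrow> 'o \<Rightarrow> 'm"
  LUnit :: "'o \<Rightarrow> 'm"
  RUnit :: "'o \<Rightarrow> 'm"

locale monoidal_category = category G + bifunctor G G G "TenO G" "TenA G"
  for G :: "('o, 'm, 'z) moncat_scheme" (structure) +
  assumes UnitO_closed: "UnitO G \<in> Obj G"
    and Assoc_in_Hom: "\<lbrakk>a \<in> Obj G; b \<in> Obj G; c \<in> Obj G\<rbrakk>
      \<Longrightarrow> Assoc G a b c \<in> Hom G ((a \<otimes>\<^sub>o b) \<otimes>\<^sub>o c) (a \<otimes>\<^sub>o (b \<otimes>\<^sub>o c))"
    and Assoc_iso: "\<lbrakk>a \<in> Obj G; b \<in> Obj G; c \<in> Obj G\<rbrakk> \<Longrightarrow> iso_arrow G (Assoc G a b c)"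
    and Assoc_natural: "\<lbrakk>f \<in> Hom G a a'; g \<in> Hom G b b'; h \<in> Hom G c c'\<rbrakk>
      \<Longrightarrow> Assoc G a' b' c' \<bullet> ((f \<otimes>\<^sub>a g) \<otimes>\<^sub>a h) = (f \<otimes>\<^sub>a (g \<otimes>\<^sub>a h)) \<bullet> Assoc G a b c"
    and LUnit_in_Hom: "a \<in> Obj G \<Longrightarrow> LUnit G a \<in> Hom G (UnitO G \<otimes>\<^sub>o a) a"
    and LUnit_iso: "a \<in> Obj G \<Longrightarrow> iso_arrow G (LUnit G a)"
    and LUnit_natural: "f \<in> Hom G a b
      \<Longrightarrow> LUnit G b \<bullet> (Idn G (UnitO G) \<otimes>\<^sub>a f) = f \<bullet> LUnit G a"
    and RUnit_in_Hom: "a \<in> Obj G \<Longrightarrow> RUnit G a \<in> Hom G (a \<otimes>\<^sub>o UnitO G) a"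
    and RUnit_iso: "a \<in> Obj G \<Longrightarrow> iso_arrow G (RUnit G a)"
    and RUnit_natural: "f \<in> Hom G a b
      \<Longrightarrow> RUnit G b \<bullet> (f \<otimes>\<^sub>a Idn G (UnitO G)) = f \<bullet> RUnit G a"
    and pentagon: "\<lbrakk>a \<in> Obj G; b \<in> Obj G; c \<in> Obj G; d \<in> Obj G\<rbrakk>
      \<Longrightarrow> (Idn G a \<otimes>\<^sub>a Assoc G b c d) \<bullet> Assoc G a (b \<otimes>\<^sub>o c) d \<bullet> (Assoc G a b c \<otimes>\<^sub>a Idn G d)
          = Assoc G a b (c \<otimes>\<^sub>o d) \<bullet> Assoc G (a \<otimes>\<^sub>o b) c d"
    and triangle: "\<lbrakk>a \<in> Obj G; b \<in> Obj G\<rbrakk>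
      \<Longrightarrow> (Idn G a \<otimes>\<^sub>a LUnit G b) \<bullet> Assoc G a (UnitO G) b = RUnit G a \<otimes>\<^sub>a Idn G b"

text \<open>The chosen left duals are part of the data. In a groupoid the inverses of the evaluation
  and coevaluation satisfy the zigzag identities of a right dual automatically (invert the two
  identities below).\<close>

record ('o, 'm) dual_moncat = "('o, 'm) moncat" +
  DualO :: "'o \<Rightarrow> 'o"
  Ev :: "'o \<Rightarrow> 'm"
  Coev :: "'o \<Rightarrow> 'm"

locale two_group = monoidal_category G
  for G :: "('o, 'm, 'z) dual_moncat_scheme" (structure) +
  assumes arrows_iso: "f \<in> Arr G \<Longrightarrow> iso_arrow G f"
    and objects_invertible: "g \<in> Obj G \<Longrightarrow> \<exists>h \<in> Obj G.
      isomorphic G (g \<otimes>\<^sub>o h) (UnitO G) \<and> isomorphic G (h \<otimes>\<^sub>o g) (UnitO G)"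
    and DualO_closed: "g \<in> Obj G \<Longrightarrow> DualO G g \<in> Obj G"
    and Ev_in_Hom: "g \<in> Obj G \<Longrightarrow> Ev G g \<in> Hom G (DualO G g \<otimes>\<^sub>o g) (UnitO G)"
    and Coev_in_Hom: "g \<in> Obj G \<Longrightarrow> Coev G g \<in> Hom G (UnitO G) (g \<otimes>\<^sub>o DualO G g)"
    and zigzag: "g \<in> Obj G \<Longrightarrow>
      RUnit G g \<bullet> (Idn G g \<otimes>\<^sub>a Ev G g) \<bullet> Assoc G g (DualO G g) g
        \<bullet> (Coev G g \<otimes>\<^sub>a Idn G g) \<bullet> inv_arrow G (LUnit G g) = Idn G g"
    and zigzag_dual: "g \<in> Obj G \<Longrightarrow>
      LUnit G (DualO G g) \<bullet> (Ev G g \<otimes>\<^sub>a Idn G (DualO G g))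
        \<bullet> inv_arrow G (Assoc G (DualO G g) g (DualO G g))
        \<bullet> (Idn G (DualO G g) \<otimes>\<^sub>a Coev G g) \<bullet> inv_arrow G (RUnit G (DualO G g))
        = Idn G (DualO G g)"

context
  fixes G :: "('o, 'm, 'z) dual_moncat_scheme" (structure)
begin

text \<open>The mate \<open>d \<rightarrow> d'\<close> of \<open>a : x \<rightarrow> y\<close>, where \<open>d\<close> is a left dual of \<open>y\<close> with evaluation
  \<open>\<epsilon> : d \<otimes> y \<rightarrow> e\<close> and \<open>d'\<close> is a left dual of \<open>x\<close> with coevaluation \<open>\<eta> : e \<rightarrow> x \<otimes> d'\<close>.\<close>

definition mate :: "'o \<Rightarrow> 'o \<Rightarrow> 'm \<Rightarrow> 'o \<Rightarrow> 'm \<Rightarrow> 'm \<Rightarrow> 'm" where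
  "mate y d \<epsilon> d' \<eta> a =
     LUnit G d' \<bullet> (\<epsilon> \<otimes>\<^sub>a Idn G d') \<bullet> inv_arrow G (Assoc G d y d')
       \<bullet> (Idn G d \<otimes>\<^sub>a (a \<otimes>\<^sub>a Idn G d')) \<bullet> (Idn G d \<otimes>\<^sub>a \<eta>) \<bullet> inv_arrow G (RUnit G d)"

text \<open>\<open>a\<^sup>L : h\<^sup>* \<rightarrow> g\<^sup>*\<close> for \<open>a : g \<rightarrow> h\<close>, and its inverse \<open>a\<^sup>* : g\<^sup>* \<rightarrow> h\<^sup>*\<close>.\<close>

definition left_dual_arrow :: "'m \<Rightarrow> 'm" where
  "left_dual_arrow a =
     mate (Tgt G a) (DualO G (Tgt G a)) (Ev G (Tgt G a)) (DualO G (Src G a)) (Coev G (Src G a)) a"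

definition star_arrow :: "'m \<Rightarrow> 'm" where
  "star_arrow a = inv_arrow G (left_dual_arrow a)"

text \<open>The coevaluation \<open>e \<rightarrow> (g \<otimes> h) \<otimes> (h\<^sup>* \<otimes> g\<^sup>*)\<close> exhibiting \<open>h\<^sup>* \<otimes> g\<^sup>*\<close> as a left dual of
  \<open>g \<otimes> h\<close>, and the resulting comparison \<open>(g \<otimes> h)\<^sup>* \<rightarrow> h\<^sup>* \<otimes> g\<^sup>*\<close> with the chosen dual.\<close>

definition coev_tensor :: "'o \<Rightarrow> 'o \<Rightarrow> 'm" where
  "coev_tensor g h =
     inv_arrow G (Assoc G g h (DualO G h \<otimes>\<^sub>o DualO G g))
       \<bullet> (Idn G g \<otimes>\<^sub>a Assoc G h (DualO G h) (DualO G g))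
       \<bullet> (Idn G g \<otimes>\<^sub>a (Coev G h \<otimes>\<^sub>a Idn G (DualO G g)))
       \<bullet> (Idn G g \<otimes>\<^sub>a inv_arrow G (LUnit G (DualO G g)))
       \<bullet> Coev G g"

definition dual_tensor_iso :: "'o \<Rightarrow> 'o \<Rightarrow> 'm" where
  "dual_tensor_iso g h =
     mate (g \<otimes>\<^sub>o h) (DualO G (g \<otimes>\<^sub>o h)) (Ev G (g \<otimes>\<^sub>o h))
       (DualO G h \<otimes>\<^sub>o DualO G g) (coev_tensor g h) (Idn G (g \<otimes>\<^sub>o h))"

definition conj_obj :: "'o \<Rightarrow> 'o \<Rightarrow> 'o" where
  "conj_obj g x = (g \<otimes>\<^sub>o x) \<otimes>\<^sub>o DualO G g"

text \<open>The canonical isomorphism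
  \<open>((g \<otimes> h) \<otimes> x) \<otimes> (g \<otimes> h)\<^sup>* \<rightarrow> (g \<otimes> ((h \<otimes> x) \<otimes> h\<^sup>*)) \<otimes> g\<^sup>*\<close>.\<close>

definition conj_tensor_iso :: "'o \<Rightarrow> 'o \<Rightarrow> 'o \<Rightarrow> 'm" where
  "conj_tensor_iso g h x =
     (Assoc G g (h \<otimes>\<^sub>o x) (DualO G h) \<otimes>\<^sub>a Idn G (DualO G g))
       \<bullet> inv_arrow G (Assoc G (g \<otimes>\<^sub>o (h \<otimes>\<^sub>o x)) (DualO G h) (DualO G g))
       \<bullet> (Assoc G g h x \<otimes>\<^sub>a Idn G (DualO G h \<otimes>\<^sub>o DualO G g))
       \<bullet> (Idn G ((g \<otimes>\<^sub>o h) \<otimes>\<^sub>o x) \<otimes>\<^sub>a dual_tensor_iso g h)"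

text \<open>The isomorphism \<open>(g \<otimes> g) \<otimes> g\<^sup>* \<rightarrow> g \<otimes> (g \<otimes> g\<^sup>*) \<rightarrow> g \<otimes> e \<rightarrow> g\<close>.\<close>

definition conj_self_iso :: "'o \<Rightarrow> 'm" where
  "conj_self_iso g =
     RUnit G g \<bullet> (Idn G g \<otimes>\<^sub>a inv_arrow G (Coev G g)) \<bullet> Assoc G g g (DualO G g)"

end


section \<open>Finite-dimensional vector spaces\<close>

locale alg_closed_field_char_0 = algebraically_closed K
  for K :: "('k, 'z) ring_scheme" (structure) +
  assumes char_0: "[n] \<cdot> \<one> = \<zero> \<Longrightarrow> n = (0::nat)"

definition fd_vectorspace :: "('k, 'z) ring_scheme \<Rightarrow> ('k, 'v, 'w) module_scheme \<Rightarrow> bool" where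
  "fd_vectorspace K U \<longleftrightarrow> vectorspace K U \<and> vectorspace.fin_dim K U"

text \<open>The category of finite-dimensional vector spaces whose vectors are drawn from the type
  \<open>'v\<close>; the 2-character below uses \<open>'v = 'vo \<Rightarrow> 'vm\<close>. An arrow is a triple consisting of source, linear map and target; the ring components
  \<open>mult\<close> and \<open>one\<close> of the record type \<open>module\<close> play no role.\<close>

type_synonym ('k, 'v) vec_arrow = "('k, 'v) module \<times> ('v \<Rightarrow> 'v) \<times> ('k, 'v) module"

definition Vec :: "('k, 'z) ring_scheme \<Rightarrow> (('k, 'v) module, ('k, 'v) vec_arrow) cat" where
  "Vec K =
     \<lparr>Obj = {U. fd_vectorspace K U},
      Arr = {(U, f, W). fd_vectorspace K U \<and> fd_vectorspace K W \<and>
                        f \<in> LinearCombinations.module_hom K U W \<and> f \<in> extensional (carrier U)},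
      Src = (\<lambda>(U, f, W). U),
      Tgt = (\<lambda>(U, f, W). W),
      Idn = (\<lambda>U. (U, \<lambda>u\<in>carrier U. u, U)),
      Cmp = (\<lambda>(U', g, W) (U, f, W'). (U, compose (carrier U) g f, W))\<rparr>"


section \<open>Finite semisimple linear categories\<close>

record ('k, 'o, 'm) lincat = "('o, 'm) cat" +
  HomSp :: "'o \<Rightarrow> 'o \<Rightarrow> ('k, 'm) module"

locale linear_category = category C
  for K :: "('k, 'y) ring_scheme" and C :: "('k, 'o, 'm, 'z) lincat_scheme" (structure) +
  assumes HomSp_carrier: "\<lbrakk>a \<in> Obj C; b \<in> Obj C\<rbrakk> \<Longrightarrow> carrier (HomSp C a b) = Hom C a b"
    and HomSp_vectorspace: "\<lbrakk>a \<in> Obj C; b \<in> Obj C\<rbrakk> \<Longrightarrow> vectorspace K (HomSp C a b)"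
    and Cmp_linear_right: "\<lbrakk>a \<in> Obj C; g \<in> Hom C b c\<rbrakk>
      \<Longrightarrow> linear_map K (HomSp C a b) (HomSp C a c) (\<lambda>f. g \<bullet> f)"
    and Cmp_linear_left: "\<lbrakk>f \<in> Hom C a b; c \<in> Obj C\<rbrakk>
      \<Longrightarrow> linear_map K (HomSp C b c) (HomSp C a c) (\<lambda>g. g \<bullet> f)"

context
  fixes C :: "('k, 'o, 'm, 'z) lincat_scheme" (structure)
begin

definition zero_object :: "'o \<Rightarrow> bool" where
  "zero_object z \<longleftrightarrow>
     z \<in> Obj C \<and> (\<forall>a \<in> Obj C. (\<exists>!f. f \<in> Hom C a z) \<and> (\<exists>!f. f \<in> Hom C z a))"

definition mono_arrow :: "'m \<Rightarrow> bool" where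
  "mono_arrow m \<longleftrightarrow> m \<in> Arr C \<and>
     (\<forall>d. \<forall>f \<in> Hom C d (Src C m). \<forall>g \<in> Hom C d (Src C m). m \<bullet> f = m \<bullet> g \<longrightarrow> f = g)"

definition epi_arrow :: "'m \<Rightarrow> bool" where
  "epi_arrow q \<longleftrightarrow> q \<in> Arr C \<and>
     (\<forall>d. \<forall>f \<in> Hom C (Tgt C q) d. \<forall>g \<in> Hom C (Tgt C q) d. f \<bullet> q = g \<bullet> q \<longrightarrow> f = g)"

definition is_kernel :: "'m \<Rightarrow> 'm \<Rightarrow> bool" where
  "is_kernel f i \<longleftrightarrow> f \<in> Arr C \<and> i \<in> Arr C \<and> Tgt C i = Src C f \<and>
     f \<bullet> i = \<zero>\<^bsub>HomSp C (Src C i) (Tgt C f)\<^esub> \<and>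
     (\<forall>d. \<forall>t \<in> Hom C d (Src C f). f \<bullet> t = \<zero>\<^bsub>HomSp C d (Tgt C f)\<^esub>
        \<longrightarrow> (\<exists>!u. u \<in> Hom C d (Src C i) \<and> i \<bullet> u = t))"

definition is_cokernel :: "'m \<Rightarrow> 'm \<Rightarrow> bool" where
  "is_cokernel f q \<longleftrightarrow> f \<in> Arr C \<and> q \<in> Arr C \<and> Src C q = Tgt C f \<and>
     q \<bullet> f = \<zero>\<^bsub>HomSp C (Src C f) (Tgt C q)\<^esub> \<and>
     (\<forall>d. \<forall>t \<in> Hom C (Tgt C f) d. t \<bullet> f = \<zero>\<^bsub>HomSp C (Src C f) d\<^esub>
        \<longrightarrow> (\<exists>!u. u \<in> Hom C (Tgt C q) d \<and> u \<bullet> q = t))"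

text \<open>\<open>a\<close> is the direct sum of \<open>s 0, \<dots>, s (n - 1)\<close> with inclusions \<open>\<iota>\<close> and projections \<open>\<pi>\<close>;
  for \<open>n = 0\<close> this says that \<open>a\<close> is a zero object.\<close>

definition is_direct_sum ::
  "nat \<Rightarrow> (nat \<Rightarrow> 'o) \<Rightarrow> 'o \<Rightarrow> (nat \<Rightarrow> 'm) \<Rightarrow> (nat \<Rightarrow> 'm) \<Rightarrow> bool" where
  "is_direct_sum n s a \<iota> \<pi> \<longleftrightarrow> a \<in> Obj C \<and>
     (\<forall>j<n. \<iota> j \<in> Hom C (s j) a \<and> \<pi> j \<in> Hom C a (s j)) \<and>
     (\<forall>i<n. \<forall>j<n. \<pi> i \<bullet> \<iota> j = (if i = j then Idn C (s i) else \<zero>\<^bsub>HomSp C (s j) (s i)\<^esub>)) \<and>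
     finsum (HomSp C a a) (\<lambda>j. \<iota> j \<bullet> \<pi> j) {..<n} = Idn C a"

definition simple_object :: "'o \<Rightarrow> bool" where
  "simple_object s \<longleftrightarrow> s \<in> Obj C \<and> \<not> zero_object s \<and>
     (\<forall>m. mono_arrow m \<and> Tgt C m = s \<longrightarrow> zero_object (Src C m) \<or> iso_arrow C m)"

end

locale abelian_linear_category = linear_category K C
  for K :: "('k, 'y) ring_scheme" and C :: "('k, 'o, 'm, 'z) lincat_scheme" (structure) +
  assumes zero_object_exists: "\<exists>z. zero_object C z"
    and direct_sum_exists: "\<lbrakk>a \<in> Obj C; b \<in> Obj C\<rbrakk>
      \<Longrightarrow> \<exists>c \<iota> \<pi>. is_direct_sum C 2 (\<lambda>j. if j = 0 then a else b) c \<iota> \<pi>"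
    and kernel_exists: "f \<in> Arr C \<Longrightarrow> \<exists>i. is_kernel C f i"
    and cokernel_exists: "f \<in> Arr C \<Longrightarrow> \<exists>q. is_cokernel C f q"
    and mono_is_kernel: "mono_arrow C m \<Longrightarrow> \<exists>f. is_kernel C f m"
    and epi_is_cokernel: "epi_arrow C q \<Longrightarrow> \<exists>f. is_cokernel C f q"

locale finite_semisimple_category = abelian_linear_category K C
  for K :: "('k, 'y) ring_scheme" and C :: "('k, 'o, 'm, 'z) lincat_scheme" (structure) +
  assumes HomSp_fin_dim: "\<lbrakk>a \<in> Obj C; b \<in> Obj C\<rbrakk> \<Longrightarrow> vectorspace.fin_dim K (HomSp C a b)"
    and finitely_many_simples: "\<exists>S. finite S \<and> S \<subseteq> Obj C \<and>
      (\<forall>s. simple_object C s \<longrightarrow> (\<exists>t \<in> S. isomorphic C s t))"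
    and semisimple: "a \<in> Obj C \<Longrightarrow>
      \<exists>n s \<iota> \<pi>. (\<forall>j<n. simple_object C (s j)) \<and> is_direct_sum C n s a \<iota> \<pi>"


section \<open>Finite semisimple 2-representations\<close>

text \<open>\<open>ActAssoc g h v : (g \<otimes> h) \<odot> v \<rightarrow> g \<odot> (h \<odot> v)\<close> and \<open>ActUnit v : e \<odot> v \<rightarrow> v\<close>.\<close>

record ('k, 'go, 'gm, 'vo, 'vm) modcat = "('k, 'vo, 'vm) lincat" +
  ActO :: "'go \<Rightarrow> 'vo \<Rightarrow> 'vo" (infixr \<open>\<odot>\<^sub>o\<index>\<close> 70)
  ActA :: "'gm \<Rightarrow> 'vm \<Rightarrow> 'vm" (infixr \<open>\<odot>\<^sub>a\<index>\<close> 70)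
  ActAssoc :: "'go \<Rightarrow> 'go \<Rightarrow> 'vo \<Rightarrow> 'vm"
  ActUnit :: "'vo \<Rightarrow> 'vm"

definition act_functr ::
  "('go, 'gm, 'y) cat_scheme \<Rightarrow> ('k, 'go, 'gm, 'vo, 'vm, 'z) modcat_scheme \<Rightarrow> 'go
   \<Rightarrow> ('vo, 'vm, 'vo, 'vm) functr" where
  "act_functr G V g = \<lparr>FObj = (\<lambda>v. g \<odot>\<^sub>o\<^bsub>V\<^esub> v), FArr = (\<lambda>f. Idn G g \<odot>\<^sub>a\<^bsub>V\<^esub> f)\<rparr>"

locale two_representation =
  G: two_group G + V: finite_semisimple_category K V + bifunctor G V V "ActO V" "ActA V"
  for K :: "('k, 'x) ring_scheme"
    and G :: "('go, 'gm, 'y) dual_moncat_scheme"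
    and V :: "('k, 'go, 'gm, 'vo, 'vm, 'z) modcat_scheme" (structure) +
  assumes ActA_linear: "\<lbrakk>g \<in> Obj G; v \<in> Obj V; w \<in> Obj V\<rbrakk>
      \<Longrightarrow> linear_map K (HomSp V v w) (HomSp V (g \<odot>\<^sub>o v) (g \<odot>\<^sub>o w)) (\<lambda>f. Idn G g \<odot>\<^sub>a f)"
    and ActAssoc_in_Hom: "\<lbrakk>g \<in> Obj G; h \<in> Obj G; v \<in> Obj V\<rbrakk>
      \<Longrightarrow> ActAssoc V g h v \<in> Hom V ((g \<otimes>\<^sub>o\<^bsub>G\<^esub> h) \<odot>\<^sub>o v) (g \<odot>\<^sub>o (h \<odot>\<^sub>o v))"
    and ActAssoc_iso: "\<lbrakk>g \<in> Obj G; h \<in> Obj G; v \<in> Obj V\<rbrakk> \<Longrightarrow> iso_arrow V (ActAssoc V g h v)"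
    and ActAssoc_natural: "\<lbrakk>a \<in> Hom G g g'; b \<in> Hom G h h'; f \<in> Hom V v v'\<rbrakk>
      \<Longrightarrow> ActAssoc V g' h' v' \<bullet> ((a \<otimes>\<^sub>a\<^bsub>G\<^esub> b) \<odot>\<^sub>a f) = (a \<odot>\<^sub>a (b \<odot>\<^sub>a f)) \<bullet> ActAssoc V g h v"
    and ActUnit_in_Hom: "v \<in> Obj V \<Longrightarrow> ActUnit V v \<in> Hom V (UnitO G \<odot>\<^sub>o v) v"
    and ActUnit_iso: "v \<in> Obj V \<Longrightarrow> iso_arrow V (ActUnit V v)"
    and ActUnit_natural: "f \<in> Hom V v w
      \<Longrightarrow> ActUnit V w \<bullet> (Idn G (UnitO G) \<odot>\<^sub>a f) = f \<bullet> ActUnit V v"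
    and Act_pentagon: "\<lbrakk>g \<in> Obj G; h \<in> Obj G; k \<in> Obj G; v \<in> Obj V\<rbrakk>
      \<Longrightarrow> (Idn G g \<odot>\<^sub>a ActAssoc V h k v) \<bullet> ActAssoc V g (h \<otimes>\<^sub>o\<^bsub>G\<^esub> k) v
            \<bullet> (Assoc G g h k \<odot>\<^sub>a Idn V v)
          = ActAssoc V g h (k \<odot>\<^sub>o v) \<bullet> ActAssoc V (g \<otimes>\<^sub>o\<^bsub>G\<^esub> h) k v"
    and Act_triangle: "\<lbrakk>g \<in> Obj G; v \<in> Obj V\<rbrakk>
      \<Longrightarrow> (Idn G g \<odot>\<^sub>a ActUnit V v) \<bullet> ActAssoc V g (UnitO G) v = RUnit G g \<odot>\<^sub>a Idn V v"


section \<open>Class functors and the circle action\<close>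

text \<open>A candidate object \<open>(F, \<psi>)\<close> of the category of class functors.\<close>

type_synonym ('k, 'go, 'gm, 'v) class_datum =
  "('go, 'gm, ('k, 'v) module, ('k, 'v) vec_arrow) functr \<times> ('go \<Rightarrow> 'go \<Rightarrow> ('k, 'v) vec_arrow)"

definition class_functor ::
  "('k, 'x) ring_scheme \<Rightarrow> ('go, 'gm, 'y) dual_moncat_scheme
   \<Rightarrow> ('k, 'go, 'gm, 'v) class_datum \<Rightarrow> bool" where
  "class_functor K G = (\<lambda>(F, \<psi>).
     functor_between G (Vec K) F \<and>
     (\<forall>g \<in> Obj G. \<forall>x \<in> Obj G.
        \<psi> g x \<in> Hom (Vec K) (FObj F x) (FObj F (conj_obj G g x)) \<and> iso_arrow (Vec K) (\<psi> g x)) \<and>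
     (\<forall>g \<in> Obj G. \<forall>x \<in> Obj G. \<forall>y \<in> Obj G. \<forall>f \<in> Hom G x y.
        \<psi> g y \<bullet>\<^bsub>Vec K\<^esub> FArr F f
        = FArr F ((Idn G g \<otimes>\<^sub>a\<^bsub>G\<^esub> f) \<otimes>\<^sub>a\<^bsub>G\<^esub> Idn G (DualO G g)) \<bullet>\<^bsub>Vec K\<^esub> \<psi> g x) \<and>
     (\<forall>g \<in> Obj G. \<forall>h \<in> Obj G. \<forall>x \<in> Obj G.
        \<psi> g (conj_obj G h x) \<bullet>\<^bsub>Vec K\<^esub> \<psi> h x
        = FArr F (conj_tensor_iso G g h x) \<bullet>\<^bsub>Vec K\<^esub> \<psi> (g \<otimes>\<^sub>o\<^bsub>G\<^esub> h) x) \<and>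
     (\<forall>g \<in> Obj G. \<forall>h \<in> Obj G. \<forall>x \<in> Obj G. \<forall>a \<in> Hom G g h.
        FArr F ((a \<otimes>\<^sub>a\<^bsub>G\<^esub> Idn G x) \<otimes>\<^sub>a\<^bsub>G\<^esub> star_arrow G a) \<bullet>\<^bsub>Vec K\<^esub> \<psi> g x = \<psi> h x))"

definition ClassFun ::
  "('k, 'x) ring_scheme \<Rightarrow> ('go, 'gm, 'y) dual_moncat_scheme
   \<Rightarrow> (('k, 'go, 'gm, 'v) class_datum,
       ('k, 'go, 'gm, 'v) class_datum \<times> ('go \<Rightarrow> ('k, 'v) vec_arrow)
         \<times> ('k, 'go, 'gm, 'v) class_datum) cat" where
  "ClassFun K G =
     \<lparr>Obj = {P. class_functor K G P},
      Arr = {(P, \<eta>, Q). class_functor K G P \<and> class_functor K G Q \<and>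
               \<eta> \<in> nat_trans G (Vec K) (fst P) (fst Q) \<and>
               (\<forall>g \<in> Obj G. \<forall>x \<in> Obj G.
                  snd Q g x \<bullet>\<^bsub>Vec K\<^esub> \<eta> x = \<eta> (conj_obj G g x) \<bullet>\<^bsub>Vec K\<^esub> snd P g x)},
      Src = (\<lambda>(P, \<eta>, Q). P),
      Tgt = (\<lambda>(P, \<eta>, Q). Q),
      Idn = (\<lambda>P. (P, \<lambda>x\<in>Obj G. Idn (Vec K) (FObj (fst P) x), P)),
      Cmp = (\<lambda>(Q', \<theta>, R) (P, \<eta>, Q). (P, \<lambda>x\<in>Obj G. \<theta> x \<bullet>\<^bsub>Vec K\<^esub> \<eta> x, R))\<rparr>"

text \<open>The component at \<open>P\<close> of the natural automorphism of the identity functor which gives the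
  \<open>B\<int>\<close>-action, as an arrow \<open>P \<rightarrow> P\<close> of \<open>ClassFun K G\<close>.\<close>

definition BZ_automorphism ::
  "('k, 'x) ring_scheme \<Rightarrow> ('go, 'gm, 'y) dual_moncat_scheme \<Rightarrow> ('k, 'go, 'gm, 'v) class_datum
   \<Rightarrow> ('k, 'go, 'gm, 'v) class_datum \<times> ('go \<Rightarrow> ('k, 'v) vec_arrow)
       \<times> ('k, 'go, 'gm, 'v) class_datum" where
  "BZ_automorphism K G P =
     (P, \<lambda>g\<in>Obj G. FArr (fst P) (conj_self_iso G g) \<bullet>\<^bsub>Vec K\<^esub> snd P g g, P)"

definition BZ_fixed_point ::
  "('k, 'x) ring_scheme \<Rightarrow> ('go, 'gm, 'y) dual_moncat_scheme
   \<Rightarrow> ('k, 'go, 'gm, 'v) class_datum \<Rightarrow> bool" where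
  "BZ_fixed_point K G P \<longleftrightarrow>
     P \<in> Obj (ClassFun K G) \<and> BZ_automorphism K G P = Idn (ClassFun K G) P"


section \<open>The 2-character\<close>

definition nat_space ::
  "('o1, 'm1, 'y) cat_scheme \<Rightarrow> ('k, 'o2, 'm2, 'z) lincat_scheme
   \<Rightarrow> ('o1, 'm1, 'o2, 'm2) functr \<Rightarrow> ('o1, 'm1, 'o2, 'm2) functr
   \<Rightarrow> ('k, 'o1 \<Rightarrow> 'm2) module" where
  "nat_space A B F F' =
     \<lparr>carrier = nat_trans A B F F',
      monoid.mult = undefined,
      one = undefined,
      zero = (\<lambda>a\<in>Obj A. \<zero>\<^bsub>HomSp B (FObj F a) (FObj F' a)\<^esub>),
      add = (\<lambda>\<alpha> \<beta>. \<lambda>a\<in>Obj A. \<alpha> a \<oplus>\<^bsub>HomSp B (FObj F a) (FObj F' a)\<^esub> \<beta> a),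
      smult = (\<lambda>c \<alpha>. \<lambda>a\<in>Obj A. c \<odot>\<^bsub>HomSp B (FObj F a) (FObj F' a)\<^esub> \<alpha> a)\<rparr>"

context
  fixes G :: "('go, 'gm, 'y) dual_moncat_scheme"
    and V :: "('k, 'go, 'gm, 'vo, 'vm, 'z) modcat_scheme" (structure)
begin

definition char_space :: "'go \<Rightarrow> ('k, 'vo \<Rightarrow> 'vm) module" where
  "char_space x = nat_space V V id_functr (act_functr G V x)"

definition char_functr ::
  "('go, 'gm, ('k, 'vo \<Rightarrow> 'vm) module, ('k, 'vo \<Rightarrow> 'vm) vec_arrow) functr" where
  "char_functr =
     \<lparr>FObj = char_space,
      FArr = (\<lambda>f. (char_space (Src G f),
                   \<lambda>\<alpha>\<in>carrier (char_space (Src G f)). \<lambda>v\<in>Obj V. (f \<odot>\<^sub>a Idn V v) \<bullet> \<alpha> v,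
                   char_space (Tgt G f)))\<rparr>"

text \<open>The isomorphisms \<open>v \<rightarrow> g \<odot> (g\<^sup>* \<odot> v)\<close> and
  \<open>g \<odot> (x \<odot> (g\<^sup>* \<odot> v)) \<rightarrow> ((g \<otimes> x) \<otimes> g\<^sup>*) \<odot> v\<close>.\<close>

definition act_coev_iso :: "'go \<Rightarrow> 'vo \<Rightarrow> 'vm" where
  "act_coev_iso g v =
     ActAssoc V g (DualO G g) v \<bullet> (Coev G g \<odot>\<^sub>a Idn V v) \<bullet> inv_arrow V (ActUnit V v)"

definition act_conj_iso :: "'go \<Rightarrow> 'go \<Rightarrow> 'vo \<Rightarrow> 'vm" where
  "act_conj_iso g x v =
     inv_arrow V (ActAssoc V (g \<otimes>\<^sub>o\<^bsub>G\<^esub> x) (DualO G g) v)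
       \<bullet> inv_arrow V (ActAssoc V g x (DualO G g \<odot>\<^sub>o v))"

definition char_conj :: "'go \<Rightarrow> 'go \<Rightarrow> ('k, 'vo \<Rightarrow> 'vm) vec_arrow" where
  "char_conj g x =
     (char_space x,
      \<lambda>\<alpha>\<in>carrier (char_space x). \<lambda>v\<in>Obj V.
        act_conj_iso g x v \<bullet> (Idn G g \<odot>\<^sub>a \<alpha> (DualO G g \<odot>\<^sub>o v)) \<bullet> act_coev_iso g v,
      char_space (conj_obj G g x))"

definition two_character :: "('k, 'go, 'gm, 'vo \<Rightarrow> 'vm) class_datum" where
  "two_character = (char_functr, char_conj)"

end

end

(*
Let \<alpha> : 1 \<Rightarrow> g \<odot> - be an element of the 2-character at g. After cancelling the canonical isomorphisms, the
component of \<phi>(\<alpha>) at v is the composite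

  v \<rightarrow> g(g^* v) \<rightarrow> g(g(g^* v)) \<rightarrow> g v

of the coevaluation, g \<odot> \<alpha> at g^* v, and g applied to the inverse coevaluation. If g \<odot> \<alpha> at g^* v is replaced by \<alpha>
at g(g^* v), naturality of \<alpha> along the coevaluation identifies this composite with \<alpha> at v. So everything
rests on g \<odot> \<alpha>_w = \<alpha>_(g w) for all w. Both sides are natural in w, so by semisimplicity w may be assumed
simple. Then g w is simple too, as g \<odot> - is an equivalence, and by Schur's lemma \<alpha>_w is zero or invertible.
If it is invertible, the claim is naturality of \<alpha> along \<alpha>_w itself; if it is zero, then so is \<alpha>_(g w), as
otherwise w and g w would be isomorphic and \<alpha>_w would be nonzero as well.
*)

theory Submission
  imports Defs
begin

section \<open>Categories, bifunctors and 2-groups\<close>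

text \<open>Membership in \<open>ClassFun\<close> is part of being a fixed point. Besides the
  identity on components, the spaces Nat(1, x \<odot> -) must therefore be finite-dimensional, every
  \<psi> must be invertible, and \<psi> must respect tensor products and arrows of the 2-group. The
  obstacle there is coherence: duals are chosen arbitrarily, (g \<otimes> h)^* meets h^* \<otimes>
  g^* only through a mate, and all associators and unitors are explicit. The remedy is to leave the
  2-group early. A coevaluation or evaluation is replaced by the natural isomorphism that it induces
  on V, between the identity and g \<odot> (g^* \<odot> -) or g^* \<odot> (g \<odot> -). Associators
  of the 2-group are then consumed by pentagons of the action, and what is left are naturality
  squares and zigzag identities. The same isomorphisms show that g \<odot> - is faithful, reflects
  isomorphisms and preserves simple objects, without setting up a quasi-inverse functor.\<close>

context category
begin

lemma Hom_iff: "f \<in> Hom C a b \<longleftrightarrow> f \<in> Arr C \<and> Src C f = a \<and> Tgt C f = b"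
  by (simp add: Hom_def)

lemma Idn_simps [simp]:
  assumes "a \<in> Obj C"
  shows "Idn C a \<in> Arr C" "Src C (Idn C a) = a" "Tgt C (Idn C a) = a"
  using Idn_in_Hom[OF assms] by (simp_all add: Hom_iff)

lemma Cmp_simps [simp]:
  assumes "f \<in> Arr C" "g \<in> Arr C" "Src C g = Tgt C f"
  shows "g \<bullet> f \<in> Arr C" "Src C (g \<bullet> f) = Src C f" "Tgt C (g \<bullet> f) = Tgt C g"
  using Cmp_in_Hom[of f "Src C f" "Tgt C f" g "Tgt C g"] assms by (simp_all add: Hom_iff)

lemma Src_Tgt_closed [simp]:
  "f \<in> Arr C \<Longrightarrow> Src C f \<in> Obj C" "f \<in> Arr C \<Longrightarrow> Tgt C f \<in> Obj C"
  by (simp_all add: Src_closed Tgt_closed)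

lemma Hom_Obj: "f \<in> Hom C a b \<Longrightarrow> a \<in> Obj C" "f \<in> Hom C a b \<Longrightarrow> b \<in> Obj C"
  by (auto simp: Hom_iff)

lemma Cmp_Idn_simp [simp]: "\<lbrakk>f \<in> Arr C; a = Src C f\<rbrakk> \<Longrightarrow> f \<bullet> Idn C a = f"
  using Cmp_Idn[of f a "Tgt C f"] by (simp add: Hom_iff)

lemma Idn_Cmp_simp [simp]: "\<lbrakk>f \<in> Arr C; a = Tgt C f\<rbrakk> \<Longrightarrow> Idn C a \<bullet> f = f"
  using Idn_Cmp[of f "Src C f" a] by (simp add: Hom_iff)

lemma assoc [simp]:
  "\<lbrakk>f \<in> Arr C; g \<in> Arr C; h \<in> Arr C; Src C g = Tgt C f; Src C h = Tgt C g\<rbrakk>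
    \<Longrightarrow> (h \<bullet> g) \<bullet> f = h \<bullet> g \<bullet> f"
  by (rule Cmp_assoc[of f "Src C f" "Tgt C f" g "Tgt C g" h "Tgt C h"]) (simp_all add: Hom_iff)

text \<open>Since \<open>assoc\<close> nests all composites to the right, an equation for
  \<open>f \<bullet> g\<close> does not match inside a longer chain. Applied through
  \<open>THEN\<close>, this lemma and \<open>reduce3\<close> add the missing tail
  \<open>x\<close>.\<close>

lemma reduce2:
  "\<lbrakk>f \<bullet> g = k; f \<in> Arr C; g \<in> Arr C; Src C f = Tgt C g; x \<in> Arr C; Src C g = Tgt C x\<rbrakk>
    \<Longrightarrow> f \<bullet> g \<bullet> x = k \<bullet> x"
  using assoc[of x g f] by simp

lemma reduce3:
  "\<lbrakk>f \<bullet> g \<bullet> h = k; f \<in> Arr C; g \<in> Arr C; h \<in> Arr C; Src C f = Tgt C g; Src C g = Tgt C h;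
    x \<in> Arr C; Src C h = Tgt C x\<rbrakk> \<Longrightarrow> f \<bullet> g \<bullet> h \<bullet> x = k \<bullet> x"
  using assoc[of x "g \<bullet> h" f] by simp

lemma inverse_arrows_unique:
  assumes "inverse_arrows C f g" "inverse_arrows C f h"
  shows "g = h"
proof -
  have "g = g \<bullet> f \<bullet> h" using assms by (simp add: inverse_arrows_def Hom_iff)
  also have "\<dots> = (g \<bullet> f) \<bullet> h" using assms by (subst assoc) (simp_all add: inverse_arrows_def Hom_iff)
  also have "\<dots> = h" using assms by (simp add: inverse_arrows_def Hom_iff)
  finally show ?thesis .
qed

lemma inv_arrow_eqI:
  assumes "inverse_arrows C f g"
  shows "inv_arrow C f = g"
  unfolding inv_arrow_def using assms inverse_arrows_unique by blast

lemma inverse_inv_arrow: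
  assumes "iso_arrow C f"
  shows "inverse_arrows C f (inv_arrow C f)"
  using assms inv_arrow_eqI unfolding iso_arrow_def by blast

lemma iso_Arr: "iso_arrow C f \<Longrightarrow> f \<in> Arr C"
  by (auto simp: iso_arrow_def inverse_arrows_def)

lemma inv_simps [simp]:
  assumes "iso_arrow C f"
  shows "inv_arrow C f \<in> Arr C" "Src C (inv_arrow C f) = Tgt C f" "Tgt C (inv_arrow C f) = Src C f"
    "inv_arrow C f \<bullet> f = Idn C (Src C f)" "f \<bullet> inv_arrow C f = Idn C (Tgt C f)"
  using inverse_inv_arrow[OF assms] by (simp_all add: inverse_arrows_def Hom_iff)

lemma inv_cancel [simp]:
  assumes "iso_arrow C f" "x \<in> Arr C"
  shows "Src C f = Tgt C x \<Longrightarrow> inv_arrow C f \<bullet> f \<bullet> x = x"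
    "Tgt C f = Tgt C x \<Longrightarrow> f \<bullet> inv_arrow C f \<bullet> x = x"
  using reduce2[OF inv_simps(4), of f x] reduce2[OF inv_simps(5), of f x] assms iso_Arr[of f]
  by simp_all

lemma isoI:
  assumes "f \<in> Arr C" "g \<in> Arr C" "Src C g = Tgt C f" "Tgt C g = Src C f"
    "g \<bullet> f = Idn C (Src C f)" "f \<bullet> g = Idn C (Tgt C f)"
  shows "iso_arrow C f" "inv_arrow C f = g"
proof -
  have *: "inverse_arrows C f g" using assms by (simp add: inverse_arrows_def Hom_iff)
  show "iso_arrow C f" using * by (auto simp: iso_arrow_def)
  show "inv_arrow C f = g" using * by (rule inv_arrow_eqI)
qed

lemma iso_Idn [simp]:
  assumes "a \<in> Obj C"
  shows "iso_arrow C (Idn C a)" "inv_arrow C (Idn C a) = Idn C a"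
  using isoI[of "Idn C a" "Idn C a"] assms by simp_all

lemma iso_Cmp [simp]:
  assumes "iso_arrow C f" "iso_arrow C g" "Src C g = Tgt C f"
  shows "iso_arrow C (g \<bullet> f)" "inv_arrow C (g \<bullet> f) = inv_arrow C f \<bullet> inv_arrow C g"
  using isoI[of "g \<bullet> f" "inv_arrow C f \<bullet> inv_arrow C g"] assms iso_Arr[of f] iso_Arr[of g]
  by simp_all

lemma iso_inv [simp]:
  assumes "iso_arrow C f"
  shows "iso_arrow C (inv_arrow C f)" "inv_arrow C (inv_arrow C f) = f"
  using isoI[of "inv_arrow C f" f] assms iso_Arr[of f] by simp_all

lemma iso_cancel_left:
  assumes "iso_arrow C f" "x \<in> Arr C" "y \<in> Arr C" "Tgt C x = Src C f" "Tgt C y = Src C f"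
    "f \<bullet> x = f \<bullet> y"
  shows "x = y"
proof -
  have "inv_arrow C f \<bullet> f \<bullet> x = inv_arrow C f \<bullet> f \<bullet> y" using assms(6) by simp
  then show ?thesis using assms(1-5) by simp
qed

lemma iso_cancel_right:
  assumes "iso_arrow C f" "x \<in> Arr C" "y \<in> Arr C" "Src C x = Tgt C f" "Src C y = Tgt C f"
    "x \<bullet> f = y \<bullet> f"
  shows "x = y"
proof -
  have "(x \<bullet> f) \<bullet> inv_arrow C f = (y \<bullet> f) \<bullet> inv_arrow C f" using assms(6) by simp
  then show ?thesis using assms(1-5) iso_Arr[of f] by simp
qed

lemma iso_eq_inv_left:
  assumes "iso_arrow C f" "x \<in> Arr C" "Tgt C x = Src C f" "f \<bullet> x = y"
  shows "x = inv_arrow C f \<bullet> y"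
  using assms by auto

end

section \<open>Bifunctors and whiskering\<close>

context bifunctor
begin

lemma TA_simps [simp]:
  assumes "f \<in> Arr A" "m \<in> Arr B"
  shows "TA f m \<in> Arr C" "Src C (TA f m) = TO (Src A f) (Src B m)"
    "Tgt C (TA f m) = TO (Tgt A f) (Tgt B m)"
  using TA_in_Hom[of f "Src A f" "Tgt A f" m "Src B m" "Tgt B m"] assms
  by (simp_all add: A.Hom_iff B.Hom_iff C.Hom_iff)

declare TO_closed [simp] TA_Idn [simp]

lemma TA_Cmp_eq:
  assumes "f \<in> Arr A" "f' \<in> Arr A" "Src A f' = Tgt A f"
    "m \<in> Arr B" "m' \<in> Arr B" "Src B m' = Tgt B m"
  shows "TA f' m' \<bullet>\<^bsub>C\<^esub> TA f m = TA (f' \<bullet>\<^bsub>A\<^esub> f) (m' \<bullet>\<^bsub>B\<^esub> m)"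
  by (rule TA_Cmp[symmetric]) (use assms in \<open>simp_all add: A.Hom_iff B.Hom_iff\<close>)

lemma TA_whisker_right [simp]:
  assumes "a \<in> Obj A" "m \<in> Arr B" "m' \<in> Arr B" "Src B m' = Tgt B m"
  shows "TA (Idn A a) (m' \<bullet>\<^bsub>B\<^esub> m) = TA (Idn A a) m' \<bullet>\<^bsub>C\<^esub> TA (Idn A a) m"
  using assms by (simp add: TA_Cmp_eq)

lemma TA_whisker_left [simp]:
  assumes "b \<in> Obj B" "f \<in> Arr A" "f' \<in> Arr A" "Src A f' = Tgt A f"
  shows "TA (f' \<bullet>\<^bsub>A\<^esub> f) (Idn B b) = TA f' (Idn B b) \<bullet>\<^bsub>C\<^esub> TA f (Idn B b)"
  using assms by (simp add: TA_Cmp_eq)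

text \<open>Both sides are \<open>TA f m\<close>. The objects are separate variables, so that
  instances can be written with sources and targets already simplified.\<close>

lemma TA_interchange:
  assumes "f \<in> Arr A" "m \<in> Arr B" "a = Src A f" "a' = Tgt A f" "b = Src B m" "b' = Tgt B m"
  shows "TA f (Idn B b') \<bullet>\<^bsub>C\<^esub> TA (Idn A a) m = TA (Idn A a') m \<bullet>\<^bsub>C\<^esub> TA f (Idn B b)"
  using assms by (simp add: TA_Cmp_eq)

lemma TA_iso [simp]:
  assumes "iso_arrow A f" "iso_arrow B m"
  shows "iso_arrow C (TA f m)" "inv_arrow C (TA f m) = TA (inv_arrow A f) (inv_arrow B m)"
  using C.isoI[of "TA f m" "TA (inv_arrow A f) (inv_arrow B m)"] assms A.iso_Arr[of f] B.iso_Arr[of m]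
  by (simp_all add: TA_Cmp_eq)

end

context monoidal_category
begin

declare UnitO_closed [simp] Assoc_iso [simp] LUnit_iso [simp] RUnit_iso [simp]

lemma Assoc_simps [simp]:
  assumes "a \<in> Obj G" "b \<in> Obj G" "c \<in> Obj G"
  shows "Assoc G a b c \<in> Arr G" "Src G (Assoc G a b c) = (a \<otimes>\<^sub>o b) \<otimes>\<^sub>o c"
    "Tgt G (Assoc G a b c) = a \<otimes>\<^sub>o (b \<otimes>\<^sub>o c)"
  using Assoc_in_Hom[OF assms] by (simp_all add: Hom_iff)

lemma unit_simps [simp]:
  assumes "a \<in> Obj G"
  shows "LUnit G a \<in> Arr G" "Src G (LUnit G a) = UnitO G \<otimes>\<^sub>o a" "Tgt G (LUnit G a) = a"
    "RUnit G a \<in> Arr G" "Src G (RUnit G a) = a \<otimes>\<^sub>o UnitO G" "Tgt G (RUnit G a) = a"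
  using LUnit_in_Hom[OF assms] RUnit_in_Hom[OF assms] by (simp_all add: Hom_iff)

end

section \<open>Chosen duals, mates and conjugation in a 2-group\<close>

context two_group
begin

declare DualO_closed [simp] arrows_iso [simp]

lemma dual_simps [simp]:
  assumes "g \<in> Obj G"
  shows "Ev G g \<in> Arr G" "Src G (Ev G g) = DualO G g \<otimes>\<^sub>o g" "Tgt G (Ev G g) = UnitO G"
    "Coev G g \<in> Arr G" "Src G (Coev G g) = UnitO G" "Tgt G (Coev G g) = g \<otimes>\<^sub>o DualO G g"
  using Ev_in_Hom[OF assms] Coev_in_Hom[OF assms] by (simp_all add: Hom_iff)

lemma mate_simps [simp]:
  assumes "a \<in> Arr G" "Tgt G a = y" "Src G a = x" "d \<in> Obj G" "d' \<in> Obj G"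
    "\<epsilon> \<in> Arr G" "Src G \<epsilon> = d \<otimes>\<^sub>o y" "Tgt G \<epsilon> = UnitO G"
    "\<eta> \<in> Arr G" "Src G \<eta> = UnitO G" "Tgt G \<eta> = x \<otimes>\<^sub>o d'"
  shows "mate G y d \<epsilon> d' \<eta> a \<in> Arr G" "Src G (mate G y d \<epsilon> d' \<eta> a) = d"
    "Tgt G (mate G y d \<epsilon> d' \<eta> a) = d'"
proof -
  have o: "x \<in> Obj G" "y \<in> Obj G" using assms(1-3) by auto
  show "mate G y d \<epsilon> d' \<eta> a \<in> Arr G" "Src G (mate G y d \<epsilon> d' \<eta> a) = d"
    "Tgt G (mate G y d \<epsilon> d' \<eta> a) = d'"
    using assms o by (simp_all add: mate_def)
qed

lemma left_dual_arrow_simps [simp]: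
  assumes "a \<in> Arr G"
  shows "left_dual_arrow G a \<in> Arr G" "Src G (left_dual_arrow G a) = DualO G (Tgt G a)"
    "Tgt G (left_dual_arrow G a) = DualO G (Src G a)"
  using assms by (simp_all add: left_dual_arrow_def)

lemma star_arrow_simps [simp]:
  assumes "a \<in> Arr G"
  shows "star_arrow G a \<in> Arr G" "Src G (star_arrow G a) = DualO G (Src G a)"
    "Tgt G (star_arrow G a) = DualO G (Tgt G a)"
  using assms by (simp_all add: star_arrow_def)

lemma coev_tensor_simps [simp]:
  assumes "g \<in> Obj G" "h \<in> Obj G"
  shows "coev_tensor G g h \<in> Arr G" "Src G (coev_tensor G g h) = UnitO G"
    "Tgt G (coev_tensor G g h) = (g \<otimes>\<^sub>o h) \<otimes>\<^sub>o (DualO G h \<otimes>\<^sub>o DualO G g)"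
  using assms by (simp_all add: coev_tensor_def)

lemma dual_tensor_iso_simps [simp]:
  assumes "g \<in> Obj G" "h \<in> Obj G"
  shows "dual_tensor_iso G g h \<in> Arr G" "Src G (dual_tensor_iso G g h) = DualO G (g \<otimes>\<^sub>o h)"
    "Tgt G (dual_tensor_iso G g h) = DualO G h \<otimes>\<^sub>o DualO G g"
  using assms by (simp_all add: dual_tensor_iso_def)

lemma conj_obj_closed [simp]: "\<lbrakk>g \<in> Obj G; x \<in> Obj G\<rbrakk> \<Longrightarrow> conj_obj G g x \<in> Obj G"
  by (simp add: conj_obj_def)

lemma conj_tensor_iso_simps [simp]:
  assumes "g \<in> Obj G" "h \<in> Obj G" "x \<in> Obj G"
  shows "conj_tensor_iso G g h x \<in> Arr G"
    "Src G (conj_tensor_iso G g h x) = conj_obj G (g \<otimes>\<^sub>o h) x"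
    "Tgt G (conj_tensor_iso G g h x) = conj_obj G g (conj_obj G h x)"
  using assms by (simp_all add: conj_tensor_iso_def conj_obj_def)

lemma conj_self_iso_simps [simp]:
  assumes "g \<in> Obj G"
  shows "conj_self_iso G g \<in> Arr G" "Src G (conj_self_iso G g) = conj_obj G g g"
    "Tgt G (conj_self_iso G g) = g"
  using assms by (simp_all add: conj_self_iso_def conj_obj_def)

end

section \<open>Duality and coherence for the action\<close>

context two_representation
begin

declare ActAssoc_iso [simp] ActUnit_iso [simp]

lemma ActAssoc_simps [simp]:
  assumes "g \<in> Obj G" "h \<in> Obj G" "v \<in> Obj V"
  shows "ActAssoc V g h v \<in> Arr V" "Src V (ActAssoc V g h v) = (g \<otimes>\<^sub>o\<^bsub>G\<^esub> h) \<odot>\<^sub>o v"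
    "Tgt V (ActAssoc V g h v) = g \<odot>\<^sub>o (h \<odot>\<^sub>o v)"
  using ActAssoc_in_Hom[OF assms] by (simp_all add: V.Hom_iff)

lemma ActUnit_simps [simp]:
  assumes "v \<in> Obj V"
  shows "ActUnit V v \<in> Arr V" "Src V (ActUnit V v) = UnitO G \<odot>\<^sub>o v" "Tgt V (ActUnit V v) = v"
  using ActUnit_in_Hom[OF assms] by (simp_all add: V.Hom_iff)

section \<open>Naturality and unit coherence of the action\<close>

abbreviation U where "U \<equiv> UnitO G"
abbreviation dual where "dual \<equiv> DualO G"
abbreviation tens (infixr "\<boxtimes>" 70) where "g \<boxtimes> h \<equiv> TenO G g h"

lemma ActAssoc_nat:
  assumes "a \<in> Arr G" "b \<in> Arr G" "f \<in> Arr V"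
  shows "ActAssoc V (Tgt G a) (Tgt G b) (Tgt V f) \<bullet> (TenA G a b \<odot>\<^sub>a f)
    = (a \<odot>\<^sub>a (b \<odot>\<^sub>a f)) \<bullet> ActAssoc V (Src G a) (Src G b) (Src V f)"
  by (rule ActAssoc_natural) (use assms in \<open>simp_all add: G.Hom_iff V.Hom_iff\<close>)

lemma ActAssoc_nat_left:
  assumes "a \<in> Arr G" "Src G a = g" "Tgt G a = g'" "h \<in> Obj G" "v \<in> Obj V"
  shows "ActAssoc V g' h v \<bullet> (TenA G a (Idn G h) \<odot>\<^sub>a Idn V v)
    = (a \<odot>\<^sub>a Idn V (h \<odot>\<^sub>o v)) \<bullet> ActAssoc V g h v"
  using ActAssoc_nat[of a "Idn G h" "Idn V v"] assms by simp

lemma ActAssoc_nat_mid: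
  assumes "b \<in> Arr G" "Src G b = h" "Tgt G b = h'" "g \<in> Obj G" "v \<in> Obj V"
  shows "ActAssoc V g h' v \<bullet> (TenA G (Idn G g) b \<odot>\<^sub>a Idn V v)
    = (Idn G g \<odot>\<^sub>a (b \<odot>\<^sub>a Idn V v)) \<bullet> ActAssoc V g h v"
  using ActAssoc_nat[of "Idn G g" b "Idn V v"] assms by simp

lemma ActAssoc_nat_right:
  assumes "f \<in> Arr V" "Src V f = v" "Tgt V f = w" "g \<in> Obj G" "h \<in> Obj G"
  shows "ActAssoc V g h w \<bullet> (Idn G (g \<boxtimes> h) \<odot>\<^sub>a f)
    = (Idn G g \<odot>\<^sub>a (Idn G h \<odot>\<^sub>a f)) \<bullet> ActAssoc V g h v"
  using ActAssoc_nat[of "Idn G g" "Idn G h" f] assms by simp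

lemma ActUnit_nat:
  assumes "f \<in> Arr V" "Src V f = v" "Tgt V f = w"
  shows "ActUnit V w \<bullet> (Idn G U \<odot>\<^sub>a f) = f \<bullet> ActUnit V v"
  by (rule ActUnit_natural) (use assms in \<open>simp add: V.Hom_iff\<close>)

text \<open>The isomorphisms \<open>ActUnit\<close> conjugate
  \<open>Idn G U \<odot>\<^sub>a f\<close> into \<open>f\<close>.\<close>

lemma unit_faithful:
  assumes "f \<in> Arr V" "f' \<in> Arr V" "Src V f = v" "Src V f' = v" "Tgt V f = w" "Tgt V f' = w"
    "Idn G U \<odot>\<^sub>a f = Idn G U \<odot>\<^sub>a f'"
  shows "f = f'"
proof (rule V.iso_cancel_right)
  have v: "v \<in> Obj V" using assms(1,3) by auto
  then show "iso_arrow V (ActUnit V v)" by simp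
  show "f \<bullet> ActUnit V v = f' \<bullet> ActUnit V v"
    by (simp only: ActUnit_nat[of f v w, OF assms(1,3,5), symmetric]
        ActUnit_nat[of f' v w, OF assms(2,4,6), symmetric] assms(7))
  show "Src V f = Tgt V (ActUnit V v)" "Src V f' = Tgt V (ActUnit V v)"
    using v assms(3,4) by simp_all
qed (rule assms)+

text \<open>The simplifier splits whiskered composites into chains of whiskered arrows. This lemma
  and \<open>whisker_right_eq\<close> go the other way: they turn an equation in G or V into a
  rewrite rule for neighbouring factors of such a chain.\<close>

lemma whisker_left_eq:
  assumes "f' \<bullet>\<^bsub>G\<^esub> f = k" "f \<in> Arr G" "f' \<in> Arr G" "Src G f' = Tgt G f" "v \<in> Obj V"
  shows "(f' \<odot>\<^sub>a Idn V v) \<bullet> (f \<odot>\<^sub>a Idn V v) = k \<odot>\<^sub>a Idn V v"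
  by (simp only: TA_whisker_left[OF assms(5,2,3,4), symmetric] assms(1))

lemma whisker_right_eq:
  assumes "f' \<bullet> f = k" "f \<in> Arr V" "f' \<in> Arr V" "Src V f' = Tgt V f" "g \<in> Obj G"
  shows "(Idn G g \<odot>\<^sub>a f') \<bullet> (Idn G g \<odot>\<^sub>a f) = Idn G g \<odot>\<^sub>a k"
  by (simp only: TA_whisker_right[OF assms(5,2,3,4), symmetric] assms(1))

text \<open>Kelly's argument: the remaining unit law follows from the triangle after applying the
  faithful functor \<open>e \<odot> -\<close>.\<close>

lemma ActUnit_tensor:
  assumes [simp]: "g \<in> Obj G" "w \<in> Obj V"
  shows "ActUnit V (g \<odot>\<^sub>o w) \<bullet> ActAssoc V U g w = LUnit G g \<odot>\<^sub>a Idn V w"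
proof (rule unit_faithful[of _ _ "(U \<boxtimes> g) \<odot>\<^sub>o w" "g \<odot>\<^sub>o w"])
  let ?A = "ActAssoc V"
  let ?c = "?A U (U \<boxtimes> g) w \<bullet> (Assoc G U U g \<odot>\<^sub>a Idn V w)"
  have "(Idn G U \<odot>\<^sub>a (LUnit G g \<odot>\<^sub>a Idn V w)) \<bullet> ?c
      = ?A U g w \<bullet> (TenA G (Idn G U) (LUnit G g) \<odot>\<^sub>a Idn V w) \<bullet> (Assoc G U U g \<odot>\<^sub>a Idn V w)"
    by (simp add: ActAssoc_nat_mid[of "LUnit G g" "U \<boxtimes> g" g U w, symmetric, THEN V.reduce2])
  also have "\<dots> = ?A U g w \<bullet> (TenA G (RUnit G U) (Idn G g) \<odot>\<^sub>a Idn V w)"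
    using whisker_left_eq[OF G.triangle[of U g], of w] by simp
  also have "\<dots> = (RUnit G U \<odot>\<^sub>a Idn V (g \<odot>\<^sub>o w)) \<bullet> ?A (U \<boxtimes> U) g w"
    by (rule ActAssoc_nat_left) simp_all
  also have "\<dots> = (Idn G U \<odot>\<^sub>a ActUnit V (g \<odot>\<^sub>o w)) \<bullet> ?A U U (g \<odot>\<^sub>o w) \<bullet> ?A (U \<boxtimes> U) g w"
    by (simp add: Act_triangle[of U "g \<odot>\<^sub>o w", THEN V.reduce2])
  also have "\<dots> = (Idn G U \<odot>\<^sub>a (ActUnit V (g \<odot>\<^sub>o w) \<bullet> ?A U g w)) \<bullet> ?c"
    using Act_pentagon[of U U g w] by simp
  finally have eq: "(Idn G U \<odot>\<^sub>a (ActUnit V (g \<odot>\<^sub>o w) \<bullet> ?A U g w)) \<bullet> ?c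
      = (Idn G U \<odot>\<^sub>a (LUnit G g \<odot>\<^sub>a Idn V w)) \<bullet> ?c" ..
  show "Idn G U \<odot>\<^sub>a (ActUnit V (g \<odot>\<^sub>o w) \<bullet> ?A U g w)
      = Idn G U \<odot>\<^sub>a (LUnit G g \<odot>\<^sub>a Idn V w)"
    by (rule V.iso_cancel_right[OF _ _ _ _ _ eq]) simp_all
qed simp_all

text \<open>Replacing \<open>\<eta> : e \<rightarrow> x \<otimes> d\<close> and \<open>\<epsilon> : d \<otimes> y \<rightarrow> e\<close> by the induced transformations
  \<open>v \<rightarrow> x \<odot> (d \<odot> v)\<close> and \<open>d \<odot> (y \<odot> v) \<rightarrow> v\<close> turns duality computations into naturality
  arguments without associators of the 2-group.\<close>

definition act_unit :: "'go \<Rightarrow> 'go \<Rightarrow> 'gm \<Rightarrow> 'vo \<Rightarrow> 'vm" where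
  "act_unit x d \<eta> v = ActAssoc V x d v \<bullet> (\<eta> \<odot>\<^sub>a Idn V v) \<bullet> inv_arrow V (ActUnit V v)"

definition act_counit :: "'go \<Rightarrow> 'go \<Rightarrow> 'gm \<Rightarrow> 'vo \<Rightarrow> 'vm" where
  "act_counit d y \<epsilon> v = ActUnit V v \<bullet> (\<epsilon> \<odot>\<^sub>a Idn V v) \<bullet> inv_arrow V (ActAssoc V d y v)"

lemma act_unit_simps [simp]:
  assumes "x \<in> Obj G" "d \<in> Obj G" "\<eta> \<in> Arr G" "Src G \<eta> = U" "Tgt G \<eta> = x \<boxtimes> d" "v \<in> Obj V"
  shows "act_unit x d \<eta> v \<in> Arr V" "Src V (act_unit x d \<eta> v) = v"
    "Tgt V (act_unit x d \<eta> v) = x \<odot>\<^sub>o (d \<odot>\<^sub>o v)" "iso_arrow V (act_unit x d \<eta> v)"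
  using assms by (simp_all add: act_unit_def)

lemma act_counit_simps [simp]:
  assumes "d \<in> Obj G" "y \<in> Obj G" "\<epsilon> \<in> Arr G" "Src G \<epsilon> = d \<boxtimes> y" "Tgt G \<epsilon> = U" "v \<in> Obj V"
  shows "act_counit d y \<epsilon> v \<in> Arr V" "Src V (act_counit d y \<epsilon> v) = d \<odot>\<^sub>o (y \<odot>\<^sub>o v)"
    "Tgt V (act_counit d y \<epsilon> v) = v" "iso_arrow V (act_counit d y \<epsilon> v)"
  using assms by (simp_all add: act_counit_def)

lemma inv_ActUnit_nat:
  assumes "f \<in> Arr V" "Src V f = v" "Tgt V f = w"
  shows "(Idn G U \<odot>\<^sub>a f) \<bullet> inv_arrow V (ActUnit V v) = inv_arrow V (ActUnit V w) \<bullet> f"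
proof -
  have [simp]: "v \<in> Obj V" "w \<in> Obj V" using assms by auto
  show ?thesis
    by (rule V.iso_cancel_left[of "ActUnit V w"], simp_all add: assms)
      (use assms ActUnit_nat[OF assms, THEN V.reduce2, of "inv_arrow V (ActUnit V v)"] in simp)
qed

lemma inv_ActAssoc_nat_right:
  assumes "f \<in> Arr V" "Src V f = v" "Tgt V f = w" "g \<in> Obj G" "h \<in> Obj G"
  shows "inv_arrow V (ActAssoc V g h w) \<bullet> (Idn G g \<odot>\<^sub>a (Idn G h \<odot>\<^sub>a f))
    = (Idn G (g \<boxtimes> h) \<odot>\<^sub>a f) \<bullet> inv_arrow V (ActAssoc V g h v)"
proof -
  have [simp]: "v \<in> Obj V" "w \<in> Obj V" using assms by auto
  show ?thesis
    by (rule V.iso_cancel_left[of "ActAssoc V g h w"], simp_all add: assms)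
      (use assms ActAssoc_nat_right[OF assms, THEN V.reduce2, of "inv_arrow V (ActAssoc V g h v)"] in simp)
qed

lemma act_unit_nat:
  assumes "x \<in> Obj G" "d \<in> Obj G" "\<eta> \<in> Arr G" "Src G \<eta> = U" "Tgt G \<eta> = x \<boxtimes> d"
    "f \<in> Arr V" "Src V f = v" "Tgt V f = w"
  shows "(Idn G x \<odot>\<^sub>a (Idn G d \<odot>\<^sub>a f)) \<bullet> act_unit x d \<eta> v = act_unit x d \<eta> w \<bullet> f"
proof -
  have [simp]: "v \<in> Obj V" "w \<in> Obj V" using assms by auto
  show ?thesis
    unfolding act_unit_def using assms
    by (simp add: ActAssoc_nat_right[of f v w x d, symmetric, THEN V.reduce2]
        inv_ActUnit_nat[of f v w, symmetric]
        TA_interchange[of \<eta> f U "x \<boxtimes> d" v w, symmetric, THEN V.reduce2])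
qed

lemma act_counit_nat:
  assumes "d \<in> Obj G" "y \<in> Obj G" "\<epsilon> \<in> Arr G" "Src G \<epsilon> = d \<boxtimes> y" "Tgt G \<epsilon> = U"
    "f \<in> Arr V" "Src V f = v" "Tgt V f = w"
  shows "act_counit d y \<epsilon> w \<bullet> (Idn G d \<odot>\<^sub>a (Idn G y \<odot>\<^sub>a f)) = f \<bullet> act_counit d y \<epsilon> v"
proof -
  have [simp]: "v \<in> Obj V" "w \<in> Obj V" using assms by auto
  show ?thesis
    unfolding act_counit_def using assms
    by (simp add: inv_ActAssoc_nat_right[of f v w d y]
        ActUnit_nat[of f v w, symmetric, THEN V.reduce2]
        TA_interchange[of \<epsilon> f "d \<boxtimes> y" U v w, THEN V.reduce2])
qed

text \<open>The pentagon in the form in which it meets the inverse associators inside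
  \<open>mate\<close>, \<open>coev_tensor\<close> and \<open>conj_tensor_iso\<close>.\<close>

lemma pentagon_inv:
  assumes [simp]: "g \<in> Obj G" "h \<in> Obj G" "k \<in> Obj G" "v \<in> Obj V"
  shows "ActAssoc V (g \<boxtimes> h) k v \<bullet> (inv_arrow G (Assoc G g h k) \<odot>\<^sub>a Idn V v)
    = inv_arrow V (ActAssoc V g h (k \<odot>\<^sub>o v)) \<bullet> (Idn G g \<odot>\<^sub>a ActAssoc V h k v) \<bullet> ActAssoc V g (h \<boxtimes> k) v"
proof (rule V.iso_cancel_right[of "Assoc G g h k \<odot>\<^sub>a Idn V v"])
  show "(ActAssoc V (g \<boxtimes> h) k v \<bullet> (inv_arrow G (Assoc G g h k) \<odot>\<^sub>a Idn V v)) \<bullet> (Assoc G g h k \<odot>\<^sub>a Idn V v)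
    = (inv_arrow V (ActAssoc V g h (k \<odot>\<^sub>o v)) \<bullet> (Idn G g \<odot>\<^sub>a ActAssoc V h k v) \<bullet> ActAssoc V g (h \<boxtimes> k) v)
      \<bullet> (Assoc G g h k \<odot>\<^sub>a Idn V v)"
    by (simp add: Act_pentagon[of g h k v] TA_Cmp_eq)
qed simp_all

lemma inv_LUnit_act:
  assumes [simp]: "g \<in> Obj G" "w \<in> Obj V"
  shows "ActAssoc V U g w \<bullet> (inv_arrow G (LUnit G g) \<odot>\<^sub>a Idn V w) = inv_arrow V (ActUnit V (g \<odot>\<^sub>o w))"
proof (rule V.iso_cancel_left[of "ActUnit V (g \<odot>\<^sub>o w)"])
  show "ActUnit V (g \<odot>\<^sub>o w) \<bullet> ActAssoc V U g w \<bullet> (inv_arrow G (LUnit G g) \<odot>\<^sub>a Idn V w)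
    = ActUnit V (g \<odot>\<^sub>o w) \<bullet> inv_arrow V (ActUnit V (g \<odot>\<^sub>o w))"
    by (simp add: ActUnit_tensor[of g w, THEN V.reduce2] TA_Cmp_eq)
qed simp_all

lemma inv_RUnit_act:
  assumes [simp]: "g \<in> Obj G" "w \<in> Obj V"
  shows "ActAssoc V g U w \<bullet> (inv_arrow G (RUnit G g) \<odot>\<^sub>a Idn V w) = Idn G g \<odot>\<^sub>a inv_arrow V (ActUnit V w)"
proof (rule V.iso_cancel_left[of "Idn G g \<odot>\<^sub>a ActUnit V w"])
  show "(Idn G g \<odot>\<^sub>a ActUnit V w) \<bullet> ActAssoc V g U w \<bullet> (inv_arrow G (RUnit G g) \<odot>\<^sub>a Idn V w)
    = (Idn G g \<odot>\<^sub>a ActUnit V w) \<bullet> (Idn G g \<odot>\<^sub>a inv_arrow V (ActUnit V w))"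
    by (simp add: Act_triangle[of g w, THEN V.reduce2] TA_Cmp_eq)
qed simp_all

section \<open>Zigzag identities and mates, transported to V\<close>

abbreviation coev where "coev g \<equiv> act_unit g (dual g) (Coev G g)"
abbreviation ev where "ev g \<equiv> act_counit (dual g) g (Ev G g)"

text \<open>This is the zigzag identity of g acting on w. The pentagon exchanges the associator of
  the 2-group for associators of the action, and the remaining factors regroup into
  \<open>ev\<close> and \<open>coev\<close>.\<close>

lemma act_zigzag:
  assumes [simp]: "g \<in> Obj G" "w \<in> Obj V"
  shows "(Idn G g \<odot>\<^sub>a ev g w) \<bullet> coev g (g \<odot>\<^sub>o w) = Idn V (g \<odot>\<^sub>o w)"
proof -
  let ?R = "\<lambda>a. a \<odot>\<^sub>a Idn V w" and ?L = "\<lambda>f. Idn G g \<odot>\<^sub>a f" and ?A = "ActAssoc V"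
  have "Idn V (g \<odot>\<^sub>o w) = ?R (RUnit G g) \<bullet> ?R (TenA G (Idn G g) (Ev G g)) \<bullet> ?R (Assoc G g (dual g) g)
      \<bullet> ?R (TenA G (Coev G g) (Idn G g)) \<bullet> ?R (inv_arrow G (LUnit G g))"
    using arg_cong[OF G.zigzag[of g], of "\<lambda>a. a \<odot>\<^sub>a Idn V w"] by simp
  also have "\<dots> = ?L (ActUnit V w) \<bullet> ?A g U w \<bullet> ?R (TenA G (Idn G g) (Ev G g)) \<bullet> ?R (Assoc G g (dual g) g)
      \<bullet> ?R (TenA G (Coev G g) (Idn G g)) \<bullet> ?R (inv_arrow G (LUnit G g))"
    by (simp add: Act_triangle[of g w, THEN V.reduce2])
  also have "\<dots> = ?L (ActUnit V w) \<bullet> ?L (?R (Ev G g)) \<bullet> ?A g (dual g \<boxtimes> g) w \<bullet> ?R (Assoc G g (dual g) g)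
      \<bullet> ?R (TenA G (Coev G g) (Idn G g)) \<bullet> ?R (inv_arrow G (LUnit G g))"
    by (simp add: ActAssoc_nat_mid[of "Ev G g" "dual g \<boxtimes> g" U g w, THEN V.reduce2])
  \<comment> \<open>An identity is inserted to create the left side of
    \<open>Act_pentagon\<close>.\<close>
  also have "\<dots> = ?L (ActUnit V w) \<bullet> ?L (?R (Ev G g)) \<bullet> ?L (inv_arrow V (?A (dual g) g w))
      \<bullet> ?L (?A (dual g) g w) \<bullet> ?A g (dual g \<boxtimes> g) w \<bullet> ?R (Assoc G g (dual g) g)
      \<bullet> ?R (TenA G (Coev G g) (Idn G g)) \<bullet> ?R (inv_arrow G (LUnit G g))"
    by (simp add: whisker_right_eq[OF V.inv_simps(4), of "?A (dual g) g w" g, THEN V.reduce2])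
  also have "\<dots> = ?L (ActUnit V w) \<bullet> ?L (?R (Ev G g)) \<bullet> ?L (inv_arrow V (?A (dual g) g w))
      \<bullet> ?A g (dual g) (g \<odot>\<^sub>o w) \<bullet> ?A (g \<boxtimes> dual g) g w
      \<bullet> ?R (TenA G (Coev G g) (Idn G g)) \<bullet> ?R (inv_arrow G (LUnit G g))"
    by (simp add: Act_pentagon[of g "dual g" g w, THEN V.reduce3])
  also have "\<dots> = ?L (ActUnit V w) \<bullet> ?L (?R (Ev G g)) \<bullet> ?L (inv_arrow V (?A (dual g) g w))
      \<bullet> ?A g (dual g) (g \<odot>\<^sub>o w) \<bullet> (Coev G g \<odot>\<^sub>a Idn V (g \<odot>\<^sub>o w)) \<bullet> inv_arrow V (ActUnit V (g \<odot>\<^sub>o w))"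
    by (simp add: ActAssoc_nat_left[of "Coev G g" U "g \<boxtimes> dual g" g w, THEN V.reduce2] inv_LUnit_act)
  also have "\<dots> = (Idn G g \<odot>\<^sub>a ev g w) \<bullet> coev g (g \<odot>\<^sub>o w)"
    by (simp add: act_unit_def act_counit_def)
  finally show ?thesis ..
qed

text \<open>On V the mate becomes the usual formula for the mate of a transformation between
  functors with given unit and counit: unit, then \<open>a\<close>, then counit. The duals and
  \<eta> stay arbitrary because \<eta> will also be \<open>coev_tensor\<close>, which is not a
  chosen coevaluation.\<close>

lemma mate_act:
  assumes [simp]: "a \<in> Arr G" "Tgt G a = y" "Src G a = x" "d \<in> Obj G" "d' \<in> Obj G"
    "\<epsilon> \<in> Arr G" "Src G \<epsilon> = d \<boxtimes> y" "Tgt G \<epsilon> = U"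
    "\<eta> \<in> Arr G" "Src G \<eta> = U" "Tgt G \<eta> = x \<boxtimes> d'" "v \<in> Obj V"
  shows "mate G y d \<epsilon> d' \<eta> a \<odot>\<^sub>a Idn V v
    = act_counit d y \<epsilon> (d' \<odot>\<^sub>o v) \<bullet> (Idn G d \<odot>\<^sub>a (a \<odot>\<^sub>a Idn V (d' \<odot>\<^sub>o v))) \<bullet> (Idn G d \<odot>\<^sub>a act_unit x d' \<eta> v)"
proof -
  have [simp]: "x \<in> Obj G" "y \<in> Obj G" using G.Src_Tgt_closed[of a] by simp_all
  show ?thesis
    unfolding mate_def act_counit_def act_unit_def
    by (simp add: ActUnit_tensor[of d' v, symmetric]
        ActAssoc_nat_left[of \<epsilon> "d \<boxtimes> y" U d' v, THEN V.reduce2]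
        pentagon_inv[of d y d' v, THEN V.reduce2]
        ActAssoc_nat_mid[of "TenA G a (Idn G d')" "x \<boxtimes> d'" "y \<boxtimes> d'" d v, THEN V.reduce2]
        ActAssoc_nat_mid[of \<eta> U "x \<boxtimes> d'" d v, THEN V.reduce2]
        inv_RUnit_act
        whisker_right_eq[OF ActAssoc_nat_left[of a x y d' v], of d, THEN V.reduce2])
qed

text \<open>The universal property of the mate: naturality of the coevaluation of y moves it past
  the counit in \<open>mate_act\<close>, and the zigzag identity removes both. With \<eta> arbitrary
  this covers a^L as well as the comparison between (g \<otimes> h)^* and h^* \<otimes> g^*.\<close>

lemma mate_coev:
  assumes [simp]: "a \<in> Arr G" "Tgt G a = y" "Src G a = x" "d' \<in> Obj G"
    "\<eta> \<in> Arr G" "Src G \<eta> = U" "Tgt G \<eta> = x \<boxtimes> d'" "v \<in> Obj V"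
  shows "(Idn G y \<odot>\<^sub>a (mate G y (dual y) (Ev G y) d' \<eta> a \<odot>\<^sub>a Idn V v)) \<bullet> coev y v
    = (a \<odot>\<^sub>a Idn V (d' \<odot>\<^sub>o v)) \<bullet> act_unit x d' \<eta> v"
proof -
  have [simp]: "x \<in> Obj G" "y \<in> Obj G" using G.Src_Tgt_closed[of a] by simp_all
  let ?\<theta> = "(a \<odot>\<^sub>a Idn V (d' \<odot>\<^sub>o v)) \<bullet> act_unit x d' \<eta> v"
  have "mate G y (dual y) (Ev G y) d' \<eta> a \<odot>\<^sub>a Idn V v = ev y (d' \<odot>\<^sub>o v) \<bullet> (Idn G (dual y) \<odot>\<^sub>a ?\<theta>)"
    using mate_act[of a y x "dual y" d' "Ev G y" \<eta> v] by simp
  then have "(Idn G y \<odot>\<^sub>a (mate G y (dual y) (Ev G y) d' \<eta> a \<odot>\<^sub>a Idn V v)) \<bullet> coev y v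
      = (Idn G y \<odot>\<^sub>a ev y (d' \<odot>\<^sub>o v)) \<bullet> (Idn G y \<odot>\<^sub>a (Idn G (dual y) \<odot>\<^sub>a ?\<theta>)) \<bullet> coev y v"
    by simp
  also have "\<dots> = (Idn G y \<odot>\<^sub>a ev y (d' \<odot>\<^sub>o v)) \<bullet> coev y (y \<odot>\<^sub>o (d' \<odot>\<^sub>o v)) \<bullet> ?\<theta>"
    by (subst act_unit_nat[of y "dual y" "Coev G y" ?\<theta> v "y \<odot>\<^sub>o (d' \<odot>\<^sub>o v)"]) simp_all
  also have "\<dots> = ?\<theta>"
    by (simp add: act_zigzag[of y "d' \<odot>\<^sub>o v", THEN V.reduce2])
  finally show ?thesis .
qed

text \<open>Composing \<open>mate_coev\<close> for a^L with the inverse of a^L. This equation is the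
  source of the compatibility of \<psi> with arrows a of the 2-group.\<close>

lemma star_coev:
  assumes [simp]: "a \<in> Arr G" "v \<in> Obj V"
  shows "(a \<odot>\<^sub>a (star_arrow G a \<odot>\<^sub>a Idn V v)) \<bullet> coev (Src G a) v = coev (Tgt G a) v"
proof -
  let ?g = "Src G a" and ?h = "Tgt G a" and ?l = "left_dual_arrow G a"
  let ?s = "inv_arrow G ?l"
  have m: "(Idn G ?h \<odot>\<^sub>a (?l \<odot>\<^sub>a Idn V v)) \<bullet> coev ?h v = (a \<odot>\<^sub>a Idn V (dual ?g \<odot>\<^sub>o v)) \<bullet> coev ?g v"
    unfolding left_dual_arrow_def by (rule mate_coev) simp_all
  have "a \<odot>\<^sub>a (?s \<odot>\<^sub>a Idn V v) = (Idn G ?h \<odot>\<^sub>a (?s \<odot>\<^sub>a Idn V v)) \<bullet> (a \<odot>\<^sub>a Idn V (dual ?g \<odot>\<^sub>o v))"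
    by (simp add: TA_Cmp_eq)
  then have "(a \<odot>\<^sub>a (star_arrow G a \<odot>\<^sub>a Idn V v)) \<bullet> coev ?g v
      = (Idn G ?h \<odot>\<^sub>a (?s \<odot>\<^sub>a Idn V v)) \<bullet> (Idn G ?h \<odot>\<^sub>a (?l \<odot>\<^sub>a Idn V v)) \<bullet> coev ?h v"
    by (simp add: m star_arrow_def)
  also have "\<dots> = coev ?h v"
  proof -
    have "(?s \<odot>\<^sub>a Idn V v) \<bullet> (?l \<odot>\<^sub>a Idn V v) = Idn V (dual ?h \<odot>\<^sub>o v)"
      by (simp add: TA_Cmp_eq)
    from whisker_right_eq[OF this, of ?h, THEN V.reduce2] show ?thesis by simp
  qed
  finally show ?thesis .
qed

section \<open>The dual of a tensor product\<close>

definition dual_act where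
  "dual_act g h v = ActAssoc V (dual h) (dual g) v \<bullet> (dual_tensor_iso G g h \<odot>\<^sub>a Idn V v)"

lemma dual_act_simps [simp]:
  assumes "g \<in> Obj G" "h \<in> Obj G" "v \<in> Obj V"
  shows "dual_act g h v \<in> Arr V" "Src V (dual_act g h v) = dual (g \<boxtimes> h) \<odot>\<^sub>o v"
    "Tgt V (dual_act g h v) = dual h \<odot>\<^sub>o (dual g \<odot>\<^sub>o v)"
  using assms by (simp_all add: dual_act_def)

text \<open>\<open>coev_tensor\<close> inserts the coevaluation of h into the middle of that of g;
  on V this is plain nesting, once the associators are moved into the action.\<close>

lemma coev_tensor_act:
  assumes [simp]: "g \<in> Obj G" "h \<in> Obj G" "v \<in> Obj V"
  shows "ActAssoc V g h (dual h \<odot>\<^sub>o (dual g \<odot>\<^sub>o v)) \<bullet> (Idn G (g \<boxtimes> h) \<odot>\<^sub>a ActAssoc V (dual h) (dual g) v)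
      \<bullet> act_unit (g \<boxtimes> h) (dual h \<boxtimes> dual g) (coev_tensor G g h) v
    = (Idn G g \<odot>\<^sub>a coev h (dual g \<odot>\<^sub>o v)) \<bullet> coev g v"
proof -
  let ?A = "ActAssoc V" and ?L = "\<lambda>f. Idn G g \<odot>\<^sub>a f" and ?R = "\<lambda>f. f \<odot>\<^sub>a Idn V v"
  let ?H = "dual h" and ?D = "dual g"
  let ?tail = "?R (Coev G g) \<bullet> inv_arrow V (ActUnit V v)"
  have "?A g h (?H \<odot>\<^sub>o (?D \<odot>\<^sub>o v)) \<bullet> (Idn G (g \<boxtimes> h) \<odot>\<^sub>a ?A ?H ?D v)
      \<bullet> act_unit (g \<boxtimes> h) (?H \<boxtimes> ?D) (coev_tensor G g h) v
    = ?L (Idn G h \<odot>\<^sub>a ?A ?H ?D v) \<bullet> ?L (?A h (?H \<boxtimes> ?D) v) \<bullet> ?L (?R (Assoc G h ?H ?D))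
      \<bullet> ?L (?R (TenA G (Coev G h) (Idn G ?D))) \<bullet> ?L (?R (inv_arrow G (LUnit G ?D)))
      \<bullet> ?A g ?D v \<bullet> ?tail"
    unfolding act_unit_def coev_tensor_def
    by (simp add: ActAssoc_nat_right[of "?A ?H ?D v" "(?H \<boxtimes> ?D) \<odot>\<^sub>o v" "?H \<odot>\<^sub>o (?D \<odot>\<^sub>o v)" g h, THEN V.reduce2]
        pentagon_inv[of g h "?H \<boxtimes> ?D" v, THEN V.reduce2]
        ActAssoc_nat_mid[of "Assoc G h ?H ?D" "(h \<boxtimes> ?H) \<boxtimes> ?D" "h \<boxtimes> (?H \<boxtimes> ?D)" g v, THEN V.reduce2]
        ActAssoc_nat_mid[of "TenA G (Coev G h) (Idn G ?D)" "U \<boxtimes> ?D" "(h \<boxtimes> ?H) \<boxtimes> ?D" g v, THEN V.reduce2]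
        ActAssoc_nat_mid[of "inv_arrow G (LUnit G ?D)" "?D" "U \<boxtimes> ?D" g v, THEN V.reduce2])
  \<comment> \<open>Everything before \<open>?A g ?D v\<close> is whiskered by g. Taken together it
    is a computation about h alone, which pentagon and unit coherence reduce to
    \<open>coev h\<close>.\<close>
  also have "\<dots> = ?L ((Idn G h \<odot>\<^sub>a ?A ?H ?D v) \<bullet> ?A h (?H \<boxtimes> ?D) v \<bullet> ?R (Assoc G h ?H ?D)
      \<bullet> ?R (TenA G (Coev G h) (Idn G ?D)) \<bullet> ?R (inv_arrow G (LUnit G ?D)))
      \<bullet> ?A g ?D v \<bullet> ?tail"
    by simp
  also have "(Idn G h \<odot>\<^sub>a ?A ?H ?D v) \<bullet> ?A h (?H \<boxtimes> ?D) v \<bullet> ?R (Assoc G h ?H ?D)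
      \<bullet> ?R (TenA G (Coev G h) (Idn G ?D)) \<bullet> ?R (inv_arrow G (LUnit G ?D)) = coev h (?D \<odot>\<^sub>o v)"
    unfolding act_unit_def
    by (simp add: Act_pentagon[of h ?H ?D v, THEN V.reduce3] inv_LUnit_act
        ActAssoc_nat_left[of "Coev G h" U "h \<boxtimes> ?H" ?D v, THEN V.reduce2])
  finally show ?thesis by (simp add: act_unit_def)
qed

text \<open>The chosen dual of g \<otimes> h is related to h^* \<otimes> g^* only as a mate of the
  identity, so \<open>mate_coev\<close> replaces its coevaluation by \<open>coev_tensor\<close>,
  which \<open>coev_tensor_act\<close> then unnests.\<close>

lemma dual_act_coev:
  assumes [simp]: "g \<in> Obj G" "h \<in> Obj G" "v \<in> Obj V"
  shows "ActAssoc V g h (dual h \<odot>\<^sub>o (dual g \<odot>\<^sub>o v)) \<bullet> (Idn G (g \<boxtimes> h) \<odot>\<^sub>a dual_act g h v) \<bullet> coev (g \<boxtimes> h) v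
    = (Idn G g \<odot>\<^sub>a coev h (dual g \<odot>\<^sub>o v)) \<bullet> coev g v"
proof -
  have "(Idn G (g \<boxtimes> h) \<odot>\<^sub>a (dual_tensor_iso G g h \<odot>\<^sub>a Idn V v)) \<bullet> coev (g \<boxtimes> h) v
    = (Idn G (g \<boxtimes> h) \<odot>\<^sub>a Idn V ((dual h \<boxtimes> dual g) \<odot>\<^sub>o v))
      \<bullet> act_unit (g \<boxtimes> h) (dual h \<boxtimes> dual g) (coev_tensor G g h) v"
    unfolding dual_tensor_iso_def by (rule mate_coev) simp_all
  then show ?thesis
    using coev_tensor_act[of g h v] by (simp add: dual_act_def)
qed

text \<open>The inverse of \<open>act_conj_iso\<close>. It contains no inverse associators, so
  naturality and pentagon apply to it directly; equations between components of \<psi> are checked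
  after composing with it and cancelling.\<close>

definition unconj where
  "unconj g x v = ActAssoc V g x (dual g \<odot>\<^sub>o v) \<bullet> ActAssoc V (g \<boxtimes> x) (dual g) v"

lemma unconj_simps [simp]:
  assumes "g \<in> Obj G" "x \<in> Obj G" "v \<in> Obj V"
  shows "unconj g x v \<in> Arr V" "Src V (unconj g x v) = conj_obj G g x \<odot>\<^sub>o v"
    "Tgt V (unconj g x v) = g \<odot>\<^sub>o (x \<odot>\<^sub>o (dual g \<odot>\<^sub>o v))" "iso_arrow V (unconj g x v)"
  using assms by (simp_all add: unconj_def conj_obj_def)

lemma act_conj_iso_eq:
  assumes "g \<in> Obj G" "x \<in> Obj G" "v \<in> Obj V"
  shows "act_conj_iso G V g x v = inv_arrow V (unconj g x v)"
  using assms by (simp add: unconj_def act_conj_iso_def)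

lemma act_coev_iso_eq: "act_coev_iso G V g v = coev g v"
  by (simp add: act_coev_iso_def act_unit_def)

lemma unconj_nat:
  assumes [simp]: "a \<in> Arr G" "b \<in> Arr G" "c \<in> Arr G" "Src G c = dual (Src G a)"
    "Tgt G c = dual (Tgt G a)" "f \<in> Arr V"
  shows "unconj (Tgt G a) (Tgt G b) (Tgt V f) \<bullet> (TenA G (TenA G a b) c \<odot>\<^sub>a f)
    = (a \<odot>\<^sub>a (b \<odot>\<^sub>a (c \<odot>\<^sub>a f))) \<bullet> unconj (Src G a) (Src G b) (Src V f)"
  using ActAssoc_nat[of a b "c \<odot>\<^sub>a f", THEN V.reduce2, of "ActAssoc V (Src G a \<boxtimes> Src G b) (dual (Src G a)) (Src V f)"]
    ActAssoc_nat[of "TenA G a b" c f]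
  by (simp add: unconj_def)

text \<open>Each of the three associators in \<open>conj_tensor_iso\<close> is exchanged by a
  pentagon for associators of the action. Apart from one associator of the action, only the
  comparison of duals survives, as \<open>dual_act\<close>.\<close>

lemma unconj_conj_tensor:
  assumes [simp]: "g \<in> Obj G" "h \<in> Obj G" "x \<in> Obj G" "v \<in> Obj V"
  shows "(Idn G g \<odot>\<^sub>a unconj h x (dual g \<odot>\<^sub>o v)) \<bullet> unconj g (conj_obj G h x) v
      \<bullet> (conj_tensor_iso G g h x \<odot>\<^sub>a Idn V v)
    = ActAssoc V g h (x \<odot>\<^sub>o (dual h \<odot>\<^sub>o (dual g \<odot>\<^sub>o v)))
      \<bullet> (Idn G (g \<boxtimes> h) \<odot>\<^sub>a (Idn G x \<odot>\<^sub>a dual_act g h v)) \<bullet> unconj (g \<boxtimes> h) x v"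
proof -
  let ?A = "ActAssoc V" and ?L = "\<lambda>f. Idn G g \<odot>\<^sub>a f" and ?R = "\<lambda>f. f \<odot>\<^sub>a Idn V v"
  let ?H = "dual h" and ?D = "dual g" and ?w = "dual g \<odot>\<^sub>o v"
  let ?d = "dual_tensor_iso G g h" and ?\<alpha> = "Assoc G g h x"
  have "?L (unconj h x ?w) \<bullet> unconj g (conj_obj G h x) v \<bullet> ?R (conj_tensor_iso G g h x)
    = ?L (?A h x (?H \<odot>\<^sub>o ?w)) \<bullet> ?L (?A (h \<boxtimes> x) ?H ?w) \<bullet> ?A g ((h \<boxtimes> x) \<boxtimes> ?H) ?w
      \<bullet> (Assoc G g (h \<boxtimes> x) ?H \<odot>\<^sub>a Idn V ?w) \<bullet> ?A ((g \<boxtimes> (h \<boxtimes> x)) \<boxtimes> ?H) ?D v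
      \<bullet> ?R (inv_arrow G (Assoc G (g \<boxtimes> (h \<boxtimes> x)) ?H ?D))
      \<bullet> ?R (TenA G ?\<alpha> (Idn G (?H \<boxtimes> ?D))) \<bullet> ?R (TenA G (Idn G ((g \<boxtimes> h) \<boxtimes> x)) ?d)"
    unfolding unconj_def conj_tensor_iso_def conj_obj_def
    by (simp add: ActAssoc_nat_left[of "Assoc G g (h \<boxtimes> x) ?H" "(g \<boxtimes> (h \<boxtimes> x)) \<boxtimes> ?H" "g \<boxtimes> ((h \<boxtimes> x) \<boxtimes> ?H)" ?D v,
          THEN V.reduce2])
  also have "\<dots> = ?L (?A h x (?H \<odot>\<^sub>o ?w)) \<bullet> ?A g (h \<boxtimes> x) (?H \<odot>\<^sub>o ?w)
      \<bullet> (Idn G (g \<boxtimes> (h \<boxtimes> x)) \<odot>\<^sub>a ?A ?H ?D v) \<bullet> ?A (g \<boxtimes> (h \<boxtimes> x)) (?H \<boxtimes> ?D) v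
      \<bullet> ?R (TenA G ?\<alpha> (Idn G (?H \<boxtimes> ?D))) \<bullet> ?R (TenA G (Idn G ((g \<boxtimes> h) \<boxtimes> x)) ?d)"
    by (simp add: Act_pentagon[of g "h \<boxtimes> x" ?H ?w, THEN V.reduce3]
        pentagon_inv[of "g \<boxtimes> (h \<boxtimes> x)" ?H ?D v, THEN V.reduce2])
  also have "\<dots> = ?L (?A h x (?H \<odot>\<^sub>o ?w)) \<bullet> ?A g (h \<boxtimes> x) (?H \<odot>\<^sub>o ?w)
      \<bullet> (?\<alpha> \<odot>\<^sub>a Idn V (?H \<odot>\<^sub>o ?w)) \<bullet> (Idn G ((g \<boxtimes> h) \<boxtimes> x) \<odot>\<^sub>a dual_act g h v)
      \<bullet> ?A ((g \<boxtimes> h) \<boxtimes> x) (dual (g \<boxtimes> h)) v"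
    by (simp add: dual_act_def
        ActAssoc_nat_left[of ?\<alpha> "(g \<boxtimes> h) \<boxtimes> x" "g \<boxtimes> (h \<boxtimes> x)" "?H \<boxtimes> ?D" v, THEN V.reduce2]
        ActAssoc_nat_mid[of ?d "dual (g \<boxtimes> h)" "?H \<boxtimes> ?D" "(g \<boxtimes> h) \<boxtimes> x" v]
        TA_interchange[of ?\<alpha> "?A ?H ?D v" "(g \<boxtimes> h) \<boxtimes> x" "g \<boxtimes> (h \<boxtimes> x)" "(?H \<boxtimes> ?D) \<odot>\<^sub>o v" "?H \<odot>\<^sub>o ?w", THEN V.reduce2])
  also have "\<dots> = ?A g h (x \<odot>\<^sub>o (?H \<odot>\<^sub>o ?w)) \<bullet> ?A (g \<boxtimes> h) x (?H \<odot>\<^sub>o ?w)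
      \<bullet> (Idn G ((g \<boxtimes> h) \<boxtimes> x) \<odot>\<^sub>a dual_act g h v) \<bullet> ?A ((g \<boxtimes> h) \<boxtimes> x) (dual (g \<boxtimes> h)) v"
    by (simp add: Act_pentagon[of g h x "?H \<odot>\<^sub>o ?w", THEN V.reduce3])
  also have "\<dots> = ?A g h (x \<odot>\<^sub>o (?H \<odot>\<^sub>o ?w)) \<bullet> (Idn G (g \<boxtimes> h) \<odot>\<^sub>a (Idn G x \<odot>\<^sub>a dual_act g h v))
      \<bullet> unconj (g \<boxtimes> h) x v"
    by (simp add: unconj_def
        ActAssoc_nat_right[of "dual_act g h v" "dual (g \<boxtimes> h) \<odot>\<^sub>o v" "?H \<odot>\<^sub>o ?w" "g \<boxtimes> h" x, THEN V.reduce2])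
  finally show ?thesis .
qed

text \<open>Triangle and pentagon move the unitor and the associator of \<open>conj_self_iso\<close>
  into the action; as in \<open>act_zigzag\<close>, an inserted identity prepares the pentagon. The
  factor \<open>unconj\<close> is there to cancel against its inverse in \<psi>.\<close>

lemma conj_self_act:
  assumes [simp]: "g \<in> Obj G" "v \<in> Obj V"
  shows "(conj_self_iso G g \<odot>\<^sub>a Idn V v) = (Idn G g \<odot>\<^sub>a inv_arrow V (coev g v)) \<bullet> unconj g g v"
proof -
  let ?A = "ActAssoc V" and ?L = "\<lambda>f. Idn G g \<odot>\<^sub>a f" and ?R = "\<lambda>f. f \<odot>\<^sub>a Idn V v"
  have "?R (conj_self_iso G g) = ?L (ActUnit V v) \<bullet> ?A g U v \<bullet> ?R (TenA G (Idn G g) (inv_arrow G (Coev G g)))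
      \<bullet> ?R (Assoc G g g (dual g))"
    unfolding conj_self_iso_def by (simp add: Act_triangle[of g v, THEN V.reduce2])
  also have "\<dots> = ?L (ActUnit V v) \<bullet> ?L (?R (inv_arrow G (Coev G g))) \<bullet> ?A g (g \<boxtimes> dual g) v
      \<bullet> ?R (Assoc G g g (dual g))"
    by (simp add: ActAssoc_nat_mid[of "inv_arrow G (Coev G g)" "g \<boxtimes> dual g" U g v, THEN V.reduce2])
  also have "\<dots> = ?L (ActUnit V v) \<bullet> ?L (?R (inv_arrow G (Coev G g))) \<bullet> ?L (inv_arrow V (?A g (dual g) v))
      \<bullet> ?L (?A g (dual g) v) \<bullet> ?A g (g \<boxtimes> dual g) v \<bullet> ?R (Assoc G g g (dual g))"
    by (simp add: whisker_right_eq[OF V.inv_simps(4), of "?A g (dual g) v" g, THEN V.reduce2])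
  also have "\<dots> = ?L (ActUnit V v) \<bullet> ?L (?R (inv_arrow G (Coev G g))) \<bullet> ?L (inv_arrow V (?A g (dual g) v))
      \<bullet> unconj g g v"
    by (simp add: Act_pentagon[of g g "dual g" v] unconj_def)
  also have "\<dots> = ?L (inv_arrow V (coev g v)) \<bullet> unconj g g v"
    by (simp add: act_unit_def)
  finally show ?thesis .
qed

text \<open>Evaluation conjugates g^* \<odot> (g \<odot> f) into f.\<close>

lemma act_faithful:
  assumes "g \<in> Obj G" "f \<in> Arr V" "f' \<in> Arr V" "Src V f = v" "Src V f' = v" "Tgt V f = w" "Tgt V f' = w"
    "Idn G g \<odot>\<^sub>a f = Idn G g \<odot>\<^sub>a f'"
  shows "f = f'"
proof (rule V.iso_cancel_right)
  have v: "v \<in> Obj V" using assms(2,4) by auto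
  then show "iso_arrow V (ev g v)" using assms(1) by simp
  have n: "f \<bullet> ev g v = ev g w \<bullet> (Idn G (dual g) \<odot>\<^sub>a (Idn G g \<odot>\<^sub>a f))"
    "f' \<bullet> ev g v = ev g w \<bullet> (Idn G (dual g) \<odot>\<^sub>a (Idn G g \<odot>\<^sub>a f'))"
    using assms(1-7) by (simp_all add: act_counit_nat)
  show "f \<bullet> ev g v = f' \<bullet> ev g v" by (simp only: n assms(8))
  show "Src V f = Tgt V (ev g v)" "Src V f' = Tgt V (ev g v)"
    using v assms(1,4,5) by simp_all
qed (rule assms)+

text \<open>Naturality of the coevaluation along its own component, which is invertible and can be
  cancelled. The invertible case for \<alpha> is the same argument.\<close>

lemma coev_coev:
  assumes [simp]: "g \<in> Obj G" "v \<in> Obj V"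
  shows "Idn G g \<odot>\<^sub>a (Idn G (dual g) \<odot>\<^sub>a coev g v) = coev g (g \<odot>\<^sub>o (dual g \<odot>\<^sub>o v))"
proof (rule V.iso_cancel_right[of "coev g v"])
  show "(Idn G g \<odot>\<^sub>a (Idn G (dual g) \<odot>\<^sub>a coev g v)) \<bullet> coev g v = coev g (g \<odot>\<^sub>o (dual g \<odot>\<^sub>o v)) \<bullet> coev g v"
    by (rule act_unit_nat) simp_all
qed simp_all

text \<open>After the faithful functor g \<odot> - is applied, \<open>coev_coev\<close> turns the
  claim into \<open>act_zigzag\<close>.\<close>

lemma act_zigzag_dual:
  assumes [simp]: "g \<in> Obj G" "v \<in> Obj V"
  shows "ev g (dual g \<odot>\<^sub>o v) \<bullet> (Idn G (dual g) \<odot>\<^sub>a coev g v) = Idn V (dual g \<odot>\<^sub>o v)"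
proof (rule act_faithful[of g _ _ "dual g \<odot>\<^sub>o v" "dual g \<odot>\<^sub>o v"])
  show "Idn G g \<odot>\<^sub>a (ev g (dual g \<odot>\<^sub>o v) \<bullet> (Idn G (dual g) \<odot>\<^sub>a coev g v)) = Idn G g \<odot>\<^sub>a Idn V (dual g \<odot>\<^sub>o v)"
    by (simp add: coev_coev act_zigzag)
qed simp_all

end

section \<open>Linear algebra\<close>

text \<open>An injective linear map keeps independent sets independent, so their size is bounded by
  the dimension of the target. A maximal independent set therefore exists, is finite, and generates
  the source.\<close>

lemma (in linear_map) inj_fin_dim:
  assumes inj: "inj_on T (carrier V)" and fd: "W.fin_dim"
  shows "V.fin_dim"
proof -
  have li_image: "W.module.lin_indpt (T ` B)"
    if B: "finite B" "B \<subseteq> carrier V" "V.module.lin_indpt B" for B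
  proof (rule W.module.finite_lin_indpt2)
    show "finite (T ` B)" "T ` B \<subseteq> carrier W" using B by auto
    fix a assume a: "a \<in> T ` B \<rightarrow> carrier K" and z: "W.module.lincomb a (T ` B) = \<zero>\<^bsub>W\<^esub>"
    have aT: "a \<circ> T \<in> B \<rightarrow> carrier K" using a by auto
    have "T (V.module.lincomb (a \<circ> T) B) = T \<zero>\<^bsub>V\<^esub>"
      using lincomb_linear_image[OF inj B(2) a B(1)] z by simp
    then have "V.module.lincomb (a \<circ> T) B = \<zero>\<^bsub>V\<^esub>"
      by (rule inj_onD[OF inj]) (use B(2) aT V.module.lincomb_closed in auto)
    then have "a \<circ> T \<in> B \<rightarrow> {\<zero>\<^bsub>K\<^esub>}"
      using V.not_lindepD[OF B(3,1) subset_refl aT] by simp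
    then show "\<forall>v\<in>T ` B. a v = \<zero>\<^bsub>K\<^esub>" by auto
  qed
  have card: "card B \<le> W.dim" if B: "finite B" "B \<subseteq> carrier V" "V.module.lin_indpt B" for B
  proof -
    have "card B = card (T ` B)" using inj B(2) by (simp add: card_image inj_on_subset)
    also have "\<dots> \<le> W.dim" using W.li_le_dim(2)[OF fd _ li_image[OF B]] B(2) by auto
    finally show ?thesis .
  qed
  have bound: "finite A \<and> card A \<le> W.dim" if A: "A \<subseteq> carrier V \<and> V.module.lin_indpt A" for A
  proof -
    have "finite A"
    proof (rule ccontr)
      \<comment> \<open>An infinite independent set would contain a finite one with more elements
        than \<open>card\<close> permits.\<close>
      assume "infinite A"
      then obtain B where B: "B \<subseteq> A" "finite B" "card B = Suc W.dim"
        using infinite_arbitrarily_large by metis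
      then have "V.module.lin_indpt B" using V.module.subset_li_is_li[of A B] A by auto
      then show False using card[of B] B A by auto
    qed
    then show ?thesis using card A by auto
  qed
  have "{} \<subseteq> carrier V \<and> V.module.lin_indpt {}" by (auto simp: V.module.lin_dep_def)
  then obtain A where A: "finite A" "maximal A (\<lambda>S. S \<subseteq> carrier V \<and> V.module.lin_indpt S)"
    using maximal_exists[of "\<lambda>S. S \<subseteq> carrier V \<and> V.module.lin_indpt S" W.dim "{}"] bound by blast
  then show ?thesis
    using V.max_li_is_gen[OF A(2)] unfolding V.fin_dim_def maximal_def by blast
qed

section \<open>Linear maps and the category of vector spaces\<close>

lemma linear_mapI:
  assumes "vectorspace K V" "vectorspace K W" "T \<in> LinearCombinations.module_hom K V W"
  shows "linear_map K V W T"
  using assms by (auto simp: linear_map_def mod_hom_def mod_hom_axioms_def vectorspace_def)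

lemma linear_map_hom: "linear_map K V W T \<Longrightarrow> T \<in> LinearCombinations.module_hom K V W"
  by (auto simp: linear_map_def mod_hom_def mod_hom_axioms_def)

lemma linear_map_comp:
  assumes "linear_map K A B f" "linear_map K B C g"
  shows "linear_map K A C (\<lambda>v. g (f v))"
proof (rule linear_mapI)
  show "(\<lambda>v. g (f v)) \<in> LinearCombinations.module_hom K A C"
    using linear_map_hom[OF assms(1)] linear_map_hom[OF assms(2)]
    by (auto simp: LinearCombinations.module_hom_def Pi_def)
qed (use assms in \<open>auto simp: linear_map_def\<close>)

lemma category_Vec:
  fixes K :: "('k, 'z) ring_scheme"
  shows "category (Vec K :: (('k, 'v) module, ('k, 'v) vec_arrow) cat)"
proof -
  have ext: "compose (carrier U) f (\<lambda>u\<in>carrier U. u) = f"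
    "f \<in> carrier U \<rightarrow> A \<Longrightarrow> compose (carrier U) (\<lambda>u\<in>A. u) f = f"
    if "f \<in> extensional (carrier U)" for f :: "'v \<Rightarrow> 'v" and U :: "('k, 'v) module" and A
    using that by (auto simp: compose_def extensional_def fun_eq_iff)
  have assoc: "compose A (compose B h g) f = compose A h (compose A g f)"
    if "f \<in> A \<rightarrow> B" for A B :: "'v set" and f g h :: "'v \<Rightarrow> 'v"
    using that by (auto simp: compose_def fun_eq_iff)
  have idn: "(\<lambda>u\<in>carrier U. u) \<in> LinearCombinations.module_hom K U U"
    if "fd_vectorspace K U" for U :: "('k, 'v) module"
  proof -
    interpret vectorspace K U using that by (simp add: fd_vectorspace_def)
    show ?thesis by (auto simp: LinearCombinations.module_hom_def)
  qed
  have cmp: "compose (carrier U) g f \<in> LinearCombinations.module_hom K U Y"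
    if "fd_vectorspace K U" "f \<in> LinearCombinations.module_hom K U W"
      "g \<in> LinearCombinations.module_hom K W Y" for U W Y :: "('k, 'v) module" and f g
  proof -
    interpret vectorspace K U using that by (simp add: fd_vectorspace_def)
    show ?thesis
      using that(2,3) by (auto simp: LinearCombinations.module_hom_def compose_def Pi_def)
  qed
  have cl: "f \<in> carrier U \<rightarrow> carrier W" if "f \<in> LinearCombinations.module_hom K U W"
    for U W :: "('k, 'v) module" and f
    using that by (simp add: LinearCombinations.module_hom_def)
  show ?thesis
    by unfold_locales (auto simp: Vec_def Hom_def ext assoc idn cmp cl)
qed

lemma Vec_arr_iff:
  "(U, f, W) \<in> Hom (Vec K) U' W' \<longleftrightarrow> U = U' \<and> W = W' \<and> fd_vectorspace K U \<and> fd_vectorspace K W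
    \<and> f \<in> LinearCombinations.module_hom K U W \<and> f \<in> extensional (carrier U)"
  by (auto simp: Vec_def Hom_def)

text \<open>The set-theoretic inverse is restricted to the carrier because arrows of
  \<open>Vec\<close> are extensional. Its linearity is checked after applying the injective map
  f.\<close>

lemma iso_VecI:
  assumes f: "(U, f, W) \<in> Hom (Vec K) U W" and bij: "bij_betw f (carrier U) (carrier W)"
  shows "iso_arrow (Vec K) (U, f, W)"
proof -
  let ?g = "restrict (inv_into (carrier U) f) (carrier W)"
  have gf: "\<And>u. u \<in> carrier U \<Longrightarrow> ?g (f u) = u" and fg: "\<And>w. w \<in> carrier W \<Longrightarrow> f (?g w) = w"
    and gc: "\<And>w. w \<in> carrier W \<Longrightarrow> ?g w \<in> carrier U" and fc: "\<And>u. u \<in> carrier U \<Longrightarrow> f u \<in> carrier W"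
    using bij by (auto simp: bij_betw_inv_into_left bij_betw_inv_into_right bij_betwE
        intro: bij_betwE[OF bij_betw_inv_into[OF bij], rule_format])
  have U: "vectorspace K U" and W: "vectorspace K W" using f by (auto simp: Vec_arr_iff fd_vectorspace_def)
  interpret U: vectorspace K U by fact
  interpret W: vectorspace K W by fact
  have hom: "f \<in> LinearCombinations.module_hom K U W" using f by (simp add: Vec_arr_iff)
  have inj: "inj_on f (carrier U)" using bij by (simp add: bij_betw_def)
  have "?g \<in> LinearCombinations.module_hom K W U"
    unfolding LinearCombinations.module_hom_def
  proof (intro CollectI conjI allI impI)
    show "?g \<in> carrier W \<rightarrow> carrier U" using gc by auto
  next
    fix v w assume vw: "v \<in> carrier W \<and> w \<in> carrier W"
    have "f (?g (v \<oplus>\<^bsub>W\<^esub> w)) = f (?g v \<oplus>\<^bsub>U\<^esub> ?g w)"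
      using vw gc fg by (simp add: module_hom_add[OF hom] del: restrict_apply)
    then show "?g (v \<oplus>\<^bsub>W\<^esub> w) = ?g v \<oplus>\<^bsub>U\<^esub> ?g w"
      using vw gc inj by (simp add: inj_on_eq_iff del: restrict_apply)
  next
    fix r w assume rw: "r \<in> carrier K \<and> w \<in> carrier W"
    have "f (?g (r \<odot>\<^bsub>W\<^esub> w)) = f (r \<odot>\<^bsub>U\<^esub> ?g w)"
      using rw gc fg by (simp add: module_hom_smult[OF hom] del: restrict_apply)
    then show "?g (r \<odot>\<^bsub>W\<^esub> w) = r \<odot>\<^bsub>U\<^esub> ?g w"
      using rw gc inj by (simp add: inj_on_eq_iff del: restrict_apply)
  qed
  then have "inverse_arrows (Vec K) (U, f, W) (W, ?g, U)"
    using f gf fg unfolding inverse_arrows_def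
    by (auto simp: Vec_def Hom_def compose_def)
  then show ?thesis by (auto simp: iso_arrow_def)
qed

section \<open>Hom spaces, zero objects and direct sums\<close>

context linear_category
begin

lemma HomSp_simps:
  assumes "f \<in> Hom C a b" "f' \<in> Hom C a b" "r \<in> carrier K"
  shows "f \<oplus>\<^bsub>HomSp C a b\<^esub> f' \<in> Hom C a b" "r \<odot>\<^bsub>HomSp C a b\<^esub> f \<in> Hom C a b"
    "\<zero>\<^bsub>HomSp C a b\<^esub> \<in> Hom C a b"
proof -
  have ab: "a \<in> Obj C" "b \<in> Obj C" using assms(1) by (auto dest: Hom_Obj)
  interpret H: vectorspace K "HomSp C a b" using HomSp_vectorspace ab .
  show "f \<oplus>\<^bsub>HomSp C a b\<^esub> f' \<in> Hom C a b" "r \<odot>\<^bsub>HomSp C a b\<^esub> f \<in> Hom C a b"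
    "\<zero>\<^bsub>HomSp C a b\<^esub> \<in> Hom C a b"
    using H.smult_closed[of r f] H.M.add.m_closed[of f f'] H.M.zero_closed assms
    by (simp_all add: HomSp_carrier[OF ab])
qed

lemma zero_Hom: "\<lbrakk>a \<in> Obj C; b \<in> Obj C\<rbrakk> \<Longrightarrow> \<zero>\<^bsub>HomSp C a b\<^esub> \<in> Hom C a b"
  using HomSp_vectorspace[of a b] HomSp_carrier[of a b]
  by (auto simp: vectorspace_def module_def abelian_group_def dest: abelian_monoid.zero_closed)

lemma zero_simps [simp]:
  assumes "a \<in> Obj C" "b \<in> Obj C"
  shows "\<zero>\<^bsub>HomSp C a b\<^esub> \<in> Arr C" "Src C \<zero>\<^bsub>HomSp C a b\<^esub> = a" "Tgt C \<zero>\<^bsub>HomSp C a b\<^esub> = b"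
  using zero_Hom[OF assms] by (simp_all add: Hom_iff)

lemma Cmp_zero [simp]:
  assumes "f \<in> Arr C" "a \<in> Obj C"
  shows "Tgt C f = b \<Longrightarrow> \<zero>\<^bsub>HomSp C b a\<^esub> \<bullet> f = \<zero>\<^bsub>HomSp C (Src C f) a\<^esub>"
    "Src C f = b \<Longrightarrow> f \<bullet> \<zero>\<^bsub>HomSp C a b\<^esub> = \<zero>\<^bsub>HomSp C a (Tgt C f)\<^esub>"
  using linear_map.T0_is_0[OF Cmp_linear_left[of f "Src C f" b a]]
    linear_map.T0_is_0[OF Cmp_linear_right[of a f b "Tgt C f"]] assms
  by (auto simp: Hom_iff)

lemma Cmp_bilinear:
  assumes "f \<in> Hom C a b" "f' \<in> Hom C a b" "g \<in> Hom C b c" "g' \<in> Hom C b c" "r \<in> carrier K"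
  shows "g \<bullet> (f \<oplus>\<^bsub>HomSp C a b\<^esub> f') = (g \<bullet> f) \<oplus>\<^bsub>HomSp C a c\<^esub> (g \<bullet> f')"
    "g \<bullet> (r \<odot>\<^bsub>HomSp C a b\<^esub> f) = r \<odot>\<^bsub>HomSp C a c\<^esub> (g \<bullet> f)"
    "(g \<oplus>\<^bsub>HomSp C b c\<^esub> g') \<bullet> f = (g \<bullet> f) \<oplus>\<^bsub>HomSp C a c\<^esub> (g' \<bullet> f)"
    "(r \<odot>\<^bsub>HomSp C b c\<^esub> g) \<bullet> f = r \<odot>\<^bsub>HomSp C a c\<^esub> (g \<bullet> f)"
proof -
  have o: "a \<in> Obj C" "b \<in> Obj C" "c \<in> Obj C" using assms(1,3) by (auto dest: Hom_Obj)
  note R = linear_map_hom[OF Cmp_linear_right[OF o(1) assms(3)]]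
  note L = linear_map_hom[OF Cmp_linear_left[OF assms(1) o(3)]]
  show "g \<bullet> (f \<oplus>\<^bsub>HomSp C a b\<^esub> f') = (g \<bullet> f) \<oplus>\<^bsub>HomSp C a c\<^esub> (g \<bullet> f')"
    "g \<bullet> (r \<odot>\<^bsub>HomSp C a b\<^esub> f) = r \<odot>\<^bsub>HomSp C a c\<^esub> (g \<bullet> f)"
    "(g \<oplus>\<^bsub>HomSp C b c\<^esub> g') \<bullet> f = (g \<bullet> f) \<oplus>\<^bsub>HomSp C a c\<^esub> (g' \<bullet> f)"
    "(r \<odot>\<^bsub>HomSp C b c\<^esub> g) \<bullet> f = r \<odot>\<^bsub>HomSp C a c\<^esub> (g \<bullet> f)"
    using module_hom_add[OF R, of f f'] module_hom_smult[OF R, of r f]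
      module_hom_add[OF L, of g g'] module_hom_smult[OF L, of r g] assms
    by (simp_all add: HomSp_carrier o)
qed

text \<open>The axioms hold componentwise because each Hom space is a vector space; bilinearity of
  composition keeps sums and multiples natural.\<close>

lemma vectorspace_nat_space:
  assumes F: "functor_between A C F" and F': "functor_between A C F'" and K: "field K"
  shows "vectorspace K (nat_space A C F F')"
proof -
  interpret F: functor_between A C F by fact
  interpret F': functor_between A C F' by fact
  interpret K: field K by fact
  let ?N = "nat_trans A C F F'" and ?H = "\<lambda>a. HomSp C (FObj F a) (FObj F' a)"
  have H: "vectorspace K (?H a)" if "a \<in> Obj A" for a
    using that by (intro HomSp_vectorspace F.FObj_closed F'.FObj_closed)
  have N: "\<eta> a \<in> carrier (?H a)" if "\<eta> \<in> ?N" "a \<in> Obj A" for \<eta> a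
    using that by (simp add: nat_trans_def HomSp_carrier F.FObj_closed F'.FObj_closed)
  have FA: "FArr F f \<in> Hom C (FObj F (Src A f)) (FObj F (Tgt A f))"
    "FArr F' f \<in> Hom C (FObj F' (Src A f)) (FObj F' (Tgt A f))" if "f \<in> Arr A" for f
    using that F.FArr_in_Hom[of f "Src A f" "Tgt A f"] F'.FArr_in_Hom[of f "Src A f" "Tgt A f"]
    by (simp_all add: F.A.Hom_iff)
  have zero: "\<zero>\<^bsub>nat_space A C F F'\<^esub> \<in> ?N"
    using FA by (auto simp: nat_space_def nat_trans_def zero_Hom F.FObj_closed F'.FObj_closed Hom_iff)
  have add: "\<alpha> \<oplus>\<^bsub>nat_space A C F F'\<^esub> \<beta> \<in> ?N" if ab: "\<alpha> \<in> ?N" "\<beta> \<in> ?N" for \<alpha> \<beta>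
    unfolding nat_trans_def
  proof (intro CollectI conjI ballI)
    fix a assume "a \<in> Obj A"
    then show "(\<alpha> \<oplus>\<^bsub>nat_space A C F F'\<^esub> \<beta>) a \<in> Hom C (FObj F a) (FObj F' a)"
      using ab by (simp add: nat_space_def nat_trans_def HomSp_simps(1)[OF _ _ K.zero_closed])
  next
    fix f assume f: "f \<in> Arr A"
    then show "(\<alpha> \<oplus>\<^bsub>nat_space A C F F'\<^esub> \<beta>) (Tgt A f) \<bullet> FArr F f
        = FArr F' f \<bullet> (\<alpha> \<oplus>\<^bsub>nat_space A C F F'\<^esub> \<beta>) (Src A f)"
      using ab FA[OF f] by (simp add: nat_space_def nat_trans_def
        Cmp_bilinear(3)[OF FA(1)[OF f] FA(1)[OF f] _ _ K.zero_closed]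
        Cmp_bilinear(1)[OF _ _ FA(2)[OF f] FA(2)[OF f] K.zero_closed])
  qed (simp add: nat_space_def)
  have smult: "r \<odot>\<^bsub>nat_space A C F F'\<^esub> \<alpha> \<in> ?N" if a: "r \<in> carrier K" "\<alpha> \<in> ?N" for r \<alpha>
    unfolding nat_trans_def
  proof (intro CollectI conjI ballI)
    fix b assume "b \<in> Obj A"
    then show "(r \<odot>\<^bsub>nat_space A C F F'\<^esub> \<alpha>) b \<in> Hom C (FObj F b) (FObj F' b)"
      using a HomSp_simps(2)[of "\<alpha> b" "FObj F b" "FObj F' b" "\<alpha> b" r]
      by (simp add: nat_space_def nat_trans_def)
  next
    fix f assume f: "f \<in> Arr A"
    have 1: "\<alpha> (Src A f) \<in> Hom C (FObj F (Src A f)) (FObj F' (Src A f))"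
      "\<alpha> (Tgt A f) \<in> Hom C (FObj F (Tgt A f)) (FObj F' (Tgt A f))"
      using a f by (simp_all add: nat_trans_def)
    show "(r \<odot>\<^bsub>nat_space A C F F'\<^esub> \<alpha>) (Tgt A f) \<bullet> FArr F f
        = FArr F' f \<bullet> (r \<odot>\<^bsub>nat_space A C F F'\<^esub> \<alpha>) (Src A f)"
      using a f FA[OF f] by (simp add: nat_space_def nat_trans_def
        Cmp_bilinear(4)[OF FA(1)[OF f] FA(1)[OF f] 1(2) 1(2) a(1)]
        Cmp_bilinear(2)[OF 1(1) 1(1) FA(2)[OF f] FA(2)[OF f] a(1)])
  qed (simp add: nat_space_def)
  \<comment> \<open>Multiplication by -1 supplies the negative, so its naturality is already known
    from \<open>smult\<close>.\<close>
  have neg: "\<exists>\<beta>\<in>?N. \<alpha> \<oplus>\<^bsub>nat_space A C F F'\<^esub> \<beta> = \<zero>\<^bsub>nat_space A C F F'\<^esub>" if a: "\<alpha> \<in> ?N" for \<alpha>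
  proof (rule bexI)
    show "\<ominus>\<^bsub>K\<^esub> \<one>\<^bsub>K\<^esub> \<odot>\<^bsub>nat_space A C F F'\<^esub> \<alpha> \<in> ?N" using a by (simp add: smult)
    have "\<alpha> b \<oplus>\<^bsub>?H b\<^esub> (\<ominus>\<^bsub>K\<^esub> \<one>\<^bsub>K\<^esub> \<odot>\<^bsub>?H b\<^esub> \<alpha> b) = \<zero>\<^bsub>?H b\<^esub>" if "b \<in> Obj A" for b
    proof -
      interpret H: vectorspace K "?H b" using H that .
      show ?thesis using N[OF a that] by (simp add: H.smult_minus_1 H.M.r_neg)
    qed
    then show "\<alpha> \<oplus>\<^bsub>nat_space A C F F'\<^esub> (\<ominus>\<^bsub>K\<^esub> \<one>\<^bsub>K\<^esub> \<odot>\<^bsub>nat_space A C F F'\<^esub> \<alpha>) = \<zero>\<^bsub>nat_space A C F F'\<^esub>"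
      by (auto simp: nat_space_def)
  qed
  have pointwise: "module K (?H b)" if "b \<in> Obj A" for b
    using H[OF that] by (rule vectorspace.axioms(1))
  note M = module.smult_l_distr[OF pointwise] module.smult_r_distr[OF pointwise]
    module.smult_assoc1[OF pointwise] module.smult_one[OF pointwise]
    abelian_monoid.a_comm[OF abelian_group.axioms(1)[OF module.axioms(2)[OF pointwise]]]
    abelian_monoid.a_assoc[OF abelian_group.axioms(1)[OF module.axioms(2)[OF pointwise]]]
    abelian_monoid.r_zero[OF abelian_group.axioms(1)[OF module.axioms(2)[OF pointwise]]]
  have ext: "\<eta> \<in> extensional (Obj A)" if "\<eta> \<in> ?N" for \<eta>
    using that by (simp add: nat_trans_def)
  have carrier: "carrier (nat_space A C F F') = ?N" by (simp add: nat_space_def)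
  show ?thesis
  proof (rule vs_criteria, unfold carrier)
    show "\<forall>v w. v \<in> ?N \<and> w \<in> ?N \<longrightarrow> v \<oplus>\<^bsub>nat_space A C F F'\<^esub> w = w \<oplus>\<^bsub>nat_space A C F F'\<^esub> v"
      "\<forall>v w x. v \<in> ?N \<and> w \<in> ?N \<and> x \<in> ?N \<longrightarrow>
        v \<oplus>\<^bsub>nat_space A C F F'\<^esub> w \<oplus>\<^bsub>nat_space A C F F'\<^esub> x
        = v \<oplus>\<^bsub>nat_space A C F F'\<^esub> (w \<oplus>\<^bsub>nat_space A C F F'\<^esub> x)"
      "\<forall>v\<in>?N. v \<oplus>\<^bsub>nat_space A C F F'\<^esub> \<zero>\<^bsub>nat_space A C F F'\<^esub> = v"
      "\<forall>a b v. a \<in> carrier K \<and> b \<in> carrier K \<and> v \<in> ?N \<longrightarrow>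
        a \<otimes>\<^bsub>K\<^esub> b \<odot>\<^bsub>nat_space A C F F'\<^esub> v = a \<odot>\<^bsub>nat_space A C F F'\<^esub> (b \<odot>\<^bsub>nat_space A C F F'\<^esub> v)"
      "\<forall>v\<in>?N. \<one>\<^bsub>K\<^esub> \<odot>\<^bsub>nat_space A C F F'\<^esub> v = v"
      "\<forall>a b v. a \<in> carrier K \<and> b \<in> carrier K \<and> v \<in> ?N \<longrightarrow>
        (a \<oplus>\<^bsub>K\<^esub> b) \<odot>\<^bsub>nat_space A C F F'\<^esub> v
        = a \<odot>\<^bsub>nat_space A C F F'\<^esub> v \<oplus>\<^bsub>nat_space A C F F'\<^esub> b \<odot>\<^bsub>nat_space A C F F'\<^esub> v"
      "\<forall>a v w. a \<in> carrier K \<and> v \<in> ?N \<and> w \<in> ?N \<longrightarrow>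
        a \<odot>\<^bsub>nat_space A C F F'\<^esub> (v \<oplus>\<^bsub>nat_space A C F F'\<^esub> w)
        = a \<odot>\<^bsub>nat_space A C F F'\<^esub> v \<oplus>\<^bsub>nat_space A C F F'\<^esub> a \<odot>\<^bsub>nat_space A C F F'\<^esub> w"
      by (auto simp: nat_space_def N M intro!: restrict_ext extensionalityI[OF restrict_extensional ext])
  qed (use K zero add smult neg in auto)
qed

text \<open>Any arrow into or out of z factors through its identity. As an equation in a Hom space,
  the condition can be carried along a faithful linear functor.\<close>

lemma zero_object_iff:
  "zero_object C z \<longleftrightarrow> z \<in> Obj C \<and> Idn C z = \<zero>\<^bsub>HomSp C z z\<^esub>"
proof
  assume "zero_object C z"
  then show "z \<in> Obj C \<and> Idn C z = \<zero>\<^bsub>HomSp C z z\<^esub>"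
    using Idn_in_Hom[of z] zero_Hom[of z z] unfolding zero_object_def by blast
next
  assume z: "z \<in> Obj C \<and> Idn C z = \<zero>\<^bsub>HomSp C z z\<^esub>"
  have 1: "f = \<zero>\<^bsub>HomSp C a z\<^esub>" if "f \<in> Hom C a z" for f a
  proof -
    have "f = Idn C z \<bullet> f" using that by (auto simp: Hom_iff)
    also have "\<dots> = \<zero>\<^bsub>HomSp C a z\<^esub>" using that z by (auto simp: Hom_iff)
    finally show ?thesis .
  qed
  have 2: "f = \<zero>\<^bsub>HomSp C z a\<^esub>" if "f \<in> Hom C z a" for f a
  proof -
    have "f = f \<bullet> Idn C z" using that by (auto simp: Hom_iff)
    also have "\<dots> = \<zero>\<^bsub>HomSp C z a\<^esub>" using that z by (auto simp: Hom_iff)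
    finally show ?thesis .
  qed
  show "zero_object C z"
    unfolding zero_object_def using z 1 2 zero_Hom by blast
qed

lemma Hom_to_zero:
  assumes "zero_object C z" "f \<in> Hom C a z"
  shows "f = \<zero>\<^bsub>HomSp C a z\<^esub>"
  using assms zero_Hom[of a z] Hom_Obj(1)[OF assms(2)] unfolding zero_object_def by blast

lemma iso_mono: "iso_arrow C m \<Longrightarrow> mono_arrow C m"
  unfolding mono_arrow_def using iso_Arr by (auto simp: Hom_iff intro: iso_cancel_left)

lemma mono_Cmp:
  assumes "mono_arrow C m" "mono_arrow C n" "Src C n = Tgt C m"
  shows "mono_arrow C (n \<bullet> m)"
  unfolding mono_arrow_def
proof (intro conjI allI ballI impI)
  have mn: "m \<in> Arr C" "n \<in> Arr C" using assms by (auto simp: mono_arrow_def)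
  then show "n \<bullet> m \<in> Arr C" using assms(3) by simp
  fix d f g assume f: "f \<in> Hom C d (Src C (n \<bullet> m))" and g: "g \<in> Hom C d (Src C (n \<bullet> m))"
    and eq: "(n \<bullet> m) \<bullet> f = (n \<bullet> m) \<bullet> g"
  have fg: "f \<in> Hom C d (Src C m)" "g \<in> Hom C d (Src C m)" using f g mn assms(3) by simp_all
  have "m \<bullet> f \<in> Hom C d (Src C n)" "m \<bullet> g \<in> Hom C d (Src C n)" "n \<bullet> (m \<bullet> f) = n \<bullet> (m \<bullet> g)"
    using fg mn assms(3) eq by (auto simp: Hom_iff)
  then have "m \<bullet> f = m \<bullet> g" using assms(2) unfolding mono_arrow_def by blast
  then show "f = g" using assms(1) fg unfolding mono_arrow_def by blast
qed

text \<open>The identity of a is the sum of the \<open>\<iota> j \<bullet> \<pi> j\<close>, and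
  linear maps commute with the sum. Arbitrary linear \<open>S\<close> and \<open>T\<close> are
  allowed because the endomorphism may be whiskered by g before it is composed with a component of
  \<alpha>.\<close>

lemma direct_sum_ext:
  assumes ds: "is_direct_sum C n s a \<iota> \<pi>"
    and lin: "linear_map K (HomSp C a a) W S" "linear_map K (HomSp C a a) W T"
    and eq: "\<And>j. j < n \<Longrightarrow> S (\<iota> j \<bullet> \<pi> j) = T (\<iota> j \<bullet> \<pi> j)"
  shows "S (Idn C a) = T (Idn C a)"
proof -
  interpret W: vectorspace K W using lin(1) by (simp add: linear_map_def)
  interpret S: linear_map K "HomSp C a a" W S by fact
  interpret T: linear_map K "HomSp C a a" W T by fact
  have a: "a \<in> Obj C" and id: "finsum (HomSp C a a) (\<lambda>j. \<iota> j \<bullet> \<pi> j) {..<n} = Idn C a"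
    using ds by (auto simp: is_direct_sum_def)
  have p: "(\<lambda>j. \<iota> j \<bullet> \<pi> j) \<in> {..<n} \<rightarrow> carrier (HomSp C a a)"
    using ds Cmp_in_Hom by (auto simp: is_direct_sum_def HomSp_carrier a)
  have sum: "R (finsum (HomSp C a a) p J) = finsum W (\<lambda>j. R (p j)) J"
    if "finite J" "linear_map K (HomSp C a a) W R" "p \<in> J \<rightarrow> carrier (HomSp C a a)"
    for R and p :: "nat \<Rightarrow> _" and J
    using that(1,3)
  proof (induction J)
    case empty
    interpret R: linear_map K "HomSp C a a" W R by fact
    show ?case by simp
  next
    case (insert j J)
    interpret R: linear_map K "HomSp C a a" W R by fact
    have "p \<in> J \<rightarrow> carrier (HomSp C a a)" "p j \<in> carrier (HomSp C a a)"
      "(\<lambda>j. R (p j)) \<in> J \<rightarrow> carrier W" "R (p j) \<in> carrier W"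
      using insert.prems by auto
    then show ?case using insert by simp
  qed
  have "S (Idn C a) = finsum W (\<lambda>j. S (\<iota> j \<bullet> \<pi> j)) {..<n}"
    using sum[OF finite_lessThan lin(1) p] by (simp add: id)
  also have "\<dots> = finsum W (\<lambda>j. T (\<iota> j \<bullet> \<pi> j)) {..<n}"
    using p by (intro W.M.finsum_cong') (auto simp: eq)
  also have "\<dots> = T (Idn C a)"
    using sum[OF finite_lessThan lin(2) p] by (simp add: id)
  finally show ?thesis .
qed

end

section \<open>Schur's lemma and semisimplicity\<close>

context abelian_linear_category
begin

lemma kernel_mono:
  assumes "is_kernel C f i"
  shows "mono_arrow C i"
  unfolding mono_arrow_def
proof (intro conjI allI ballI impI)
  have k: "f \<in> Arr C" "i \<in> Arr C" "Tgt C i = Src C f" "f \<bullet> i = \<zero>\<^bsub>HomSp C (Src C i) (Tgt C f)\<^esub>"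
    using assms by (simp_all add: is_kernel_def)
  show "i \<in> Arr C" by fact
  fix d g h assume g: "g \<in> Hom C d (Src C i)" and h: "h \<in> Hom C d (Src C i)" and eq: "i \<bullet> g = i \<bullet> h"
  have "i \<bullet> g \<in> Hom C d (Src C f)" using g k by (auto simp: Hom_iff)
  moreover have "f \<bullet> (i \<bullet> g) = \<zero>\<^bsub>HomSp C d (Tgt C f)\<^esub>"
    using reduce2[OF k(4), of g] g k(1-3) by (auto simp: Hom_iff)
  ultimately have "\<exists>!u. u \<in> Hom C d (Src C i) \<and> i \<bullet> u = i \<bullet> g"
    using assms unfolding is_kernel_def by blast
  then show "g = h" using g h eq by metis
qed

text \<open>The kernel of f is a monomorphism into the simple object s. If it is invertible, then f
  vanishes; if its source is zero, then f kills no nonzero difference of arrows.\<close>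

lemma schur_mono:
  assumes s: "simple_object C s" and f: "f \<in> Hom C s b"
  shows "f = \<zero>\<^bsub>HomSp C s b\<^esub> \<or> mono_arrow C f"
proof -
  have fA: "f \<in> Arr C" "Src C f = s" "Tgt C f = b" using f by (simp_all add: Hom_iff)
  obtain i where i: "is_kernel C f i" using kernel_exists fA(1) by blast
  then have k: "i \<in> Arr C" "Tgt C i = s" "f \<bullet> i = \<zero>\<^bsub>HomSp C (Src C i) b\<^esub>"
    by (simp_all add: is_kernel_def fA)
  have o: "s \<in> Obj C" "b \<in> Obj C" "Src C i \<in> Obj C" using f k(1) by (auto dest: Hom_Obj)
  have "zero_object C (Src C i) \<or> iso_arrow C i"
    using s kernel_mono[OF i] k(2) unfolding simple_object_def by blast
  then show ?thesis
  proof
    assume iso: "iso_arrow C i"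
    have "f \<bullet> i = \<zero>\<^bsub>HomSp C s b\<^esub> \<bullet> i" using k o by simp
    then have "f = \<zero>\<^bsub>HomSp C s b\<^esub>"
      by (rule iso_cancel_right[OF iso, rotated 4]) (use fA k o in simp_all)
    then show ?thesis ..
  next
    assume z: "zero_object C (Src C i)"
    have "mono_arrow C f"
      unfolding mono_arrow_def
    proof (intro conjI allI ballI impI)
      show "f \<in> Arr C" by fact
      fix d g h assume g: "g \<in> Hom C d (Src C f)" and h: "h \<in> Hom C d (Src C f)" and eq: "f \<bullet> g = f \<bullet> h"
      have d: "d \<in> Obj C" using g by (rule Hom_Obj)
      have gh: "g \<in> Hom C d s" "h \<in> Hom C d s" using g h fA by simp_all
      interpret H: vectorspace K "HomSp C d s" using HomSp_vectorspace d o(1) .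
      interpret B: vectorspace K "HomSp C d b" using HomSp_vectorspace d o(2) .
      interpret T: linear_map K "HomSp C d s" "HomSp C d b" "\<lambda>g. f \<bullet> g"
        by (rule Cmp_linear_right[OF d f])
      have c: "g \<in> carrier (HomSp C d s)" "h \<in> carrier (HomSp C d s)"
        using gh by (simp_all add: HomSp_carrier d o)
      \<comment> \<open>f kills this difference, which hence factors through the kernel, that is,
        through a zero object.\<close>
      let ?t = "g \<ominus>\<^bsub>HomSp C d s\<^esub> h"
      have t: "?t \<in> Hom C d (Src C f)" using c H.M.minus_closed[of g h] by (simp add: HomSp_carrier d o fA)
      have "f \<bullet> ?t = \<zero>\<^bsub>HomSp C d (Tgt C f)\<^esub>"
        using T.T_minus[OF c] eq T.T_im[OF c(2)] by (simp add: fA B.M.r_neg a_minus_def)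
      then obtain u where u: "u \<in> Hom C d (Src C i)" "i \<bullet> u = ?t"
        using i t unfolding is_kernel_def by blast
      then have "?t = \<zero>\<^bsub>HomSp C d s\<^esub>"
        using Hom_to_zero[OF z u(1)] k d by auto
      then show "g = h" using c by (simp add: H.M.minus_other_side)
    qed
    then show ?thesis ..
  qed
qed

text \<open>A nonzero f is a monomorphism into the simple object t, and its source s is not
  zero.\<close>

lemma schur:
  assumes "simple_object C s" "simple_object C t" "f \<in> Hom C s t"
  shows "f = \<zero>\<^bsub>HomSp C s t\<^esub> \<or> iso_arrow C f"
  using schur_mono[OF assms(1,3)] assms unfolding simple_object_def Hom_iff by blast

text \<open>A direct sum of all members of A, built from binary sums. Applied to representatives of
  the simple objects, it bounds the space of natural transformations by a single Hom space.\<close>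

lemma common_retracts:
  assumes "finite A" "A \<subseteq> Obj C"
  shows "\<exists>a \<in> Obj C. \<forall>s \<in> A. \<exists>i \<in> Hom C s a. \<exists>p \<in> Hom C a s. p \<bullet> i = Idn C s"
  using assms
proof (induction A)
  case empty
  \<comment> \<open>With nothing to embed, any object will do.\<close>
  then show ?case using zero_object_exists by (auto simp: zero_object_def)
next
  case (insert t A)
  then obtain a where a: "a \<in> Obj C" "\<forall>s \<in> A. \<exists>i \<in> Hom C s a. \<exists>p \<in> Hom C a s. p \<bullet> i = Idn C s"
    by auto
  obtain c \<iota> \<pi> where c: "is_direct_sum C 2 (\<lambda>j. if j = 0 then a else t) c \<iota> \<pi>"
    using direct_sum_exists[of a t] a insert by auto
  then have c': "c \<in> Obj C" "\<iota> 0 \<in> Hom C a c" "\<pi> 0 \<in> Hom C c a" "\<iota> 1 \<in> Hom C t c" "\<pi> 1 \<in> Hom C c t"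
    "\<pi> 0 \<bullet> \<iota> 0 = Idn C a" "\<pi> 1 \<bullet> \<iota> 1 = Idn C t"
    by (auto simp: is_direct_sum_def split: if_splits dest: spec[of _ 0] spec[of _ 1])
  have "\<exists>i \<in> Hom C s c. \<exists>p \<in> Hom C c s. p \<bullet> i = Idn C s" if s: "s \<in> insert t A" for s
  proof (cases "s = t")
    case True
    then show ?thesis using c' by blast
  next
    case False
    then obtain i p where ip: "i \<in> Hom C s a" "p \<in> Hom C a s" "p \<bullet> i = Idn C s" using a s by blast
    have "(p \<bullet> \<pi> 0) \<bullet> (\<iota> 0 \<bullet> i) = Idn C s"
      using ip c' reduce2[OF c'(6), of i] by (auto simp: Hom_iff)
    moreover have "\<iota> 0 \<bullet> i \<in> Hom C s c" "p \<bullet> \<pi> 0 \<in> Hom C c s"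
      using ip c' by (auto simp: Hom_iff)
    ultimately show ?thesis by blast
  qed
  then show ?case using c' by blast
qed

end

section \<open>Simple objects under the action and the exchange of g with \<alpha>\<close>

context two_representation
begin

abbreviation char where "char x \<equiv> nat_trans V V id_functr (act_functr G V x)"

lemma char_iff:
  "\<alpha> \<in> char x \<longleftrightarrow> \<alpha> \<in> extensional (Obj V) \<and> (\<forall>v \<in> Obj V. \<alpha> v \<in> Hom V v (x \<odot>\<^sub>o v))
    \<and> (\<forall>f \<in> Arr V. \<alpha> (Tgt V f) \<bullet> f = (Idn G x \<odot>\<^sub>a f) \<bullet> \<alpha> (Src V f))"
  by (simp add: nat_trans_def id_functr_def act_functr_def)

lemma char_simps:
  assumes "\<alpha> \<in> char x" "v \<in> Obj V"
  shows "\<alpha> v \<in> Arr V" "Src V (\<alpha> v) = v" "Tgt V (\<alpha> v) = x \<odot>\<^sub>o v"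
  using assms by (auto simp: char_iff V.Hom_iff)

lemma char_nat:
  assumes "\<alpha> \<in> char x" "f \<in> Arr V" "Src V f = v" "Tgt V f = w"
  shows "\<alpha> w \<bullet> f = (Idn G x \<odot>\<^sub>a f) \<bullet> \<alpha> v"
  using assms by (auto simp: char_iff)

lemma char_eqI:
  assumes "\<alpha> \<in> char x" "\<beta> \<in> char y" "\<And>v. v \<in> Obj V \<Longrightarrow> \<alpha> v = \<beta> v"
  shows "\<alpha> = \<beta>"
  using assms by (auto simp: char_iff intro: extensionalityI)

lemma act_linear_comp:
  assumes "g \<in> Obj G" "f \<in> Arr V" "a \<in> Obj V" "b \<in> Obj V" "Src V f = g \<odot>\<^sub>o b"
  shows "linear_map K (HomSp V a b) (HomSp V (g \<odot>\<^sub>o a) (Tgt V f)) (\<lambda>m. f \<bullet> (Idn G g \<odot>\<^sub>a m))"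
  by (rule linear_map_comp[OF ActA_linear V.Cmp_linear_right]) (use assms in \<open>auto simp: V.Hom_iff\<close>)

lemma act_zero:
  assumes "g \<in> Obj G" "a \<in> Obj V" "b \<in> Obj V"
  shows "Idn G g \<odot>\<^sub>a \<zero>\<^bsub>HomSp V a b\<^esub> = \<zero>\<^bsub>HomSp V (g \<odot>\<^sub>o a) (g \<odot>\<^sub>o b)\<^esub>"
  using linear_map.T0_is_0[OF ActA_linear[OF assms]] .

text \<open>By linearity g \<odot> - preserves the equation 1 = 0 in an endomorphism space, and by
  faithfulness it reflects it.\<close>

lemma act_zero_object_iff:
  assumes "g \<in> Obj G" "z \<in> Obj V"
  shows "zero_object V (g \<odot>\<^sub>o z) \<longleftrightarrow> zero_object V z"
proof -
  have "Idn G g \<odot>\<^sub>a Idn V z = Idn G g \<odot>\<^sub>a \<zero>\<^bsub>HomSp V z z\<^esub> \<longleftrightarrow> Idn V z = \<zero>\<^bsub>HomSp V z z\<^esub>"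
  proof
    show "Idn V z = \<zero>\<^bsub>HomSp V z z\<^esub>" if "Idn G g \<odot>\<^sub>a Idn V z = Idn G g \<odot>\<^sub>a \<zero>\<^bsub>HomSp V z z\<^esub>"
      by (rule act_faithful[OF assms(1) _ _ _ _ _ _ that]) (use assms in simp_all)
  qed (simp only:)
  then have "Idn V (g \<odot>\<^sub>o z) = \<zero>\<^bsub>HomSp V (g \<odot>\<^sub>o z) (g \<odot>\<^sub>o z)\<^esub> \<longleftrightarrow> Idn V z = \<zero>\<^bsub>HomSp V z z\<^esub>"
    by (simp only: TA_Idn[OF assms] act_zero[OF assms(1,2,2)])
  then show ?thesis using assms by (simp add: V.zero_object_iff)
qed

lemma ev_nat:
  assumes "g \<in> Obj G" "f \<in> Arr V" "Src V f = v" "Tgt V f = w"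
  shows "ev g w \<bullet> (Idn G (dual g) \<odot>\<^sub>a (Idn G g \<odot>\<^sub>a f)) = f \<bullet> ev g v"
  using assms by (simp add: act_counit_nat)

text \<open>By naturality of the evaluation, m is conjugate to g^* \<odot> (g \<odot> m).\<close>

lemma act_iso_reflect:
  assumes "g \<in> Obj G" "m \<in> Arr V" "iso_arrow V (Idn G g \<odot>\<^sub>a m)"
  shows "iso_arrow V m"
proof -
  let ?n = "ev g (Tgt V m) \<bullet> (Idn G (dual g) \<odot>\<^sub>a (Idn G g \<odot>\<^sub>a m)) \<bullet> inv_arrow V (ev g (Src V m))"
  have "?n = (m \<bullet> ev g (Src V m)) \<bullet> inv_arrow V (ev g (Src V m))"
    using assms(1,2) by (simp add: ev_nat[THEN V.reduce2])
  also have "\<dots> = m" using assms(1,2) by simp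
  finally have "?n = m" .
  moreover have "iso_arrow V ?n" using assms by (simp add: V.iso_Cmp(1))
  ultimately show ?thesis by simp
qed

text \<open>Arrows into g \<odot> a are transposed to arrows from g^* \<odot> d into a, where m
  itself can be cancelled. Transposition is injective because the evaluation is invertible and g^*
  \<odot> - is faithful.\<close>

lemma act_mono:
  assumes g: "g \<in> Obj G" and m: "mono_arrow V m"
  shows "mono_arrow V (Idn G g \<odot>\<^sub>a m)"
  unfolding mono_arrow_def
proof (intro conjI allI ballI impI)
  have mA: "m \<in> Arr V" using m by (simp add: mono_arrow_def)
  then show "Idn G g \<odot>\<^sub>a m \<in> Arr V" using g by simp
  let ?a = "Src V m" and ?b = "Tgt V m" and ?L = "\<lambda>f. Idn G (dual g) \<odot>\<^sub>a f"
  fix d f f' assume f: "f \<in> Hom V d (Src V (Idn G g \<odot>\<^sub>a m))" and f': "f' \<in> Hom V d (Src V (Idn G g \<odot>\<^sub>a m))"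
    and eq: "(Idn G g \<odot>\<^sub>a m) \<bullet> f = (Idn G g \<odot>\<^sub>a m) \<bullet> f'"
  have ff [simp]: "f \<in> Arr V" "Src V f = d" "Tgt V f = g \<odot>\<^sub>o ?a" "f' \<in> Arr V" "Src V f' = d" "Tgt V f' = g \<odot>\<^sub>o ?a"
    using f f' mA g by (auto simp: V.Hom_iff)
  have d: "d \<in> Obj V" using f by (rule V.Hom_Obj)
  have n: "m \<bullet> ev g ?a \<bullet> ?L h = ev g ?b \<bullet> ?L ((Idn G g \<odot>\<^sub>a m) \<bullet> h)"
    if "h \<in> Arr V" "Tgt V h = g \<odot>\<^sub>o ?a" for h
    using that g mA by (simp add: ev_nat[of g m ?a ?b, THEN V.reduce2])
  have "m \<bullet> (ev g ?a \<bullet> ?L f) = m \<bullet> (ev g ?a \<bullet> ?L f')"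
    by (simp add: n eq)
  moreover have "ev g ?a \<bullet> ?L f \<in> Hom V (dual g \<odot>\<^sub>o d) ?a" "ev g ?a \<bullet> ?L f' \<in> Hom V (dual g \<odot>\<^sub>o d) ?a"
    using g mA by (auto simp: V.Hom_iff)
  ultimately have "ev g ?a \<bullet> ?L f = ev g ?a \<bullet> ?L f'" using m unfolding mono_arrow_def by blast
  then have "?L f = ?L f'"
    by (rule V.iso_cancel_left[rotated 5]) (use g mA in simp_all)
  then show "f = f'"
    by (rule act_faithful[of "dual g" f f' d "g \<odot>\<^sub>o ?a", rotated 7]) (use g in simp_all)
qed

text \<open>A subobject m of g \<odot> s transposes to a subobject of s with source g^* \<odot> Src
  m. Whichever alternative simplicity of s gives there, g^* \<odot> - reflects it back to m.\<close>

lemma act_simple: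
  assumes g: "g \<in> Obj G" and s: "simple_object V s"
  shows "simple_object V (g \<odot>\<^sub>o s)"
  unfolding simple_object_def
proof (intro conjI allI impI)
  have sO: "s \<in> Obj V" using s by (simp add: simple_object_def)
  show "g \<odot>\<^sub>o s \<in> Obj V" using g sO by simp
  show "\<not> zero_object V (g \<odot>\<^sub>o s)" using s g sO by (simp add: act_zero_object_iff simple_object_def)
  fix m assume m: "mono_arrow V m \<and> Tgt V m = g \<odot>\<^sub>o s"
  then have mA: "m \<in> Arr V" by (simp add: mono_arrow_def)
  let ?n = "ev g s \<bullet> (Idn G (dual g) \<odot>\<^sub>a m)"
  have "mono_arrow V ?n"
    by (rule V.mono_Cmp[OF act_mono V.iso_mono]) (use m mA g sO in auto)
  moreover have "Tgt V ?n = s" "Src V ?n = dual g \<odot>\<^sub>o Src V m" using m mA g sO by simp_all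
  ultimately have "zero_object V (dual g \<odot>\<^sub>o Src V m) \<or> iso_arrow V ?n"
    using s unfolding simple_object_def by metis
  then show "zero_object V (Src V m) \<or> iso_arrow V m"
  proof
    assume "zero_object V (dual g \<odot>\<^sub>o Src V m)"
    then show ?thesis using g mA by (simp add: act_zero_object_iff)
  next
    assume n: "iso_arrow V ?n"
    have "Idn G (dual g) \<odot>\<^sub>a m = inv_arrow V (ev g s) \<bullet> ?n" using m mA g sO by simp
    also have "iso_arrow V \<dots>" by (rule V.iso_Cmp) (use n m mA g sO in simp_all)
    finally show ?thesis using act_iso_reflect[of "dual g" m] g mA by simp
  qed
qed

lemma char_self_simple:
  assumes g: "g \<in> Obj G" and \<alpha>: "\<alpha> \<in> char g" and s: "simple_object V s"
  shows "Idn G g \<odot>\<^sub>a \<alpha> s = \<alpha> (g \<odot>\<^sub>o s)"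
proof -
  have [simp]: "s \<in> Obj V" "g \<in> Obj G" using s g by (simp_all add: simple_object_def)
  note [simp] = \<alpha> char_simps[OF \<alpha>]
  let ?gs = "g \<odot>\<^sub>o s"
  have "\<alpha> s = \<zero>\<^bsub>HomSp V s ?gs\<^esub> \<or> iso_arrow V (\<alpha> s)"
    by (rule V.schur[OF s act_simple[OF g s]]) (simp add: V.Hom_iff)
  then show ?thesis
  proof
    assume iso: "iso_arrow V (\<alpha> s)"
    have "\<alpha> ?gs \<bullet> \<alpha> s = (Idn G g \<odot>\<^sub>a \<alpha> s) \<bullet> \<alpha> s"
      by (rule char_nat) simp_all
    then have "\<alpha> ?gs = Idn G g \<odot>\<^sub>a \<alpha> s"
      by (rule V.iso_cancel_right[OF iso, rotated 4]) simp_all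
    then show ?thesis ..
  next
    assume z: "\<alpha> s = \<zero>\<^bsub>HomSp V s ?gs\<^esub>"
    have "\<alpha> ?gs = \<zero>\<^bsub>HomSp V ?gs (g \<odot>\<^sub>o ?gs)\<^esub>"
    proof (rule ccontr)
      assume nz: "\<alpha> ?gs \<noteq> \<zero>\<^bsub>HomSp V ?gs (g \<odot>\<^sub>o ?gs)\<^esub>"
      have "\<alpha> ?gs = \<zero>\<^bsub>HomSp V ?gs (g \<odot>\<^sub>o ?gs)\<^esub> \<or> iso_arrow V (\<alpha> ?gs)"
        by (rule V.schur[OF act_simple[OF g s] act_simple[OF g act_simple[OF g s]]]) (simp add: V.Hom_iff)
      with nz have iso: "iso_arrow V (\<alpha> ?gs)" by blast
      \<comment> \<open>An isomorphism from s to g \<odot> s: apply g^* to \<alpha> at g \<odot> s,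
        and remove g^* and g at both ends by evaluations.\<close>
      let ?q = "ev g ?gs \<bullet> (Idn G (dual g) \<odot>\<^sub>a \<alpha> ?gs) \<bullet> inv_arrow V (ev g s)"
      have q: "iso_arrow V ?q" using iso by (simp add: V.iso_Cmp(1))
      have "\<alpha> ?gs \<bullet> ?q = (Idn G g \<odot>\<^sub>a ?q) \<bullet> \<alpha> s"
        by (rule char_nat) simp_all
      also have "\<dots> = \<zero>\<^bsub>HomSp V ?gs (g \<odot>\<^sub>o ?gs)\<^esub> \<bullet> ?q"
        by (simp add: z)
      finally have "\<alpha> ?gs = \<zero>\<^bsub>HomSp V ?gs (g \<odot>\<^sub>o ?gs)\<^esub>"
        by (rule V.iso_cancel_right[OF q, rotated 4]) simp_all
      with nz show False by contradiction
    qed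
    then show ?thesis using z by (simp add: act_zero)
  qed
qed

text \<open>Naturality gives this only after precomposition with \<open>\<alpha> w\<close>, so it cannot replace Schur's
  lemma here.\<close>

lemma char_self:
  assumes g: "g \<in> Obj G" and \<alpha>: "\<alpha> \<in> char g" and w: "w \<in> Obj V"
  shows "Idn G g \<odot>\<^sub>a \<alpha> w = \<alpha> (g \<odot>\<^sub>o w)"
proof -
  note [simp] = assms char_simps[OF \<alpha>]
  obtain n s \<iota> \<pi> where s: "\<And>j. j < n \<Longrightarrow> simple_object V (s j)" and ds: "is_direct_sum V n s w \<iota> \<pi>"
    using V.semisimple[OF w] by blast
  let ?L = "\<lambda>f. Idn G g \<odot>\<^sub>a f" and ?gw = "g \<odot>\<^sub>o w"
  have "(?L (\<alpha> w)) \<bullet> ?L (Idn V w) = \<alpha> ?gw \<bullet> ?L (Idn V w)"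
  proof (rule V.direct_sum_ext[OF ds, where S = "\<lambda>m. (?L (\<alpha> w)) \<bullet> ?L m" and T = "\<lambda>m. \<alpha> ?gw \<bullet> ?L m"])
    show "linear_map K (HomSp V w w) (HomSp V ?gw (g \<odot>\<^sub>o ?gw)) (\<lambda>m. ?L (\<alpha> w) \<bullet> ?L m)"
      using act_linear_comp[of g "?L (\<alpha> w)" w w] by simp
    show "linear_map K (HomSp V w w) (HomSp V ?gw (g \<odot>\<^sub>o ?gw)) (\<lambda>m. \<alpha> ?gw \<bullet> ?L m)"
      using act_linear_comp[of g "\<alpha> ?gw" w w] by simp
  next
    fix j assume j: "j < n"
    have [simp]: "\<iota> j \<in> Arr V" "Src V (\<iota> j) = s j" "Tgt V (\<iota> j) = w"
      "\<pi> j \<in> Arr V" "Src V (\<pi> j) = w" "Tgt V (\<pi> j) = s j" "s j \<in> Obj V"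
      using ds s[OF j] j by (auto simp: is_direct_sum_def simple_object_def V.Hom_iff)
    have "?L (\<alpha> w) \<bullet> ?L (\<iota> j) = ?L (?L (\<iota> j)) \<bullet> ?L (\<alpha> (s j))"
      using whisker_right_eq[OF char_nat[of \<alpha> g "\<iota> j" "s j" w], of g] by simp
    moreover have "\<alpha> ?gw \<bullet> ?L (\<iota> j) = ?L (?L (\<iota> j)) \<bullet> \<alpha> (g \<odot>\<^sub>o s j)"
      by (rule char_nat) simp_all
    ultimately have "?L (\<alpha> w) \<bullet> ?L (\<iota> j) = \<alpha> ?gw \<bullet> ?L (\<iota> j)"
      using char_self_simple[OF g \<alpha> s[OF j]] by simp
    from this[THEN V.reduce2, of "?L (\<pi> j)"]
    show "?L (\<alpha> w) \<bullet> ?L (\<iota> j \<bullet> \<pi> j) = \<alpha> ?gw \<bullet> ?L (\<iota> j \<bullet> \<pi> j)"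
      by simp
  qed
  then show ?thesis by simp
qed

text \<open>Naturality along the inclusions of simple summands fixes every component. This makes
  evaluation at one sufficiently large object injective.\<close>

lemma char_determined:
  assumes x: "x \<in> Obj G" and \<alpha>: "\<alpha> \<in> char x" and \<beta>: "\<beta> \<in> char x"
    and eq: "\<And>s. simple_object V s \<Longrightarrow> \<alpha> s = \<beta> s"
  shows "\<alpha> = \<beta>"
proof (rule char_eqI[OF \<alpha> \<beta>])
  note [simp] = x \<alpha> \<beta> char_simps[OF \<alpha>] char_simps[OF \<beta>]
  fix w assume w [simp]: "w \<in> Obj V"
  obtain n s \<iota> \<pi> where s: "\<And>j. j < n \<Longrightarrow> simple_object V (s j)" and ds: "is_direct_sum V n s w \<iota> \<pi>"
    using V.semisimple[OF w] by blast
  have "\<alpha> w \<bullet> Idn V w = \<beta> w \<bullet> Idn V w"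
  proof (rule V.direct_sum_ext[OF ds, where S = "\<lambda>m. \<alpha> w \<bullet> m" and T = "\<lambda>m. \<beta> w \<bullet> m"])
    show "linear_map K (HomSp V w w) (HomSp V w (x \<odot>\<^sub>o w)) (\<lambda>m. \<alpha> w \<bullet> m)"
      "linear_map K (HomSp V w w) (HomSp V w (x \<odot>\<^sub>o w)) (\<lambda>m. \<beta> w \<bullet> m)"
      by (auto intro!: V.Cmp_linear_right simp: V.Hom_iff)
  next
    fix j assume j: "j < n"
    have [simp]: "\<iota> j \<in> Arr V" "Src V (\<iota> j) = s j" "Tgt V (\<iota> j) = w"
      "\<pi> j \<in> Arr V" "Src V (\<pi> j) = w" "Tgt V (\<pi> j) = s j" "s j \<in> Obj V"
      using ds s[OF j] j by (auto simp: is_direct_sum_def simple_object_def V.Hom_iff)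
    have "\<alpha> w \<bullet> \<iota> j = \<beta> w \<bullet> \<iota> j"
      using char_nat[OF \<alpha>, of "\<iota> j"] char_nat[OF \<beta>, of "\<iota> j"] eq[OF s[OF j]] by simp
    from this[THEN V.reduce2, of "\<pi> j"] show "\<alpha> w \<bullet> (\<iota> j \<bullet> \<pi> j) = \<beta> w \<bullet> (\<iota> j \<bullet> \<pi> j)" by simp
  qed
  then show "\<alpha> w = \<beta> w" by simp
qed

end

section \<open>The 2-character as a class functor\<close>

lemma Vec_Cmp: "(U', g, W) \<bullet>\<^bsub>Vec K\<^esub> (U, f, W') = (U, compose (carrier U) g f, W)"
  by (simp add: Vec_def)

section \<open>The spaces of the 2-character\<close>

context two_representation
begin

lemma functor_id: "functor_between V V id_functr"
  by unfold_locales (simp_all add: id_functr_def)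

lemma functor_act: "x \<in> Obj G \<Longrightarrow> functor_between V V (act_functr G V x)"
  by unfold_locales (auto simp: act_functr_def V.Hom_iff)

lemma char_space_simps:
  "carrier (char_space G V x) = char x"
  "\<alpha> \<oplus>\<^bsub>char_space G V x\<^esub> \<beta> = (\<lambda>v\<in>Obj V. \<alpha> v \<oplus>\<^bsub>HomSp V v (x \<odot>\<^sub>o v)\<^esub> \<beta> v)"
  "r \<odot>\<^bsub>char_space G V x\<^esub> \<alpha> = (\<lambda>v\<in>Obj V. r \<odot>\<^bsub>HomSp V v (x \<odot>\<^sub>o v)\<^esub> \<alpha> v)"
  by (simp_all add: char_space_def nat_space_def) (simp_all add: id_functr_def act_functr_def)

lemma char_space_vectorspace:
  assumes "x \<in> Obj G"
  shows "vectorspace K (char_space G V x)"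
proof -
  \<comment> \<open>An object is needed here because \<open>field K\<close> is read off from one of
    the Hom spaces.\<close>
  obtain z where "z \<in> Obj V" using V.zero_object_exists by (auto simp: zero_object_def)
  then have "field K" using V.HomSp_vectorspace[of z z] by (simp add: vectorspace_def)
  then show ?thesis
    unfolding char_space_def using assms by (intro V.vectorspace_nat_space functor_id functor_act)
qed

lemma char_eval_linear:
  assumes "x \<in> Obj G" "a \<in> Obj V"
  shows "linear_map K (char_space G V x) (HomSp V a (x \<odot>\<^sub>o a)) (\<lambda>\<alpha>. \<alpha> a)"
proof (rule linear_mapI)
  show "(\<lambda>\<alpha>. \<alpha> a) \<in> LinearCombinations.module_hom K (char_space G V x) (HomSp V a (x \<odot>\<^sub>o a))"
    using assms by (auto simp: LinearCombinations.module_hom_def char_space_simps V.HomSp_carrier char_iff)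
qed (use assms char_space_vectorspace V.HomSp_vectorspace in auto)

text \<open>A natural transformation out of the identity is determined by its component at any object
  of which all simple objects are retracts.\<close>

lemma char_space_fd:
  assumes x: "x \<in> Obj G"
  shows "fd_vectorspace K (char_space G V x)"
proof -
  obtain S where S: "finite S" "S \<subseteq> Obj V" "\<And>s. simple_object V s \<Longrightarrow> \<exists>t \<in> S. isomorphic V s t"
    using V.finitely_many_simples by blast
  obtain a where a: "a \<in> Obj V" "\<And>s. s \<in> S \<Longrightarrow> \<exists>i \<in> Hom V s a. \<exists>p \<in> Hom V a s. p \<bullet> i = Idn V s"
    using V.common_retracts[OF S(1,2)] by blast
  interpret T: linear_map K "char_space G V x" "HomSp V a (x \<odot>\<^sub>o a)" "\<lambda>\<alpha>. \<alpha> a"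
    by (rule char_eval_linear[OF x a(1)])
  have "inj_on (\<lambda>\<alpha>. \<alpha> a) (carrier (char_space G V x))"
  proof (rule inj_onI, unfold char_space_simps)
    fix \<alpha> \<beta> assume \<alpha>: "\<alpha> \<in> char x" and \<beta>: "\<beta> \<in> char x" and eq: "\<alpha> a = \<beta> a"
    note [simp] = x \<alpha> \<beta> char_simps[OF \<alpha>] char_simps[OF \<beta>] a(1)
    show "\<alpha> = \<beta>"
    proof (rule char_determined[OF x \<alpha> \<beta>])
      fix s assume "simple_object V s"
      then obtain t f where t: "t \<in> S" and f: "f \<in> Hom V s t" "iso_arrow V f"
        using S(3) unfolding isomorphic_def by blast
      obtain i p where ip: "i \<in> Hom V t a" "p \<in> Hom V a t" "p \<bullet> i = Idn V t" using a(2)[OF t] by blast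
      let ?j = "i \<bullet> f" and ?q = "inv_arrow V f \<bullet> p"
      have [simp]: "f \<in> Arr V" "Src V f = s" "Tgt V f = t" "i \<in> Arr V" "Src V i = t" "Tgt V i = a"
        "p \<in> Arr V" "Src V p = a" "Tgt V p = t" "iso_arrow V f" "s \<in> Obj V"
        using f ip by (auto simp: V.Hom_iff)
      have qj: "?q \<bullet> ?j = Idn V s" using ip(3)[THEN V.reduce2, of f] by simp
      have *: "\<gamma> s = (Idn G x \<odot>\<^sub>a ?q) \<bullet> \<gamma> a \<bullet> ?j" if \<gamma>: "\<gamma> \<in> char x" for \<gamma>
      proof -
        note [simp] = \<gamma> char_simps[OF \<gamma>]
        have "\<gamma> s = (\<gamma> s \<bullet> ?q) \<bullet> ?j" using qj by simp
        also have "\<gamma> s \<bullet> ?q = (Idn G x \<odot>\<^sub>a ?q) \<bullet> \<gamma> a" by (rule char_nat) simp_all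
        finally show ?thesis by simp
      qed
      show "\<alpha> s = \<beta> s" using *[OF \<alpha>] *[OF \<beta>] eq by simp
    qed
  qed
  then have "vectorspace.fin_dim K (char_space G V x)"
    using T.inj_fin_dim V.HomSp_fin_dim[OF a(1), of "x \<odot>\<^sub>o a"] x a(1) by simp
  then show ?thesis using char_space_vectorspace[OF x] by (simp add: fd_vectorspace_def)
qed

text \<open>Both kinds of structure map send \<alpha> to a family of linear functions of its
  components: at v itself for arrows of the 2-group, at g^* \<odot> v for conjugation. The
  reindexing \<open>p\<close> covers the two at once.\<close>

lemma char_hom:
  assumes x: "x \<in> Obj G" and y: "y \<in> Obj G" and p: "\<And>v. v \<in> Obj V \<Longrightarrow> p v \<in> Obj V"
    and T: "\<And>v. v \<in> Obj V \<Longrightarrow> linear_map K (HomSp V (p v) (x \<odot>\<^sub>o p v)) (HomSp V v (y \<odot>\<^sub>o v)) (T v)"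
    and closed: "\<And>\<alpha>. \<alpha> \<in> char x \<Longrightarrow> (\<lambda>v\<in>Obj V. T v (\<alpha> (p v))) \<in> char y"
  shows "(char_space G V x, \<lambda>\<alpha>\<in>char x. \<lambda>v\<in>Obj V. T v (\<alpha> (p v)), char_space G V y)
    \<in> Hom (Vec K) (char_space G V x) (char_space G V y)"
proof -
  interpret X: vectorspace K "char_space G V x" using char_space_vectorspace[OF x] .
  have ca: "\<alpha> (p v) \<in> carrier (HomSp V (p v) (x \<odot>\<^sub>o p v))" if "\<alpha> \<in> char x" "v \<in> Obj V" for \<alpha> v
    using that p[OF that(2)] x by (auto simp: V.HomSp_carrier V.Hom_iff char_simps)
  have add: "(\<lambda>v\<in>Obj V. \<alpha> v \<oplus>\<^bsub>HomSp V v (x \<odot>\<^sub>o v)\<^esub> \<beta> v) \<in> char x" if "\<alpha> \<in> char x" "\<beta> \<in> char x" for \<alpha> \<beta>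
    using X.M.add.m_closed[of \<alpha> \<beta>] that by (simp add: char_space_simps)
  have smult: "(\<lambda>v\<in>Obj V. r \<odot>\<^bsub>HomSp V v (x \<odot>\<^sub>o v)\<^esub> \<alpha> v) \<in> char x" if "r \<in> carrier K" "\<alpha> \<in> char x" for r \<alpha>
    using X.smult_closed[of r \<alpha>] that by (simp add: char_space_simps)
  have "(\<lambda>\<alpha>\<in>char x. \<lambda>v\<in>Obj V. T v (\<alpha> (p v)))
      \<in> LinearCombinations.module_hom K (char_space G V x) (char_space G V y)"
    unfolding LinearCombinations.module_hom_def
    using p ca closed add smult
    by (auto simp: char_space_simps module_hom_add[OF linear_map_hom[OF T]]
        module_hom_smult[OF linear_map_hom[OF T]] intro!: restrict_ext)
  then show ?thesis
    using char_space_fd[OF x] char_space_fd[OF y] by (simp add: Vec_arr_iff char_space_simps)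
qed

text \<open>\<open>push\<close> and \<open>conj_map\<close> are the maps underlying the arrows of
  \<open>Vec\<close> in \<open>char_functr\<close> and \<open>char_conj\<close>. With them the
  axioms of a class functor become equations between natural transformations.\<close>

definition push where "push f \<alpha> = (\<lambda>v\<in>Obj V. (f \<odot>\<^sub>a Idn V v) \<bullet> \<alpha> v)"

definition conj_map where
  "conj_map g x \<alpha> = (\<lambda>v\<in>Obj V. inv_arrow V (unconj g x v) \<bullet> (Idn G g \<odot>\<^sub>a \<alpha> (dual g \<odot>\<^sub>o v)) \<bullet> coev g v)"

lemma push_closed:
  assumes f: "f \<in> Arr G" and \<alpha>: "\<alpha> \<in> char (Src G f)"
  shows "push f \<alpha> \<in> char (Tgt G f)"
proof -
  note [simp] = f char_simps[OF \<alpha>]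
  have "((f \<odot>\<^sub>a Idn V (Tgt V m)) \<bullet> \<alpha> (Tgt V m)) \<bullet> m
      = (Idn G (Tgt G f) \<odot>\<^sub>a m) \<bullet> (f \<odot>\<^sub>a Idn V (Src V m)) \<bullet> \<alpha> (Src V m)" if [simp]: "m \<in> Arr V" for m
    using char_nat[OF \<alpha>, of m "Src V m" "Tgt V m"]
      TA_interchange[of f m "Src G f" "Tgt G f" "Src V m" "Tgt V m", THEN V.reduce2, of "\<alpha> (Src V m)"]
    by simp
  then show ?thesis by (auto simp: char_iff push_def V.Hom_iff)
qed

lemma push_linear:
  assumes f: "f \<in> Arr G"
  shows "(char_space G V (Src G f), \<lambda>\<alpha>\<in>char (Src G f). push f \<alpha>, char_space G V (Tgt G f))
    \<in> Hom (Vec K) (char_space G V (Src G f)) (char_space G V (Tgt G f))"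
  unfolding push_def
proof (rule char_hom[where p = "\<lambda>v. v" and T = "\<lambda>v m. (f \<odot>\<^sub>a Idn V v) \<bullet> m"])
  show "linear_map K (HomSp V v (Src G f \<odot>\<^sub>o v)) (HomSp V v (Tgt G f \<odot>\<^sub>o v)) (\<lambda>m. (f \<odot>\<^sub>a Idn V v) \<bullet> m)"
    if "v \<in> Obj V" for v
    using that f by (intro V.Cmp_linear_right) (auto simp: V.Hom_iff)
  show "(\<lambda>v\<in>Obj V. (f \<odot>\<^sub>a Idn V v) \<bullet> \<alpha> v) \<in> char (Tgt G f)" if "\<alpha> \<in> char (Src G f)" for \<alpha>
    using push_closed[OF f that] by (simp add: push_def)
qed (use f in simp_all)

lemma unconj_conj_map:
  assumes [simp]: "g \<in> Obj G" "x \<in> Obj G" "v \<in> Obj V" and \<alpha>: "\<alpha> \<in> char x"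
  shows "unconj g x v \<bullet> conj_map g x \<alpha> v = (Idn G g \<odot>\<^sub>a \<alpha> (dual g \<odot>\<^sub>o v)) \<bullet> coev g v"
  using char_simps[OF \<alpha>] by (simp add: conj_map_def)

lemma unconj_nat_right:
  assumes "g \<in> Obj G" "x \<in> Obj G" "f \<in> Arr V" "Src V f = v" "Tgt V f = w"
  shows "unconj g x w \<bullet> (Idn G (conj_obj G g x) \<odot>\<^sub>a f)
    = (Idn G g \<odot>\<^sub>a (Idn G x \<odot>\<^sub>a (Idn G (dual g) \<odot>\<^sub>a f))) \<bullet> unconj g x v"
  using unconj_nat[of "Idn G g" "Idn G x" "Idn G (dual g)" f] assms by (simp add: conj_obj_def)

lemma conj_map_simps:
  assumes "g \<in> Obj G" "x \<in> Obj G" "v \<in> Obj V" and \<alpha>: "\<alpha> \<in> char x"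
  shows "conj_map g x \<alpha> v \<in> Arr V" "Src V (conj_map g x \<alpha> v) = v"
    "Tgt V (conj_map g x \<alpha> v) = conj_obj G g x \<odot>\<^sub>o v"
  using assms char_simps[OF \<alpha>] by (simp_all add: conj_map_def)

text \<open>An arrow m passes the coevaluation, then \<alpha> in the form g^* \<odot> m, then
  \<open>unconj\<close>; each passage is a naturality square.\<close>

lemma conj_map_closed:
  assumes g [simp]: "g \<in> Obj G" "x \<in> Obj G" and \<alpha>: "\<alpha> \<in> char x"
  shows "conj_map g x \<alpha> \<in> char (conj_obj G g x)"
proof -
  note [simp] = char_simps[OF \<alpha>] conj_map_simps[OF g _ \<alpha>]
  have "conj_map g x \<alpha> w \<bullet> m = (Idn G (conj_obj G g x) \<odot>\<^sub>a m) \<bullet> conj_map g x \<alpha> v"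
    if [simp]: "m \<in> Arr V" "Src V m = v" "Tgt V m = w" "v \<in> Obj V" "w \<in> Obj V" for m v w
  proof (rule V.iso_cancel_left[of "unconj g x w"])
    let ?L = "\<lambda>f. Idn G g \<odot>\<^sub>a f" and ?D = "\<lambda>f. Idn G (dual g) \<odot>\<^sub>a f"
    have "unconj g x w \<bullet> conj_map g x \<alpha> w \<bullet> m = ?L (\<alpha> (dual g \<odot>\<^sub>o w)) \<bullet> coev g w \<bullet> m"
      by (simp add: unconj_conj_map[OF g _ \<alpha>, THEN V.reduce2])
    also have "\<dots> = ?L (\<alpha> (dual g \<odot>\<^sub>o w)) \<bullet> ?L (?D m) \<bullet> coev g v"
      by (simp add: act_unit_nat[of g "dual g" "Coev G g" m v w])
    also have "\<dots> = ?L ((Idn G x \<odot>\<^sub>a ?D m) \<bullet> \<alpha> (dual g \<odot>\<^sub>o v)) \<bullet> coev g v"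
      by (simp add: whisker_right_eq[OF char_nat[OF \<alpha>, of "?D m" "dual g \<odot>\<^sub>o v" "dual g \<odot>\<^sub>o w"], of g, THEN V.reduce2])
    also have "\<dots> = unconj g x w \<bullet> (Idn G (conj_obj G g x) \<odot>\<^sub>a m) \<bullet> conj_map g x \<alpha> v"
      by (simp add: unconj_nat_right[of g x m v w, THEN V.reduce2] unconj_conj_map[OF g _ \<alpha>])
    finally show "unconj g x w \<bullet> conj_map g x \<alpha> w \<bullet> m
        = unconj g x w \<bullet> (Idn G (conj_obj G g x) \<odot>\<^sub>a m) \<bullet> conj_map g x \<alpha> v" .
  qed simp_all
  then show ?thesis
    using conj_map_simps[OF g _ \<alpha>] by (auto simp: char_iff V.Hom_iff) (simp add: conj_map_def)
qed

lemma conj_map_linear: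
  assumes g [simp]: "g \<in> Obj G" "x \<in> Obj G"
  shows "(char_space G V x, \<lambda>\<alpha>\<in>char x. conj_map g x \<alpha>, char_space G V (conj_obj G g x))
    \<in> Hom (Vec K) (char_space G V x) (char_space G V (conj_obj G g x))"
  unfolding conj_map_def
proof (rule char_hom[where p = "\<lambda>v. dual g \<odot>\<^sub>o v" and T = "\<lambda>v m. inv_arrow V (unconj g x v) \<bullet> (Idn G g \<odot>\<^sub>a m) \<bullet> coev g v"])
  show "linear_map K (HomSp V (dual g \<odot>\<^sub>o v) (x \<odot>\<^sub>o (dual g \<odot>\<^sub>o v))) (HomSp V v (conj_obj G g x \<odot>\<^sub>o v))
      (\<lambda>m. inv_arrow V (unconj g x v) \<bullet> (Idn G g \<odot>\<^sub>a m) \<bullet> coev g v)"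
    if [simp]: "v \<in> Obj V" for v
    by (rule linear_map_comp[OF linear_map_comp[OF ActA_linear V.Cmp_linear_left] V.Cmp_linear_right])
      (auto simp: V.Hom_iff)
  show "(\<lambda>v\<in>Obj V. inv_arrow V (unconj g x v) \<bullet> (Idn G g \<odot>\<^sub>a \<alpha> (dual g \<odot>\<^sub>o v)) \<bullet> coev g v)
      \<in> char (conj_obj G g x)" if "\<alpha> \<in> char x" for \<alpha>
    using conj_map_closed[OF g that] by (simp add: conj_map_def)
qed simp_all

text \<open>Cancelling the coevaluation and then g recovers \<alpha> at all objects g^* \<odot> v.
  Every w is isomorphic to such an object by its evaluation, with v = g \<odot> w.\<close>

lemma conj_map_inj:
  assumes g [simp]: "g \<in> Obj G" "x \<in> Obj G"
  shows "inj_on (conj_map g x) (char x)"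
proof (rule inj_onI)
  fix \<alpha> \<beta> assume \<alpha>: "\<alpha> \<in> char x" and \<beta>: "\<beta> \<in> char x" and eq: "conj_map g x \<alpha> = conj_map g x \<beta>"
  note [simp] = \<alpha> \<beta> char_simps[OF \<alpha>] char_simps[OF \<beta>]
  have *: "\<alpha> (dual g \<odot>\<^sub>o v) = \<beta> (dual g \<odot>\<^sub>o v)" if [simp]: "v \<in> Obj V" for v
  proof (rule act_faithful[of g])
    have "(Idn G g \<odot>\<^sub>a \<alpha> (dual g \<odot>\<^sub>o v)) \<bullet> coev g v = (Idn G g \<odot>\<^sub>a \<beta> (dual g \<odot>\<^sub>o v)) \<bullet> coev g v"
      using unconj_conj_map[OF g _ \<alpha>, of v] unconj_conj_map[OF g _ \<beta>, of v] eq by simp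
    then show "Idn G g \<odot>\<^sub>a \<alpha> (dual g \<odot>\<^sub>o v) = Idn G g \<odot>\<^sub>a \<beta> (dual g \<odot>\<^sub>o v)"
      by (rule V.iso_cancel_right[rotated 5]) simp_all
  qed (simp_all; rule char_simps)+
  show "\<alpha> = \<beta>"
  proof (rule char_eqI[OF \<alpha> \<beta>])
    fix w assume [simp]: "w \<in> Obj V"
    have "\<alpha> w \<bullet> ev g w = \<beta> w \<bullet> ev g w"
      using char_nat[OF \<alpha>, of "ev g w"] char_nat[OF \<beta>, of "ev g w"] *[of "g \<odot>\<^sub>o w"] by simp
    then show "\<alpha> w = \<beta> w"
      by (rule V.iso_cancel_right[rotated 5]) simp_all
  qed
qed

text \<open>An explicit preimage is used. Inverting \<psi> through conjugation by g^* would require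
  comparing a double conjugation with the identity, hence further coherence isomorphisms.\<close>

lemma conj_map_surj:
  assumes g [simp]: "g \<in> Obj G" "x \<in> Obj G" and \<beta>: "\<beta> \<in> char (conj_obj G g x)"
  shows "\<exists>\<alpha> \<in> char x. conj_map g x \<alpha> = \<beta>"
proof -
  note [simp] = char_simps[OF \<beta>]
  let ?L = "\<lambda>f. Idn G g \<odot>\<^sub>a f" and ?D = "\<lambda>f. Idn G (dual g) \<odot>\<^sub>a f" and ?X = "\<lambda>f. Idn G x \<odot>\<^sub>a f"
  let ?g = "\<lambda>v. g \<odot>\<^sub>o v" and ?d = "\<lambda>v. dual g \<odot>\<^sub>o v" and ?x = "\<lambda>v. x \<odot>\<^sub>o v"
  define b where "b v = unconj g x v \<bullet> \<beta> v" for v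
  have [simp]: "b v \<in> Arr V" "Src V (b v) = v" "Tgt V (b v) = ?g (?x (?d v))" if "v \<in> Obj V" for v
    using that by (simp_all add: b_def)
  have b_nat: "b w \<bullet> m = ?L (?X (?D m)) \<bullet> b v"
    if m [simp]: "m \<in> Arr V" "Src V m = v" "Tgt V m = w" "v \<in> Obj V" "w \<in> Obj V" for m v w
    using char_nat[OF \<beta> m(1-3)] unconj_nat_right[OF g m(1-3), THEN V.reduce2, of "\<beta> v"]
    by (simp add: b_def)
  \<comment> \<open>Conjugation is undone by transposing: w is replaced by g^* \<odot> (g \<odot>
    w), g^* is applied to \<open>b\<close> at g \<odot> w, and two evaluations remove the outer pair
    g^*, g and the pair inside x.\<close>
  define \<alpha> where "\<alpha> = (\<lambda>w\<in>Obj V. ?X (ev g w) \<bullet> ev g (?x (?d (?g w))) \<bullet> ?D (b (?g w)) \<bullet> inv_arrow V (ev g w))"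
  have \<alpha>_eq: "\<alpha> w = ?X (ev g w) \<bullet> ev g (?x (?d (?g w))) \<bullet> ?D (b (?g w)) \<bullet> inv_arrow V (ev g w)"
    if "w \<in> Obj V" for w
    using that by (simp add: \<alpha>_def)
  have [simp]: "\<alpha> v \<in> Arr V" "Src V (\<alpha> v) = v" "Tgt V (\<alpha> v) = ?x v" if "v \<in> Obj V" for v
    using that by (simp_all add: \<alpha>_eq)
  have "\<alpha> w \<bullet> m = ?X m \<bullet> \<alpha> v"
    if m [simp]: "m \<in> Arr V" "Src V m = v" "Tgt V m = w" "v \<in> Obj V" "w \<in> Obj V" for m v w
  proof -
    have 1: "inv_arrow V (ev g w) \<bullet> m = ?D (?L m) \<bullet> inv_arrow V (ev g v)"
    proof (rule V.iso_cancel_left[of "ev g w"])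
      show "ev g w \<bullet> inv_arrow V (ev g w) \<bullet> m = ev g w \<bullet> ?D (?L m) \<bullet> inv_arrow V (ev g v)"
        by (simp add: ev_nat[of g m v w, THEN V.reduce2])
    qed simp_all
    have 2: "?D (b (?g w)) \<bullet> ?D (?L m) = ?D (?L (?X (?D (?L m)))) \<bullet> ?D (b (?g v))"
      using whisker_right_eq[OF b_nat[of "?L m" "?g v" "?g w"], of "dual g"] by simp
    have 3: "ev g (?x (?d (?g w))) \<bullet> ?D (?L (?X (?D (?L m)))) = ?X (?D (?L m)) \<bullet> ev g (?x (?d (?g v)))"
      by (rule ev_nat) simp_all
    have 4: "?X (ev g w) \<bullet> ?X (?D (?L m)) = ?X m \<bullet> ?X (ev g v)"
      using whisker_right_eq[OF ev_nat[of g m v w], of x] by simp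
    show ?thesis
      by (simp add: \<alpha>_eq 1 2[THEN V.reduce2] 3[THEN V.reduce2] 4[THEN V.reduce2])
  qed
  then have \<alpha>: "\<alpha> \<in> char x" by (auto simp: char_iff V.Hom_iff) (simp add: \<alpha>_def)
  have "conj_map g x \<alpha> = \<beta>"
  proof (rule char_eqI[OF conj_map_closed[OF g \<alpha>] \<beta>])
    fix v assume v [simp]: "v \<in> Obj V"
    note [simp] = conj_map_simps[OF g _ \<alpha>]
    let ?c = "coev g v" and ?y = "?x (?d (?g (?d v)))"
    \<comment> \<open>At objects g^* \<odot> v the inverse evaluation in \<alpha> is g^* applied to
      the coevaluation. Naturality carries this coevaluation past \<open>b\<close> and
      \<open>coev g\<close> until each evaluation meets a coevaluation in one of the two zigzag
      identities.\<close>
    have i: "inv_arrow V (ev g (?d v)) = ?D ?c"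
      using V.iso_eq_inv_left[of "ev g (?d v)" "?D ?c" "Idn V (?d v)"] act_zigzag_dual[of g v] by simp
    have 1: "?D (b (?g (?d v))) \<bullet> ?D ?c = ?D (?L (?X (?D ?c)) \<bullet> b v)"
      by (rule whisker_right_eq[OF b_nat]) simp_all
    have 2: "?L (?D (?L (?X (?D ?c)) \<bullet> b v)) \<bullet> ?c = coev g (?g ?y) \<bullet> ?L (?X (?D ?c)) \<bullet> b v"
      by (rule act_unit_nat) simp_all
    have 3: "?X (ev g (?d v)) \<bullet> ?X (?D ?c) = ?X (Idn V (?d v))"
      by (rule whisker_right_eq[OF act_zigzag_dual]) simp_all
    have "?L (\<alpha> (?d v)) \<bullet> ?c = ?L (?X (ev g (?d v))) \<bullet> ?L (ev g ?y) \<bullet> ?L (?D (b (?g (?d v))) \<bullet> ?D ?c) \<bullet> ?c"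
      by (simp add: \<alpha>_eq i)
    also have "\<dots> = ?L (?X (ev g (?d v))) \<bullet> ?L (ev g ?y) \<bullet> coev g (?g ?y) \<bullet> ?L (?X (?D ?c)) \<bullet> b v"
      by (simp only: 1 2)
    also have "\<dots> = ?L (?X (ev g (?d v)) \<bullet> ?X (?D ?c)) \<bullet> b v"
      by (simp add: act_zigzag[of g ?y, THEN V.reduce2])
    also have "\<dots> = b v" by (simp add: 3)
    finally have "unconj g x v \<bullet> conj_map g x \<alpha> v = unconj g x v \<bullet> \<beta> v"
      by (simp add: unconj_conj_map[OF g _ \<alpha>] b_def)
    then show "conj_map g x \<alpha> v = \<beta> v"
      by (rule V.iso_cancel_left[rotated 5]) simp_all
  qed
  then show ?thesis using \<alpha> by blast
qed

section \<open>The axioms of a class functor, on natural transformations\<close>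

lemma conj_map_push:
  assumes g [simp]: "g \<in> Obj G" and f [simp]: "f \<in> Arr G" and \<alpha>: "\<alpha> \<in> char (Src G f)"
  shows "conj_map g (Tgt G f) (push f \<alpha>)
    = push (TenA G (TenA G (Idn G g) f) (Idn G (dual g))) (conj_map g (Src G f) \<alpha>)"
proof (rule char_eqI)
  let ?x = "Src G f" and ?y = "Tgt G f" and ?t = "TenA G (TenA G (Idn G g) f) (Idn G (dual g))"
  have x [simp]: "?x \<in> Obj G" "?y \<in> Obj G" by simp_all
  have p: "push f \<alpha> \<in> char ?y" by (rule push_closed) (simp_all add: \<alpha>)
  show "conj_map g ?y (push f \<alpha>) \<in> char (conj_obj G g ?y)" by (rule conj_map_closed) (simp_all add: p)
  have c: "conj_map g ?x \<alpha> \<in> char (conj_obj G g ?x)" by (rule conj_map_closed) (simp_all add: \<alpha>)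
  have t [simp]: "?t \<in> Arr G" "Src G ?t = conj_obj G g ?x" "Tgt G ?t = conj_obj G g ?y"
    by (simp_all add: conj_obj_def)
  show "push ?t (conj_map g ?x \<alpha>) \<in> char (conj_obj G g ?y)"
    using push_closed[of ?t "conj_map g ?x \<alpha>"] c by simp
  note [simp] = char_simps[OF \<alpha>] char_simps[OF p] conj_map_simps[OF g _ _ \<alpha>] conj_map_simps[OF g _ _ p]
  fix v assume v [simp]: "v \<in> Obj V"
  have pt: "push ?t (conj_map g ?x \<alpha>) v = (?t \<odot>\<^sub>a Idn V v) \<bullet> conj_map g ?x \<alpha> v"
    by (simp add: push_def)
  show "conj_map g ?y (push f \<alpha>) v = push ?t (conj_map g ?x \<alpha>) v"
  proof (rule V.iso_cancel_left[of "unconj g ?y v"])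
    have "unconj g ?y v \<bullet> conj_map g ?y (push f \<alpha>) v
        = (Idn G g \<odot>\<^sub>a (f \<odot>\<^sub>a Idn V (dual g \<odot>\<^sub>o v))) \<bullet> unconj g ?x v \<bullet> conj_map g ?x \<alpha> v"
      by (simp add: unconj_conj_map[OF g _ _ p] unconj_conj_map[OF g _ _ \<alpha>]) (simp add: push_def)
    also have "\<dots> = unconj g ?y v \<bullet> (?t \<odot>\<^sub>a Idn V v) \<bullet> conj_map g ?x \<alpha> v"
      using unconj_nat[of "Idn G g" f "Idn G (dual g)" "Idn V v", THEN V.reduce2, of "conj_map g ?x \<alpha> v"] t
      by (simp del: t add: conj_obj_def)
    finally show "unconj g ?y v \<bullet> conj_map g ?y (push f \<alpha>) v = unconj g ?y v \<bullet> push ?t (conj_map g ?x \<alpha>) v"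
      by (simp only: pt)
  qed (simp_all add: pt conj_obj_def)
qed

text \<open>\<open>unconj_conj_tensor\<close> reduces the canonical isomorphism to the comparison of
  duals. Naturality of \<alpha> moves this comparison onto the coevaluation of g \<otimes> h, where
  \<open>dual_act_coev\<close> splits it into those of g and h.\<close>

lemma conj_map_tensor:
  assumes g [simp]: "g \<in> Obj G" and h [simp]: "h \<in> Obj G" and x [simp]: "x \<in> Obj G" and \<alpha>: "\<alpha> \<in> char x"
  shows "conj_map g (conj_obj G h x) (conj_map h x \<alpha>) = push (conj_tensor_iso G g h x) (conj_map (g \<boxtimes> h) x \<alpha>)"
proof (rule char_eqI)
  let ?t = "conj_tensor_iso G g h x"
  have c: "conj_map h x \<alpha> \<in> char (conj_obj G h x)" by (rule conj_map_closed) (simp_all add: \<alpha>)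
  show "conj_map g (conj_obj G h x) (conj_map h x \<alpha>) \<in> char (conj_obj G g (conj_obj G h x))"
    by (rule conj_map_closed) (simp_all add: c)
  have gh: "conj_map (g \<boxtimes> h) x \<alpha> \<in> char (conj_obj G (g \<boxtimes> h) x)" by (rule conj_map_closed) (simp_all add: \<alpha>)
  show "push ?t (conj_map (g \<boxtimes> h) x \<alpha>) \<in> char (conj_obj G g (conj_obj G h x))"
    using push_closed[of ?t "conj_map (g \<boxtimes> h) x \<alpha>"] gh by simp
  note [simp] = char_simps[OF \<alpha>] conj_map_simps[OF _ _ _ \<alpha>] conj_map_simps[OF _ _ _ c]
  fix v assume v [simp]: "v \<in> Obj V"
  let ?L = "\<lambda>f. Idn G g \<odot>\<^sub>a f" and ?LH = "\<lambda>f. Idn G h \<odot>\<^sub>a f" and ?GH = "\<lambda>f. Idn G (g \<boxtimes> h) \<odot>\<^sub>a f"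
  let ?w = "dual g \<odot>\<^sub>o v" and ?A = "ActAssoc V" and ?u = "unconj (g \<boxtimes> h) x v"
  let ?z = "dual h \<odot>\<^sub>o ?w" and ?y = "dual (g \<boxtimes> h) \<odot>\<^sub>o v" and ?\<delta> = "dual_act g h v"
  let ?U = "?L (unconj h x ?w) \<bullet> unconj g (conj_obj G h x) v"
  have pt: "push ?t (conj_map (g \<boxtimes> h) x \<alpha>) v = (?t \<odot>\<^sub>a Idn V v) \<bullet> conj_map (g \<boxtimes> h) x \<alpha> v"
    by (simp add: push_def)
  show "conj_map g (conj_obj G h x) (conj_map h x \<alpha>) v = push ?t (conj_map (g \<boxtimes> h) x \<alpha>) v"
  proof (rule V.iso_cancel_left[of ?U])
    have "?U \<bullet> push ?t (conj_map (g \<boxtimes> h) x \<alpha>) v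
        = ?A g h (x \<odot>\<^sub>o ?z) \<bullet> ?GH (Idn G x \<odot>\<^sub>a ?\<delta>) \<bullet> ?u \<bullet> conj_map (g \<boxtimes> h) x \<alpha> v"
      by (simp add: pt unconj_conj_tensor[of g h x v, THEN V.reduce3])
    also have "\<dots> = ?A g h (x \<odot>\<^sub>o ?z) \<bullet> ?GH (Idn G x \<odot>\<^sub>a ?\<delta>) \<bullet> ?GH (\<alpha> ?y) \<bullet> coev (g \<boxtimes> h) v"
      by (simp add: unconj_conj_map[OF _ _ _ \<alpha>])
    also have "\<dots> = ?A g h (x \<odot>\<^sub>o ?z) \<bullet> ?GH (\<alpha> ?z) \<bullet> ?GH ?\<delta> \<bullet> coev (g \<boxtimes> h) v"
      by (simp add: whisker_right_eq[OF char_nat[OF \<alpha>, of ?\<delta> ?y ?z, symmetric], of "g \<boxtimes> h", THEN V.reduce2])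
    also have "\<dots> = ?L (?LH (\<alpha> ?z)) \<bullet> ?A g h ?z \<bullet> ?GH ?\<delta> \<bullet> coev (g \<boxtimes> h) v"
      by (simp add: ActAssoc_nat_right[of "\<alpha> ?z" ?z "x \<odot>\<^sub>o ?z" g h, THEN V.reduce2])
    also have "\<dots> = ?L (?LH (\<alpha> ?z)) \<bullet> ?L (coev h ?w) \<bullet> coev g v"
      by (simp add: dual_act_coev)
    also have "\<dots> = ?L (unconj h x ?w) \<bullet> ?L (conj_map h x \<alpha> ?w) \<bullet> coev g v"
      by (simp add: whisker_right_eq[OF unconj_conj_map[OF h x _ \<alpha>, of ?w], of g, THEN V.reduce2])
    also have "\<dots> = ?U \<bullet> conj_map g (conj_obj G h x) (conj_map h x \<alpha>) v"
      by (simp add: unconj_conj_map[OF _ _ _ c])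
    finally show "?U \<bullet> conj_map g (conj_obj G h x) (conj_map h x \<alpha>) v
        = ?U \<bullet> push ?t (conj_map (g \<boxtimes> h) x \<alpha>) v" ..
  qed (simp_all add: pt)
qed

text \<open>a^* passes \<alpha> by naturality and a passes it by interchange, so the pair reaches
  the coevaluation of the source, which \<open>star_coev\<close> turns into that of the
  target.\<close>

lemma conj_map_star:
  assumes a [simp]: "a \<in> Arr G" and x [simp]: "x \<in> Obj G" and \<alpha>: "\<alpha> \<in> char x"
  shows "push (TenA G (TenA G a (Idn G x)) (star_arrow G a)) (conj_map (Src G a) x \<alpha>) = conj_map (Tgt G a) x \<alpha>"
proof (rule char_eqI)
  let ?t = "TenA G (TenA G a (Idn G x)) (star_arrow G a)" and ?g = "Src G a" and ?h = "Tgt G a"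
  have c: "conj_map ?g x \<alpha> \<in> char (conj_obj G ?g x)" by (rule conj_map_closed) (simp_all add: \<alpha>)
  have t: "?t \<in> Arr G" "Src G ?t = conj_obj G ?g x" "Tgt G ?t = conj_obj G ?h x"
    by (simp_all add: conj_obj_def)
  show "push ?t (conj_map ?g x \<alpha>) \<in> char (conj_obj G ?h x)"
    using push_closed[OF t(1)] c by (simp only: t)
  show "conj_map ?h x \<alpha> \<in> char (conj_obj G ?h x)" by (rule conj_map_closed) (simp_all add: \<alpha>)
  note [simp] = char_simps[OF \<alpha>] conj_map_simps[OF _ _ _ \<alpha>]
  fix v assume v [simp]: "v \<in> Obj V"
  let ?s = "star_arrow G a \<odot>\<^sub>a Idn V v"
  have pt: "push ?t (conj_map ?g x \<alpha>) v = (?t \<odot>\<^sub>a Idn V v) \<bullet> conj_map ?g x \<alpha> v"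
    by (simp add: push_def)
  have n: "unconj ?h x v \<bullet> (?t \<odot>\<^sub>a Idn V v) = (a \<odot>\<^sub>a (Idn G x \<odot>\<^sub>a ?s)) \<bullet> unconj ?g x v"
    using unconj_nat[of a "Idn G x" "star_arrow G a" "Idn V v"] by simp
  have sp: "a \<odot>\<^sub>a f = (Idn G ?h \<odot>\<^sub>a f) \<bullet> (a \<odot>\<^sub>a Idn V (Src V f))" if "f \<in> Arr V" for f
    using that by (simp add: TA_Cmp_eq)
  have m: "(a \<odot>\<^sub>a (Idn G x \<odot>\<^sub>a ?s)) \<bullet> (Idn G ?g \<odot>\<^sub>a \<alpha> (dual ?g \<odot>\<^sub>o v))
      = (Idn G ?h \<odot>\<^sub>a \<alpha> (dual ?h \<odot>\<^sub>o v)) \<bullet> (a \<odot>\<^sub>a ?s)"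
    using char_nat[OF \<alpha>, of ?s "dual ?g \<odot>\<^sub>o v" "dual ?h \<odot>\<^sub>o v"] by (simp add: TA_Cmp_eq)
  show "push ?t (conj_map ?g x \<alpha>) v = conj_map ?h x \<alpha> v"
  proof (rule V.iso_cancel_left[of "unconj ?h x v"])
    have "unconj ?h x v \<bullet> push ?t (conj_map ?g x \<alpha>) v
        = (a \<odot>\<^sub>a (Idn G x \<odot>\<^sub>a ?s)) \<bullet> unconj ?g x v \<bullet> conj_map ?g x \<alpha> v"
      unfolding pt by (subst n[THEN V.reduce2]) (simp_all add: conj_obj_def)
    also have "\<dots> = (a \<odot>\<^sub>a (Idn G x \<odot>\<^sub>a ?s)) \<bullet> (Idn G ?g \<odot>\<^sub>a \<alpha> (dual ?g \<odot>\<^sub>o v)) \<bullet> coev ?g v"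
      by (simp add: unconj_conj_map[OF _ x v \<alpha>])
    also have "\<dots> = (Idn G ?h \<odot>\<^sub>a \<alpha> (dual ?h \<odot>\<^sub>o v)) \<bullet> (a \<odot>\<^sub>a ?s) \<bullet> coev ?g v"
      by (simp add: m[THEN V.reduce2])
    also have "\<dots> = unconj ?h x v \<bullet> conj_map ?h x \<alpha> v"
      by (simp add: star_coev unconj_conj_map[OF _ x v \<alpha>])
    finally show "unconj ?h x v \<bullet> push ?t (conj_map ?g x \<alpha>) v = unconj ?h x v \<bullet> conj_map ?h x \<alpha> v" .
  qed (simp_all add: pt conj_obj_def)
qed

lemma push_conj_self:
  assumes g [simp]: "g \<in> Obj G" and \<alpha>: "\<alpha> \<in> char g"
  shows "push (conj_self_iso G g) (conj_map g g \<alpha>) = \<alpha>"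
proof (rule char_eqI)
  have c: "conj_map g g \<alpha> \<in> char (conj_obj G g g)" by (rule conj_map_closed) (simp_all add: \<alpha>)
  show "push (conj_self_iso G g) (conj_map g g \<alpha>) \<in> char g"
    using push_closed[of "conj_self_iso G g"] c by simp
  show "\<alpha> \<in> char g" by fact
  note [simp] = char_simps[OF \<alpha>] conj_map_simps[OF g g _ \<alpha>]
  fix v assume v [simp]: "v \<in> Obj V"
  let ?L = "\<lambda>f. Idn G g \<odot>\<^sub>a f" and ?c = "coev g v"
  \<comment> \<open>The \<open>unconj\<close> supplied by \<open>conj_self_act\<close> cancels
    against its inverse in \<open>conj_map\<close>.\<close>
  have "push (conj_self_iso G g) (conj_map g g \<alpha>) v
      = ?L (inv_arrow V ?c) \<bullet> ?L (\<alpha> (dual g \<odot>\<^sub>o v)) \<bullet> ?c"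
    by (simp add: push_def conj_self_act unconj_conj_map[OF g g v \<alpha>])
  also have "\<dots> = ?L (inv_arrow V ?c) \<bullet> \<alpha> (g \<odot>\<^sub>o (dual g \<odot>\<^sub>o v)) \<bullet> ?c"
    by (simp add: char_self[OF g \<alpha>])
  also have "\<dots> = ?L (inv_arrow V ?c) \<bullet> ?L ?c \<bullet> \<alpha> v"
    using char_nat[OF \<alpha>, of ?c] by simp
  also have "\<dots> = \<alpha> v"
    by (simp add: whisker_right_eq[OF V.inv_simps(4), of ?c g, THEN V.reduce2])
  finally show "push (conj_self_iso G g) (conj_map g g \<alpha>) v = \<alpha> v" .
qed

section \<open>Assembly of the class functor and the fixed point property\<close>

lemma char_functr_simps:
  "FObj (char_functr G V) x = char_space G V x"
  "FArr (char_functr G V) f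
    = (char_space G V (Src G f), \<lambda>\<alpha>\<in>char (Src G f). push f \<alpha>, char_space G V (Tgt G f))"
  by (simp_all add: char_functr_def push_def char_space_simps)

lemma char_conj_eq:
  assumes "g \<in> Obj G" "x \<in> Obj G"
  shows "char_conj G V g x
    = (char_space G V x, \<lambda>\<alpha>\<in>char x. conj_map g x \<alpha>, char_space G V (conj_obj G g x))"
  using assms by (simp add: char_conj_def conj_map_def char_space_simps act_conj_iso_eq act_coev_iso_eq
      cong: restrict_cong)

lemma functor_char: "functor_between G (Vec K) (char_functr G V)"
proof -
  interpret Vc: category "Vec K :: (('k, 'vo \<Rightarrow> 'vm) module, ('k, 'vo \<Rightarrow> 'vm) vec_arrow) cat"
    by (rule category_Vec)
  show ?thesis
  proof unfold_locales
    show "FObj (char_functr G V) x \<in> Obj (Vec K)" if "x \<in> Obj G" for x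
      using char_space_fd[OF that] by (simp add: char_functr_simps Vec_def)
    show "FArr (char_functr G V) f \<in> Hom (Vec K) (FObj (char_functr G V) x) (FObj (char_functr G V) y)"
      if "f \<in> Hom G x y" for f x y
      using push_linear[of f] that by (simp add: char_functr_simps G.Hom_iff)
    show "FArr (char_functr G V) (Idn G x) = Idn (Vec K) (FObj (char_functr G V) x)" if x [simp]: "x \<in> Obj G" for x
    proof -
      have "push (Idn G x) \<alpha> = \<alpha>" if \<alpha>: "\<alpha> \<in> char x" for \<alpha>
        by (rule char_eqI[of _ x _ x]) (use push_closed[of "Idn G x"] \<alpha> char_simps[OF \<alpha>] in \<open>simp_all add: push_def\<close>)
      then show ?thesis by (auto simp: char_functr_simps Vec_def char_space_simps intro!: restrict_ext)
    qed
    show "FArr (char_functr G V) (f' \<bullet>\<^bsub>G\<^esub> f) = FArr (char_functr G V) f' \<bullet>\<^bsub>Vec K\<^esub> FArr (char_functr G V) f"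
      if f: "f \<in> Hom G x y" "f' \<in> Hom G y z" for f f' x y z
    proof -
      have [simp]: "f \<in> Arr G" "Src G f = x" "Tgt G f = y" "f' \<in> Arr G" "Src G f' = y" "Tgt G f' = z"
        using f by (simp_all add: G.Hom_iff)
      have "push (f' \<bullet>\<^bsub>G\<^esub> f) \<alpha> = push f' (push f \<alpha>)" if \<alpha>: "\<alpha> \<in> char x" for \<alpha>
        unfolding push_def by (rule restrict_ext) (use char_simps[OF \<alpha>] in simp)
      then show ?thesis
        using push_closed[of f] by (auto simp: char_functr_simps Vec_Cmp char_space_simps compose_def intro!: restrict_ext)
    qed
  qed
qed

lemma class_functor_two_character: "class_functor K G (two_character G V)"
  unfolding class_functor_def two_character_def case_prod_conv
proof (intro conjI ballI)
  show "functor_between G (Vec K) (char_functr G V)" by (rule functor_char)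
next
  fix g x assume gx [simp]: "g \<in> Obj G" "x \<in> Obj G"
  show "char_conj G V g x \<in> Hom (Vec K) (FObj (char_functr G V) x) (FObj (char_functr G V) (conj_obj G g x))"
    using conj_map_linear[OF gx] by (simp add: char_functr_simps char_conj_eq)
  have "bij_betw (\<lambda>\<alpha>\<in>char x. conj_map g x \<alpha>) (char x) (char (conj_obj G g x))"
    unfolding bij_betw_def using conj_map_inj[OF gx] conj_map_surj[OF gx] conj_map_closed[OF gx]
    by (auto simp: inj_on_def image_iff) metis
  then show "iso_arrow (Vec K) (char_conj G V g x)"
    unfolding char_conj_eq[OF gx] by (intro iso_VecI conj_map_linear gx) (simp add: char_space_simps)
next
  fix g x y f assume g [simp]: "g \<in> Obj G" "x \<in> Obj G" "y \<in> Obj G" and f: "f \<in> Hom G x y"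
  have [simp]: "f \<in> Arr G" "Src G f = x" "Tgt G f = y" using f by (simp_all add: G.Hom_iff)
  show "char_conj G V g y \<bullet>\<^bsub>Vec K\<^esub> FArr (char_functr G V) f
      = FArr (char_functr G V) (TenA G (TenA G (Idn G g) f) (Idn G (dual g))) \<bullet>\<^bsub>Vec K\<^esub> char_conj G V g x"
    using push_closed[of f] conj_map_closed[of g x] conj_map_push[of g f]
    by (auto simp: char_functr_simps char_conj_eq Vec_Cmp char_space_simps compose_def conj_obj_def intro!: restrict_ext)
next
  fix g h x assume [simp]: "g \<in> Obj G" "h \<in> Obj G" "x \<in> Obj G"
  show "char_conj G V g (conj_obj G h x) \<bullet>\<^bsub>Vec K\<^esub> char_conj G V h x
      = FArr (char_functr G V) (conj_tensor_iso G g h x) \<bullet>\<^bsub>Vec K\<^esub> char_conj G V (g \<boxtimes> h) x"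
    using conj_map_closed[of h x] conj_map_closed[of "g \<boxtimes> h" x] conj_map_tensor[of g h x]
    by (auto simp: char_functr_simps char_conj_eq Vec_Cmp char_space_simps compose_def intro!: restrict_ext)
next
  fix g h x a assume [simp]: "g \<in> Obj G" "h \<in> Obj G" "x \<in> Obj G" and a: "a \<in> Hom G g h"
  have [simp]: "a \<in> Arr G" "Src G a = g" "Tgt G a = h" using a by (simp_all add: G.Hom_iff)
  show "FArr (char_functr G V) (TenA G (TenA G a (Idn G x)) (star_arrow G a)) \<bullet>\<^bsub>Vec K\<^esub> char_conj G V g x
      = char_conj G V h x"
    using conj_map_closed[of g x] conj_map_star[of a x]
    by (auto simp: char_functr_simps char_conj_eq Vec_Cmp char_space_simps compose_def conj_obj_def intro!: restrict_ext)
qed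

lemma BZ_fixed_point_two_character: "BZ_fixed_point K G (two_character G V)"
proof -
  have "FArr (char_functr G V) (conj_self_iso G g) \<bullet>\<^bsub>Vec K\<^esub> char_conj G V g g
      = Idn (Vec K) (FObj (char_functr G V) g)" if g [simp]: "g \<in> Obj G" for g
    using conj_map_closed[OF g g] push_conj_self[OF g]
    by (auto simp: char_functr_simps char_conj_eq Vec_Cmp char_space_simps compose_def intro!: restrict_ext)
      (auto simp: Vec_def char_space_simps)
  then show ?thesis
    using class_functor_two_character
    by (auto simp: BZ_fixed_point_def BZ_automorphism_def ClassFun_def two_character_def intro!: restrict_ext)
qed

end

theorem theorem4p10:
  fixes K :: "('k, 'x) ring_scheme"
    and G :: "('go, 'gm, 'y) dual_moncat_scheme"
    and V :: "('k, 'go, 'gm, 'vo, 'vm, 'z) modcat_scheme"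
  assumes "alg_closed_field_char_0 K"
    and "two_group G"
    and "two_representation K G V"
  shows "BZ_fixed_point K G (two_character G V)"
  using two_representation.BZ_fixed_point_two_character[OF assms(3)] .

end
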